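(* Assume $V$ is $C^2$ with $\nabla^2V\succeq\alpha I$ for some $\alpha>0$. Let $\pi^\star(\mathrm{d}z)=\mathrm{p}^\star(\mathrm{d}z_1)\,\mathrm{q}^\star(\mathrm{d}z_{-1}\mid z_1)$ be a minimizer of $\mathrm{KL}(\cdot\|\pi)$ over $\mathcal{C}_{\rm star}$, with $\mathrm{q}^\star(\cdot\mid z_1)=\bigotimes_{i=2}^d\mathrm{q}^\star_i(\cdot\mid z_1)$, and suppose $\pi^\star$ has a differentiable Lebesgue density. Then $$\mathrm{p}^\star(z_1)\propto\exp\Big(-\int_0^{z_1}\int\partial_1V(s,z_{-1})\,\mathrm{q}^\star(\mathrm{d}z_{-1}\mid s)\,\mathrm{d}s\Big),$$ and for every $i\in\{2,\dots,d\}$, $$\mathrm{q}^\star_i(z_i\mid z_1)\propto\exp\Big(-\int V(z_1,z_i,z_{-\{1,i\}})\prod_{j\ge2,\,j\ne i}\mathrm{q}^\star_j(\mathrm{d}z_j\mid z_1)\Big).$$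
   Context: Let $d\ge 2$ and $\pi(z)\propto\exp(-V(z))$ on $\mathbb{R}^d$, where $V$ satisfies the growth condition: for every $c_2>0$ there is $c_1>0$ with $|V(z)|\le c_1e^{c_2\|z\|^2}$ for all $z$. Write $z=(z_1,z_{-1})$, $z_{-1}=(z_2,\dots,z_d)$, and $z_{-\{1,i\}}$ for $z$ with coordinates $1$ and $i$ removed; $\partial_1 V$ is the partial derivative in the first coordinate. $\mathcal{C}_{\rm star}$ is the set of probability measures $\mu$ on $\mathbb{R}^d$ of the form $\mu(\mathrm{d}z)=\mu_1(\mathrm{d}z_1)\prod_{j=2}^d\mu_j(\mathrm{d}z_j\mid z_1)$. Proportionality is in the free variable ($z_1$, resp. $z_i$ for fixed $z_1$). *)

theory Defs
  imports "HOL-Probability.Probability"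
begin

text \<open>Points of R^d are vectors of type real^'n (d = CARD('n)); the distinguished
  "first" coordinate is an index i1 :: 'n.\<close>

definition vembed :: "'n::finite \<Rightarrow> real \<Rightarrow> ('n \<Rightarrow> real) \<Rightarrow> real^'n" where
  "vembed i1 s y = (\<chi> j. if j = i1 then s else y j)"

definition vembed2 :: "'n::finite \<Rightarrow> 'n \<Rightarrow> real \<Rightarrow> real \<Rightarrow> ('n \<Rightarrow> real) \<Rightarrow> real^'n" where
  "vembed2 i1 i s t y = (\<chi> j. if j = i1 then s else if j = i then t else y j)"

definition star_measure ::
  "'n::finite \<Rightarrow> real measure \<Rightarrow> ('n \<Rightarrow> real \<Rightarrow> real measure) \<Rightarrow> (real^'n) measure" where
  "star_measure i1 mu1 K =
     bind mu1 (\<lambda>z1. distr (PiM (UNIV - {i1}) (\<lambda>j. K j z1)) borel (vembed i1 z1))"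

definition star_data :: "'n::finite \<Rightarrow> real measure \<Rightarrow> ('n \<Rightarrow> real \<Rightarrow> real measure) \<Rightarrow> bool" where
  "star_data i1 mu1 K \<longleftrightarrow>
     prob_space mu1 \<and> sets mu1 = sets borel \<and>
     (\<forall>j. j \<noteq> i1 \<longrightarrow> K j \<in> borel \<rightarrow>\<^sub>M prob_algebra borel)"

definition C_star :: "'n::finite \<Rightarrow> (real^'n) measure set" where
  "C_star i1 = {mu. \<exists>mu1 K. star_data i1 mu1 K \<and> mu = star_measure i1 mu1 K}"

definition KL :: "'a measure \<Rightarrow> 'a measure \<Rightarrow> ereal" where
  "KL mu nu =
    (if absolutely_continuous nu mu \<and> sets mu = sets nu \<and>
        integrable mu (\<lambda>x. ln (enn2real (RN_deriv nu mu x)))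
     then ereal (\<integral>x. ln (enn2real (RN_deriv nu mu x)) \<partial>mu)
     else \<infinity>)"

definition gibbs :: "(real^'n::finite \<Rightarrow> real) \<Rightarrow> (real^'n) measure" where
  "gibbs V = density lborel
     (\<lambda>z. ennreal (exp (- V z) / (\<integral>x. exp (- V x) \<partial>lborel)))"

end

theory Submission
  imports Defs
begin

text \<open>Write \<open>v s y\<close> for \<open>V\<close> at the point with first coordinate \<open>s\<close> and remaining coordinates \<open>y\<close>.
  For conditional densities with product \<open>f s\<close>, let \<open>F s = \<integral> f s (ln (f s) + v s)\<close>. Up to a constant, the
  divergence of a star-shaped measure with first marginal \<open>r\<close> is \<open>\<integral> r (ln r + F)\<close>, so the Gibbs variational
  principle gives \<open>r \<propto> exp (- F)\<close>. Applied for fixed \<open>s\<close> to one coordinate, it gives the formula for the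
  conditionals, together with locally uniform Gaussian bounds for them, since \<open>V\<close> grows at least
  quadratically and \<open>F\<close> is locally bounded above by comparison with the uniform kernel.

  Differentiability of \<open>F\<close> is replaced by an envelope argument: optimality against the translated
  kernel \<open>s \<mapsto> f (s - h)\<close> yields \<open>F (s + h) - F s \<le> \<integral> f s (v (s + h) - v s)\<close> for almost every \<open>s\<close>, for
  both signs of \<open>h\<close>. Hence \<open>F\<close> is locally Lipschitz off a null set; integrating over \<open>s \<in> [x, y)\<close>,
  dividing by \<open>h\<close> and letting \<open>h \<rightarrow> 0\<close> from both sides identifies \<open>F y - F x\<close> with the integral
  over \<open>[x, y)\<close> of \<open>\<integral> f s \<partial>\<^sub>1 V\<close>.\<close>

section \<open>Relative entropy densities and the Gibbs variational principle\<close>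

text \<open>The minimizer is known only up to null sets and \<open>s \<mapsto> f s\<close> has no
  regularity to differentiate. So each comparison uses a whole measurable kernel, often pasted from
  two kernels along a measurable set of \<open>s\<close>, and concludes only off a null set that
  depends on the competitor, for translations on \<open>h\<close>. Fubini exchanges "for every
  \<open>h\<close>, almost every \<open>s\<close>" for "almost every \<open>s\<close>, almost every
  \<open>h\<close>", which is enough once values of \<open>F\<close> enter only as limits of
  averages over intervals.

  The growth condition concerns \<open>V\<close> and not its derivative; convexity supplies the
  missing bound, squeezing the slope on \<open>[-R, R]\<close> between increments of
  \<open>V\<close> over unit intervals on either side. Domination also needs a kernel bound whose
  constant does not depend on \<open>s\<close>. It rests on an identity at the optimum: the
  partition function of any single coordinate equals \<open>exp (- F s)\<close>, so an upper bound
  on \<open>F\<close> bounds the conditional densities pointwise.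

  Energies are handled as nonnegative, possibly infinite integrals; real free energies are used only
  where these are finite.\<close>

text \<open>\<open>x ln (x / exp (- u)) - x + exp (- u)\<close>: the last two terms make the integrand of the divergence from \<open>exp (- u)\<close>
  nonnegative, so that it can be integrated without any integrability assumption.\<close>

definition relent :: "real \<Rightarrow> real \<Rightarrow> real" where
  "relent x u = x * (ln x + u - 1) + exp (- u)"

text \<open>With \<open>t = ln x + u\<close> the value is
  \<open>exp (- u) * (exp t * (t - 1) + 1)\<close>, and the bracket is nonnegative by
  \<open>1 - t \<le> exp (- t)\<close>.\<close>

lemma relent_nonneg: assumes "0 \<le> x" shows "0 \<le> relent x u"
proof (cases "x = 0")
  case False
  define t where "t = ln x + u"
  have x: "x = exp t * exp (- u)" using False assms by (simp add: t_def exp_add exp_minus)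
  have "exp t * (1 - t) \<le> exp t * exp (- t)"
    using exp_ge_add_one_self[of "- t"] by (intro mult_left_mono) auto
  then have "0 \<le> exp t * (t - 1) + 1"
    by (simp add: exp_minus algebra_simps)
  then have "0 \<le> exp (- u) * (exp t * (t - 1) + 1)" by simp
  also have "\<dots> = relent x u" 
    unfolding relent_def using x by (simp add: t_def algebra_simps)
  finally show ?thesis .
qed (simp add: relent_def)

lemma relent_0 [simp]: "relent 0 u = exp (- u)"
  by (simp add: relent_def)

text \<open>Equality case of the same inequality: \<open>1 - t = exp (- t)\<close> only at
  \<open>t = 0\<close>. This is what makes optimal densities unique.\<close>

lemma relent_eq_0_imp: assumes "0 < x" "relent x u = 0" shows "x = exp (- u)"
proof -
  define t where "t = ln x + u"
  have x: "x = exp t * exp (- u)" using assms by (simp add: t_def exp_add exp_minus)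
  have "relent x u = exp (- u) * (exp t * (t - 1) + 1)"
    unfolding relent_def using x by (simp add: t_def algebra_simps)
  then have "exp t * (t - 1) + 1 = 0" using assms by simp
  then have "exp (- t) * (exp t * (t - 1) + 1) = 0" by simp
  then have "(t - 1) + exp (- t) = 0" by (simp add: distrib_left mult.assoc[symmetric] exp_minus)
  then have "exp (- t) = 1 + (- t)" by simp
  then have "t = 0" using exp_minus_ge exp_ge_add_one_self
    by (metis exp_eq_one_iff exp_minus_greater less_irrefl diff_conv_add_uminus)
  then show ?thesis using x by simp
qed

text \<open>Pointwise chain rule: scaling by \<open>r\<close> adds \<open>r * ln r\<close> per unit
  of mass, and \<open>(1 - r) * exp (- u)\<close> corrects for the term \<open>exp (- u)\<close>,
  which is not scaled.\<close>

lemma relent_mult: assumes "0 \<le> r" "0 \<le> x"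
  shows "relent (r * x) u = r * relent x u + r * ln r * x + (1 - r) * exp (- u)"
  using assms by (cases "r = 0"; cases "x = 0") (auto simp: relent_def ln_mult algebra_simps)

lemma measurable_relent[measurable]:
  assumes [measurable]: "f \<in> borel_measurable M" "g \<in> borel_measurable M"
  shows "(\<lambda>x. relent (f x) (g x)) \<in> borel_measurable M"
  unfolding relent_def by measurable

definition rel_ent :: "'a measure \<Rightarrow> ('a \<Rightarrow> real) \<Rightarrow> ('a \<Rightarrow> real) \<Rightarrow> ennreal" where
  "rel_ent N A u = (\<integral>\<^sup>+y. ennreal (relent (A y) (u y)) \<partial>N)"

text \<open>For a probability density \<open>A\<close> this is \<open>\<integral> A (ln A + u)\<close>; it is meaningless when \<open>rel_ent N A u = \<infinity>\<close>.\<close>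

definition free_energy :: "'a measure \<Rightarrow> ('a \<Rightarrow> real) \<Rightarrow> ('a \<Rightarrow> real) \<Rightarrow> real" where
  "free_energy N A u = enn2real (rel_ent N A u) + 1 - (\<integral>y. exp (- u y) \<partial>N)"

section \<open>One probability density against one potential\<close>

locale prob_density_potential =
  fixes N :: "'a measure" and A u :: "'a \<Rightarrow> real"
  assumes A_meas[measurable]: "A \<in> borel_measurable N" 
    and u_meas[measurable]: "u \<in> borel_measurable N"
    and A_nonneg: "\<And>y. 0 \<le> A y" 
    and A_prob: "(\<integral>\<^sup>+y. ennreal (A y) \<partial>N) = 1"
    and exp_int: "integrable N (\<lambda>y. exp (- u y))"
begin

lemma A_int: "integrable N A" and A_integral: "integral\<^sup>L N A = 1"
proof -
  have "has_bochner_integral N A 1"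
    by (rule has_bochner_integral_nn_integral) (auto simp: A_nonneg A_prob)
  then show "integrable N A" "integral\<^sup>L N A = 1" by (auto simp: has_bochner_integral_iff)
qed

lemma rel_ent_finite_imp: assumes "rel_ent N A u < \<infinity>"
  shows "integrable N (\<lambda>y. relent (A y) (u y))" 
    and "rel_ent N A u = ennreal (\<integral>y. relent (A y) (u y) \<partial>N)"
    and "enn2real (rel_ent N A u) = (\<integral>y. relent (A y) (u y) \<partial>N)"
proof -
  show 1: "integrable N (\<lambda>y. relent (A y) (u y))"
    using assms by (intro integrableI_nonneg) (auto simp: rel_ent_def relent_nonneg A_nonneg)
  show 2: "rel_ent N A u = ennreal (\<integral>y. relent (A y) (u y) \<partial>N)"
    unfolding rel_ent_def using 1 by (intro nn_integral_eq_integral) (auto simp: relent_nonneg A_nonneg)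
  show "enn2real (rel_ent N A u) = (\<integral>y. relent (A y) (u y) \<partial>N)"
    unfolding 2 by (simp add: Bochner_Integration.integral_nonneg relent_nonneg A_nonneg)
qed

text \<open>Integrating the chain rule leaves a function of the number \<open>r\<close> that depends
  on \<open>A\<close> only through its free energy. Nonnegativity is recorded because
  \<open>ennreal\<close> truncates negative reals and real values have to be recovered
  later.\<close>

lemma rel_ent_scale: assumes fin: "rel_ent N A u < \<infinity>" and r: "0 \<le> r"
  shows "rel_ent N (\<lambda>y. r * A y) u = ennreal (r * (ln r + free_energy N A u - 1) + (\<integral>y. exp (- u y) \<partial>N))"
    and "0 \<le> r * (ln r + free_energy N A u - 1) + (\<integral>y. exp (- u y) \<partial>N)"
proof -
  have eq: "relent (r * A y) (u y) = r * relent (A y) (u y) + r * ln r * A y + (1 - r) * exp (- u y)" for y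
    using relent_mult[OF r A_nonneg] .
  note I = rel_ent_finite_imp[OF fin] A_int exp_int
  have int: "integrable N (\<lambda>y. relent (r * A y) (u y))"
    unfolding eq using I by auto
  have val: "(\<integral>y. relent (r * A y) (u y) \<partial>N) = r * (ln r + free_energy N A u - 1) + (\<integral>y. exp (- u y) \<partial>N)"
    unfolding eq free_energy_def I(3) using I by (simp add: A_integral algebra_simps)
  have nn: "0 \<le> relent (r * A y) (u y)" for y by (simp add: relent_nonneg r A_nonneg)
  show "rel_ent N (\<lambda>y. r * A y) u = ennreal (r * (ln r + free_energy N A u - 1) + (\<integral>y. exp (- u y) \<partial>N))"
    unfolding rel_ent_def using int nn by (subst nn_integral_eq_integral) (auto simp: val)
  show "0 \<le> r * (ln r + free_energy N A u - 1) + (\<integral>y. exp (- u y) \<partial>N)"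
    unfolding val[symmetric] by (simp add: nn)
qed

text \<open>The chain rule is solved for the unscaled term, dividing by \<open>r\<close>. At
  \<open>r = 0\<close> the scaled value is just the integral of \<open>exp (- u)\<close>, finite for
  every \<open>A\<close>.\<close>

lemma rel_ent_unscale: assumes fin: "rel_ent N (\<lambda>y. r * A y) u < \<infinity>" and r: "0 < r"
  shows "rel_ent N A u < \<infinity>"
proof -
  have int: "integrable N (\<lambda>y. relent (r * A y) (u y))"
    using fin r by (intro integrableI_nonneg) (auto simp: rel_ent_def relent_nonneg A_nonneg)
  have eq: "relent (A y) (u y) = (relent (r * A y) (u y) - r * ln r * A y - (1 - r) * exp (- u y)) / r" for y
    using relent_mult[of r "A y" "u y"] r A_nonneg[of y] by (simp add: field_simps)
  have "integrable N (\<lambda>y. relent (A y) (u y))" unfolding eq using int A_int exp_int by auto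
  then show ?thesis unfolding rel_ent_def
    by (subst nn_integral_eq_integral) (auto simp: relent_nonneg A_nonneg)
qed

lemma free_energy_integral: assumes fin: "rel_ent N A u < \<infinity>"
  shows "integrable N (\<lambda>y. A y * (ln (A y) + u y))" 
    and "free_energy N A u = (\<integral>y. A y * (ln (A y) + u y) \<partial>N)"
proof -
  have eq: "A y * (ln (A y) + u y) = relent (A y) (u y) + A y - exp (- u y)" for y
    by (simp add: relent_def algebra_simps)
  note I = rel_ent_finite_imp[OF fin] A_int exp_int
  show "integrable N (\<lambda>y. A y * (ln (A y) + u y))" unfolding eq using I by auto
  show "free_energy N A u = (\<integral>y. A y * (ln (A y) + u y) \<partial>N)"
    unfolding eq free_energy_def I(3) using I by (simp add: A_integral)
qed

text \<open>Gibbs' inequality against \<open>exp (- h)\<close>. Keeping \<open>c\<close> apart lets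
  the part of a lower bound that does not involve the integration variable, such as
  \<open>a + b * s\<^sup>2\<close>, pass undiminished into the free energy; this gives
  \<open>exp (- F)\<close> its Gaussian decay.\<close>

lemma free_energy_ge: assumes fin: "rel_ent N A u < \<infinity>" and le: "\<And>y. y \<in> space N \<Longrightarrow> c + h y \<le> u y"
    and h: "integrable N (\<lambda>y. exp (- h y))"
  shows "c + 1 - (\<integral>y. exp (- h y) \<partial>N) \<le> free_energy N A u"
proof -
  have "(\<integral>y. c * A y + A y - exp (- h y) \<partial>N) \<le> (\<integral>y. A y * (ln (A y) + u y) \<partial>N)"
  proof (intro integral_mono free_energy_integral[OF fin])
    fix y assume y: "y \<in> space N"
    have "c * A y + A y - exp (- h y) \<le> A y * (ln (A y) + (c + h y))"
      using relent_nonneg[OF A_nonneg[of y], of "h y"] by (simp add: relent_def algebra_simps)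
    also have "\<dots> \<le> A y * (ln (A y) + u y)"
      using le[OF y] A_nonneg by (intro mult_left_mono) auto
    finally show "c * A y + A y - exp (- h y) \<le> A y * (ln (A y) + u y)" .
  qed (use A_int h in auto)
  then show ?thesis using A_int h by (simp add: free_energy_integral(2)[OF fin] A_integral)
qed

lemma free_energy_combine: assumes 1: "integrable N (\<lambda>y. A y * ln (A y))" and 2: "integrable N (\<lambda>y. A y * u y)"
  shows "rel_ent N A u < \<infinity>" and "free_energy N A u = (\<integral>y. A y * ln (A y) \<partial>N) + (\<integral>y. A y * u y \<partial>N)"
proof -
  have eq: "relent (A y) (u y) = A y * ln (A y) + A y * u y - A y + exp (- u y)" for y
    by (simp add: relent_def algebra_simps)
  have "integrable N (\<lambda>y. relent (A y) (u y))" unfolding eq using 1 2 A_int exp_int by auto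
  then show fin: "rel_ent N A u < \<infinity>" unfolding rel_ent_def
    by (subst nn_integral_eq_integral) (auto simp: relent_nonneg A_nonneg)
  show "free_energy N A u = (\<integral>y. A y * ln (A y) \<partial>N) + (\<integral>y. A y * u y \<partial>N)"
    unfolding free_energy_integral(2)[OF fin] using 1 2
    by (subst Bochner_Integration.integral_add[symmetric]) (auto simp: algebra_simps)
qed

text \<open>Excludes that energy and entropy are infinite with opposite signs. Gibbs' inequality
  against \<open>exp (- u / 2)\<close> bounds half of the energy by the total plus integrable terms,
  \<open>c\<close> controls its negative part, and the entropy follows by subtraction.\<close>

lemma free_energy_split: assumes fin: "rel_ent N A u < \<infinity>" and le: "\<And>y. y \<in> space N \<Longrightarrow> c \<le> u y"
    and half: "integrable N (\<lambda>y. exp (- (u y / 2)))"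
  shows "integrable N (\<lambda>y. A y * u y)" and "integrable N (\<lambda>y. A y * ln (A y))"
proof -
  note I = free_energy_integral[OF fin]
  show 1: "integrable N (\<lambda>y. A y * u y)"
  proof (rule Bochner_Integration.integrable_bound)
    show "integrable N (\<lambda>y. 2 * (\<bar>A y * (ln (A y) + u y)\<bar> + A y + exp (- (u y / 2))) + \<bar>c\<bar> * A y)"
      using I A_int half by auto
    show "AE y in N. norm (A y * u y) \<le> norm (2 * (\<bar>A y * (ln (A y) + u y)\<bar> + A y + exp (- (u y / 2))) + \<bar>c\<bar> * A y)"
    proof (rule AE_I2)
      fix y assume y: "y \<in> space N"
      have "A y * (u y / 2) = A y * (ln (A y) + u y) - A y * (ln (A y) + u y / 2)" by (simp add: field_simps)
      also have "\<dots> \<le> \<bar>A y * (ln (A y) + u y)\<bar> + A y + exp (- (u y / 2))"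
        using relent_nonneg[OF A_nonneg[of y], of "u y / 2"] A_nonneg[of y] 
          abs_ge_self[of "A y * (ln (A y) + u y)"] by (simp add: relent_def right_diff_distrib)
      finally have a: "A y * u y \<le> 2 * (\<bar>A y * (ln (A y) + u y)\<bar> + A y + exp (- (u y / 2)))" by simp
      have "- \<bar>c\<bar> * A y \<le> u y * A y" using le[OF y] A_nonneg by (intro mult_right_mono) auto
      moreover have "0 \<le> 2 * (\<bar>A y * (ln (A y) + u y)\<bar> + A y + exp (- (u y / 2)))" "0 \<le> \<bar>c\<bar> * A y"
        using A_nonneg by (auto intro!: add_nonneg_nonneg)
      ultimately show "norm (A y * u y) \<le> norm (2 * (\<bar>A y * (ln (A y) + u y)\<bar> + A y + exp (- (u y / 2))) + \<bar>c\<bar> * A y)"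
        using a unfolding real_norm_def by (subst abs_of_nonneg) (auto simp: abs_le_iff mult.commute)
    qed
  qed auto
  have eq: "A y * ln (A y) = A y * (ln (A y) + u y) - A y * u y" for y by (simp add: algebra_simps)
  show "integrable N (\<lambda>y. A y * ln (A y))" unfolding eq using I 1 by auto
qed

end

text \<open>Optimising the outer density \<open>r\<close> of \<open>r x * A x y\<close> while the inner densities \<open>A x\<close> are kept.\<close>

locale two_level = N2: sigma_finite_measure N2 for N2 :: "'b measure" +
  fixes N1 :: "'a measure" and r :: "'a \<Rightarrow> real" and A u :: "'a \<Rightarrow> 'b \<Rightarrow> real" and w :: "'a \<Rightarrow> real"
  assumes r_meas[measurable]: "r \<in> borel_measurable N1"
    and A_meas2[measurable]: "case_prod A \<in> borel_measurable (N1 \<Otimes>\<^sub>M N2)"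
    and u_meas2[measurable]: "case_prod u \<in> borel_measurable (N1 \<Otimes>\<^sub>M N2)"
    and r_nonneg: "\<And>x. 0 \<le> r x" and r_prob: "(\<integral>\<^sup>+x. ennreal (r x) \<partial>N1) = 1"
    and PD: "\<And>x. x \<in> space N1 \<Longrightarrow> prob_density_potential N2 (A x) (u x)"
    and c_int: "integrable N1 (\<lambda>x. \<integral>y. exp (- u x y) \<partial>N2)"
    and fin: "(\<integral>\<^sup>+x. rel_ent N2 (\<lambda>y. r x * A x y) (u x) \<partial>N1) < \<infinity>"
    and w_def: "\<And>x. w x = (if rel_ent N2 (A x) (u x) < \<infinity> then exp (- free_energy N2 (A x) (u x)) else 0)"
    and w_int: "integrable N1 w"
begin

abbreviation "c x \<equiv> \<integral>y. exp (- u x y) \<partial>N2"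
abbreviation "W \<equiv> integral\<^sup>L N1 w"

lemma w_nonneg: "0 \<le> w x" by (simp add: w_def)

lemma rel_ent_meas[measurable]: "(\<lambda>x. rel_ent N2 (\<lambda>y. r x * A x y) (u x)) \<in> borel_measurable N1"
  unfolding rel_ent_def by measurable

lemma r_int: "integrable N1 r" and r_integral: "integral\<^sup>L N1 r = 1"
proof -
  have "has_bochner_integral N1 r 1"
    by (rule has_bochner_integral_nn_integral) (auto simp: r_nonneg r_prob)
  then show "integrable N1 r" "integral\<^sup>L N1 r = 1" by (auto simp: has_bochner_integral_iff)
qed

lemma AE_fin: "AE x in N1. rel_ent N2 (\<lambda>y. r x * A x y) (u x) < \<infinity>"
proof -
  have "AE x in N1. rel_ent N2 (\<lambda>y. r x * A x y) (u x) \<noteq> \<infinity>"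
    using fin by (intro nn_integral_noteq_infinite) auto
  then show ?thesis by (auto simp: top.not_eq_extremum)
qed

text \<open>Where the inner energy is infinite, \<open>w\<close> is 0 by convention. An
  \<open>r\<close> of finite total cannot charge such points, because a positive multiple of
  \<open>A x\<close> has infinite energy along with \<open>A x\<close>.\<close>

lemma AE_w_pos: "AE x in N1. 0 < r x \<longrightarrow> 0 < w x"
  using AE_fin AE_space
proof eventually_elim
  case (elim x)
  then show ?case using prob_density_potential.rel_ent_unscale[OF PD, of x "r x"]
    by (auto simp: w_def)
qed

lemma W_pos: "0 < W"
proof (rule ccontr)
  assume "\<not> 0 < W"
  then have "W = 0" using Bochner_Integration.integral_nonneg[of N1 w] w_nonneg by (smt (verit))
  then have "AE x in N1. w x = 0"
    using integral_nonneg_eq_0_iff_AE[OF w_int] w_nonneg by auto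
  with AE_w_pos have "AE x in N1. r x = 0"
    by eventually_elim (use r_nonneg in \<open>auto simp: order_less_le\<close>)
  then have "integral\<^sup>L N1 r = 0" by (rule integral_eq_zero_AE)
  then show False by (simp add: r_integral)
qed

text \<open>For \<open>r = w / W\<close> one has \<open>ln r + F = - ln W\<close>, so the free
  energy cancels and the value is affine in \<open>w\<close>. Points with \<open>w x = 0\<close> fit
  the same formula: they contribute \<open>c x\<close>.\<close>

lemma rel_ent_w: assumes x: "x \<in> space N1"
  shows "rel_ent N2 (\<lambda>y. w x / W * A x y) (u x) = ennreal (- (ln W + 1) * (w x / W) + c x)"
    and "0 \<le> - (ln W + 1) * (w x / W) + c x"
proof -
  interpret prob_density_potential N2 "A x" "u x" by (rule PD[OF x])
  have "rel_ent N2 (\<lambda>y. w x / W * A x y) (u x) = ennreal (- (ln W + 1) * (w x / W) + c x) \<and> 0 \<le> - (ln W + 1) * (w x / W) + c x"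
  proof (cases "rel_ent N2 (A x) (u x) < \<infinity>")
    case True
    have l: "ln (w x / W) = - free_energy N2 (A x) (u x) - ln W"
      using True W_pos by (simp add: w_def ln_div)
    have e: "w x / W * (ln (w x / W) + free_energy N2 (A x) (u x) - 1) = - (ln W + 1) * (w x / W)"
      unfolding l by (simp add: algebra_simps)
    have "0 \<le> w x / W" using W_pos w_nonneg[of x] by simp
    from rel_ent_scale[OF True this, unfolded e] show ?thesis by blast
  next
    case False
    then have "w x = 0" by (simp add: w_def)
    then show ?thesis unfolding rel_ent_def
      using exp_int by (auto simp: nn_integral_eq_integral)
  qed
  then show "rel_ent N2 (\<lambda>y. w x / W * A x y) (u x) = ennreal (- (ln W + 1) * (w x / W) + c x)"
    and "0 \<le> - (ln W + 1) * (w x / W) + c x" by auto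
qed

lemma rel_ent_w_integral: 
  "(\<integral>\<^sup>+x. rel_ent N2 (\<lambda>y. w x / W * A x y) (u x) \<partial>N1) = ennreal (- ln W - 1 + integral\<^sup>L N1 c)"
proof -
  have "(\<integral>\<^sup>+x. rel_ent N2 (\<lambda>y. w x / W * A x y) (u x) \<partial>N1)
      = (\<integral>\<^sup>+x. ennreal (- (ln W + 1) * (w x / W) + c x) \<partial>N1)"
    by (intro nn_integral_cong rel_ent_w)
  also have "\<dots> = ennreal (\<integral>x. - (ln W + 1) * (w x / W) + c x \<partial>N1)"
    using w_int c_int rel_ent_w(2) by (intro nn_integral_eq_integral) auto
  also have "(\<integral>x. - (ln W + 1) * (w x / W) + c x \<partial>N1) = - ln W - 1 + integral\<^sup>L N1 c"
    using w_int c_int W_pos by (simp add: field_simps)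
  finally show ?thesis .
qed

lemma ln_W_le: "0 \<le> - ln W - 1 + integral\<^sup>L N1 c"
proof -
  have "0 \<le> (\<integral>x. - (ln W + 1) * (w x / W) + c x \<partial>N1)" using rel_ent_w(2) by (intro integral_nonneg_AE AE_I2)
  also have "\<dots> = - ln W - 1 + integral\<^sup>L N1 c"
    using w_int c_int W_pos by (simp add: field_simps)
  finally show ?thesis .
qed

text \<open>The value at \<open>r\<close> exceeds the value at \<open>w / W\<close> exactly by the
  relative entropy of \<open>r\<close> with respect to \<open>w / W\<close>, which minimality forces
  to be zero. The minimal value is kept as a second conclusion because it later identifies a
  normalising constant.\<close>

theorem gibbs_density:
  assumes min: "(\<integral>\<^sup>+x. rel_ent N2 (\<lambda>y. r x * A x y) (u x) \<partial>N1) \<le> (\<integral>\<^sup>+x. rel_ent N2 (\<lambda>y. w x / W * A x y) (u x) \<partial>N1)"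
  shows "AE x in N1. r x = w x / W"
    and "(\<integral>\<^sup>+x. rel_ent N2 (\<lambda>y. r x * A x y) (u x) \<partial>N1) = ennreal (- ln W - 1 + integral\<^sup>L N1 c)"
proof -
  define r' where "r' x = w x / W" for x
  have r'_int: "integrable N1 r'" and r'_1: "integral\<^sup>L N1 r' = 1"
    using w_int W_pos by (auto simp: r'_def[abs_def])
  note [measurable] = borel_measurable_integrable[OF r'_int] borel_measurable_integrable[OF w_int]
    borel_measurable_integrable[OF c_int]
  have r'_nn: "0 \<le> r' x" for x using w_nonneg W_pos by (simp add: r'_def)
  \<comment> \<open>Relative entropy density of \<open>r\<close> with respect to \<open>r'\<close>.
    Since \<open>ln 0 = 0\<close>, the \<open>relent\<close> expression would be 1 instead of 0
    where both vanish, hence the case distinction.\<close>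
  define d where "d x = (if r x = 0 then r' x else relent (r x) (- ln (r' x)))" for x
  \<comment> \<open>The integrand of the outer functional with the free energy replaced by
    \<open>- ln (r' x) - ln W\<close>. The term with \<open>r' x - r x\<close> integrates to 0, both
    being probability densities.\<close>
  define e where "e x = d x + ln W * (r' x - r x) - (ln W + 1) * r' x + c x" for x
  have [measurable]: "d \<in> borel_measurable N1" "e \<in> borel_measurable N1" unfolding d_def e_def by measurable
  have d_nn: "0 \<le> d x" for x using r_nonneg r'_nn by (auto simp: d_def relent_nonneg)
  have E: "AE x in N1. rel_ent N2 (\<lambda>y. r x * A x y) (u x) = ennreal (e x) \<and> 0 \<le> e x"
    using AE_fin AE_w_pos AE_space
  proof eventually_elim
    case (elim x)
    interpret prob_density_potential N2 "A x" "u x" by (rule PD) (use elim in auto)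
    show ?case
    proof (cases "r x = 0")
      case True
      then show ?thesis using exp_int by (simp add: rel_ent_def e_def d_def nn_integral_eq_integral algebra_simps)
    next
      case False
      then have rp: "0 < r x" using r_nonneg[of x] by simp
      with elim have wp: "0 < w x" and rf: "rel_ent N2 (A x) (u x) < \<infinity>" by (auto simp: w_def split: if_splits)
      have l: "ln (r' x) = - free_energy N2 (A x) (u x) - ln W" "0 < r' x"
        using wp rf W_pos by (auto simp: r'_def ln_div w_def)
      then have F: "free_energy N2 (A x) (u x) = - ln (r' x) - ln W" by simp
      have "e x = r x * (ln (r x) + free_energy N2 (A x) (u x) - 1) + c x"
        unfolding F using False l(2) by (simp add: e_def d_def relent_def algebra_simps)
      then show ?thesis using rel_ent_scale[OF rf, of "r x"] rp by auto
    qed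
  qed
  have Ee: "(\<integral>\<^sup>+x. rel_ent N2 (\<lambda>y. r x * A x y) (u x) \<partial>N1) = (\<integral>\<^sup>+x. ennreal (e x) \<partial>N1)"
    using E by (intro nn_integral_cong_AE) auto
  have e_int: "integrable N1 e" using E fin Ee by (intro integrableI_nonneg) auto
  have Ei: "(\<integral>\<^sup>+x. rel_ent N2 (\<lambda>y. r x * A x y) (u x) \<partial>N1) = ennreal (integral\<^sup>L N1 e)"
    unfolding Ee using e_int E by (intro nn_integral_eq_integral) auto
  have c_eq: "d x = e x - ln W * (r' x - r x) + (ln W + 1) * r' x - c x" for x by (simp add: e_def)
  have d_int: "integrable N1 d" unfolding c_eq using e_int r'_int r_int c_int by auto
  have d_val: "integral\<^sup>L N1 d = integral\<^sup>L N1 e + ln W + 1 - integral\<^sup>L N1 c"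
    unfolding c_eq using e_int r'_int r_int c_int by (simp add: r'_1 r_integral)
  have "integral\<^sup>L N1 e \<le> - ln W - 1 + integral\<^sup>L N1 c"
    using min ln_W_le unfolding Ei rel_ent_w_integral by simp
  then have d0: "integral\<^sup>L N1 d \<le> 0" by (simp add: d_val)
  then have "integral\<^sup>L N1 d = 0" using d_nn by (intro antisym Bochner_Integration.integral_nonneg) auto
  then have "AE x in N1. d x = 0" using integral_nonneg_eq_0_iff_AE[OF d_int] d_nn by auto
  then show "AE x in N1. r x = w x / W"
    using AE_w_pos
  proof eventually_elim
    case (elim x)
    show ?case
    proof (cases "r x = 0")
      case False
      then have rp: "0 < r x" using r_nonneg[of x] by simp
      then have "0 < r' x" using elim W_pos by (simp add: r'_def)
      with relent_eq_0_imp[OF rp, of "- ln (r' x)"] elim False show ?thesis by (simp add: d_def r'_def)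
    qed (use elim in \<open>auto simp: d_def r'_def\<close>)
  qed
  have "integral\<^sup>L N1 e = - ln W - 1 + integral\<^sup>L N1 c" using \<open>integral\<^sup>L N1 d = 0\<close> by (simp add: d_val)
  then show "(\<integral>\<^sup>+x. rel_ent N2 (\<lambda>y. r x * A x y) (u x) \<partial>N1) = ennreal (- ln W - 1 + integral\<^sup>L N1 c)"
    by (simp add: Ei)
qed

end

section \<open>Star-shaped densities and comparison of kernels\<close>
interpretation lb: product_sigma_finite "\<lambda>_. lborel :: real measure"
  by standard

abbreviation LP :: "'i set \<Rightarrow> ('i \<Rightarrow> real) measure" where
  "LP I \<equiv> PiM I (\<lambda>_. lborel)"

lemma sigma_finite_LP: "finite I \<Longrightarrow> sigma_finite_measure (LP I)"
  by (rule lb.sigma_finite)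

lemma integrable_gauss: assumes "0 < c" shows "integrable lborel (\<lambda>t::real. exp (- (c * t\<^sup>2)))"
proof -
  define \<sigma> where "\<sigma> = sqrt (1 / (2 * c))"
  have s: "\<sigma>\<^sup>2 = 1 / (2 * c)" "0 < \<sigma>" using assms by (auto simp: \<sigma>_def)
  have "exp (- (c * t\<^sup>2)) = sqrt (2 * pi * \<sigma>\<^sup>2) * normal_density 0 \<sigma> t" for t
    using assms s by (simp add: normal_density_def)
  then show ?thesis by (simp add: integrable_normal_density s)
qed

lemma nn_integral_gauss_finite: assumes "0 < c" shows "(\<integral>\<^sup>+t. ennreal (exp (- (c * t\<^sup>2))) \<partial>lborel) < \<infinity>"
  using integrable_gauss[OF assms] by (simp add: nn_integral_eq_integral)

lemma integrable_gauss_PiM: 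
  assumes "finite I" "0 < c" 
  shows "integrable (LP I) (\<lambda>y. exp (- (c * (\<Sum>j\<in>I. (y j)\<^sup>2))))"
proof (rule integrableI_nonneg)
  have "(\<integral>\<^sup>+y. ennreal (exp (- (c * (\<Sum>j\<in>I. (y j)\<^sup>2)))) \<partial>LP I) = (\<integral>\<^sup>+y. (\<Prod>j\<in>I. ennreal (exp (- (c * (y j)\<^sup>2)))) \<partial>LP I)"
    using assms by (simp add: sum_distrib_left sum_negf[symmetric] exp_sum prod_ennreal)
  also have "\<dots> = (\<Prod>j\<in>I. \<integral>\<^sup>+t. ennreal (exp (- (c * t\<^sup>2))) \<partial>lborel)"
    using assms by (intro lb.product_nn_integral_prod) auto
  also have "\<dots> < \<infinity>" using nn_integral_gauss_finite[OF assms(2)] by (simp add: power_less_top_ennreal)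
  finally show "(\<integral>\<^sup>+y. ennreal (exp (- (c * (\<Sum>j\<in>I. (y j)\<^sup>2)))) \<partial>LP I) < \<infinity>" .
qed auto

text \<open>The exceptional set lies in a box with one null side whose other sides are the whole
  line; its volume is zero because \<open>0 * \<infinity> = 0\<close>.\<close>

lemma AE_PiM_lborel_coord:
  assumes fin: "finite I" and j: "j \<in> I" and P: "AE t in lborel. P t"
  shows "AE y in LP I. P (y j)"
proof -
  from P obtain N where N: "{t. \<not> P t} \<subseteq> N" "N \<in> sets lborel" "emeasure lborel N = 0" 
    by (auto elim!: AE_E)
  interpret finite_product_sigma_finite "\<lambda>_. lborel :: real measure" I by standard fact
  let ?B = "\<lambda>i. if i = j then N else UNIV"
  have "emeasure (LP I) (Pi\<^sub>E I ?B) = (\<Prod>i\<in>I. emeasure lborel (?B i))"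
    using N by (intro measure_times) auto
  also have "\<dots> = 0" using fin j N by (auto intro!: prod_zero)
  finally have "Pi\<^sub>E I ?B \<in> null_sets (LP I)"
    using N fin by (auto intro!: null_setsI sets_PiM_I_finite)
  moreover have "{y \<in> space (LP I). \<not> P (y j)} \<subseteq> Pi\<^sub>E I ?B"
    using N(1) by (auto simp: space_PiM PiE_iff extensional_def)
  ultimately show ?thesis by (rule AE_I')
qed

lemma AE_eq_of_nn_integral_le:
  assumes [measurable]: "f \<in> borel_measurable M" "g \<in> borel_measurable M"
    and le: "AE x in M. f x \<le> g x" and fin: "(\<integral>\<^sup>+x. g x \<partial>M) < \<infinity>"
    and ge: "(\<integral>\<^sup>+x. g x \<partial>M) \<le> (\<integral>\<^sup>+x. f x \<partial>M)"
  shows "AE x in M. f x = (g x :: ennreal)"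
proof -
  have "(\<integral>\<^sup>+x. f x \<partial>M) \<le> (\<integral>\<^sup>+x. g x \<partial>M)" using le by (rule nn_integral_mono_AE)
  then have "(\<integral>\<^sup>+x. g x - f x \<partial>M) = (\<integral>\<^sup>+x. g x \<partial>M) - (\<integral>\<^sup>+x. f x \<partial>M)"
    using le fin by (intro nn_integral_diff) auto
  also have "\<dots> = 0" using ge fin by (simp add: diff_eq_0_iff_ennreal)
  finally have "AE x in M. g x - f x = 0" by (subst (asm) nn_integral_0_iff_AE) auto
  moreover have "AE x in M. g x \<noteq> \<infinity>" using fin by (intro nn_integral_noteq_infinite) auto
  ultimately show ?thesis using le
    by eventually_elim (auto simp: diff_eq_0_iff_ennreal intro!: antisym)
qed

locale star_core =
  fixes J :: "'n set" and v :: "real \<Rightarrow> ('n \<Rightarrow> real) \<Rightarrow> real" and a b :: real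
  assumes finJ: "finite J" and b_pos: "0 < b"
    and v_meas[measurable]: "case_prod v \<in> borel_measurable (lborel \<Otimes>\<^sub>M LP J)"
    and v_lower: "\<And>s y. a + b * (s\<^sup>2 + (\<Sum>j\<in>J. (y j)\<^sup>2)) \<le> v s y"
    and v_growth: "\<And>c. 0 < c \<Longrightarrow> \<exists>C>0. \<forall>s y. \<bar>v s y\<bar> \<le> C * exp (c * (s\<^sup>2 + (\<Sum>j\<in>J. (y j)\<^sup>2)))"
begin

lemma v_meas'[measurable (raw)]:
  assumes "f \<in> M \<rightarrow>\<^sub>M lborel" "g \<in> M \<rightarrow>\<^sub>M LP J"
  shows "(\<lambda>x. v (f x) (g x)) \<in> borel_measurable M"
  using measurable_compose[OF measurable_Pair[OF assms] v_meas] by simp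

text \<open>Unit mass is required for every \<open>s\<close> and not just almost every one, so that
  two kernels glued along any measurable set of \<open>s\<close> form a kernel again.\<close>

definition kern :: "('n \<Rightarrow> real \<Rightarrow> real \<Rightarrow> real) \<Rightarrow> bool" where
  "kern k \<longleftrightarrow> (\<forall>j\<in>J. case_prod (k j) \<in> borel_measurable (lborel \<Otimes>\<^sub>M lborel) \<and> (\<forall>s. (\<integral>\<^sup>+t. ennreal (k j s t) \<partial>lborel) = 1))
     \<and> (\<forall>j s t. 0 \<le> k j s t)"

definition dens :: "(real \<Rightarrow> real) \<Rightarrow> bool" where
  "dens r \<longleftrightarrow> r \<in> borel_measurable lborel \<and> (\<forall>s. 0 \<le> r s) \<and> (\<integral>\<^sup>+s. ennreal (r s) \<partial>lborel) = 1"

definition prod_kernel :: "('n \<Rightarrow> real \<Rightarrow> real \<Rightarrow> real) \<Rightarrow> real \<Rightarrow> ('n \<Rightarrow> real) \<Rightarrow> real" where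
  "prod_kernel k s y = (\<Prod>j\<in>J. k j s (y j))"

abbreviation "LJ \<equiv> LP J"
abbreviation "c s \<equiv> \<integral>y. exp (- v s y) \<partial>LJ"

text \<open>The generalised divergence from the unnormalised \<open>exp (- v)\<close>, with the
  first coordinate integrated last. Where finite, it differs from \<open>KL\<close> by the constant
  in \<open>KL_star\<close>.\<close>

definition Ent where "Ent r k = (\<integral>\<^sup>+s. rel_ent LJ (\<lambda>y. r s * prod_kernel k s y) (v s) \<partial>lborel)"

sublocale LJ: sigma_finite_measure LJ by (rule sigma_finite_LP[OF finJ])

lemma kern_meas: "kern k \<Longrightarrow> j \<in> J \<Longrightarrow> f \<in> M \<rightarrow>\<^sub>M lborel \<Longrightarrow> g \<in> M \<rightarrow>\<^sub>M lborel \<Longrightarrow>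
    (\<lambda>x. k j (f x) (g x)) \<in> borel_measurable M"
  using measurable_compose[OF measurable_Pair, of f M lborel g lborel "case_prod (k j)" borel]
  by (simp add: kern_def)

lemma kern_nonneg: "kern k \<Longrightarrow> 0 \<le> k j s t" by (simp add: kern_def)

lemma kern_prob: "kern k \<Longrightarrow> j \<in> J \<Longrightarrow> (\<integral>\<^sup>+t. ennreal (k j s t) \<partial>lborel) = 1" by (simp add: kern_def)

lemma prodK_meas[measurable (raw)]: 
  assumes "kern k" "I \<subseteq> J" "f \<in> M \<rightarrow>\<^sub>M lborel" "g \<in> M \<rightarrow>\<^sub>M LP I"
  shows "(\<lambda>x. \<Prod>j\<in>I. k j (f x) (g x j)) \<in> borel_measurable M"
  using assms 
  by (intro borel_measurable_prod kern_meas[OF assms(1)] measurable_compose[OF assms(4)]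
      measurable_compose[OF assms(4) measurable_component_singleton]) auto

lemma prod_kernel_meas: 
  assumes "kern k" "f \<in> M \<rightarrow>\<^sub>M lborel" "g \<in> M \<rightarrow>\<^sub>M LJ"
  shows "(\<lambda>x. prod_kernel k (f x) (g x)) \<in> borel_measurable M"
  unfolding prod_kernel_def using assms by (intro prodK_meas) auto

lemma prod_kernel_nonneg: "kern k \<Longrightarrow> 0 \<le> prod_kernel k s y"
  by (auto simp: prod_kernel_def kern_nonneg intro!: prod_nonneg)

lemma nn_integral_prodK: assumes "kern k" "I \<subseteq> J"
  shows "(\<integral>\<^sup>+y. ennreal (\<Prod>j\<in>I. k j s (y j)) \<partial>LP I) = 1"
proof -
  have fin: "finite I" using assms finJ finite_subset by auto
  have "(\<integral>\<^sup>+y. ennreal (\<Prod>j\<in>I. k j s (y j)) \<partial>LP I) = (\<integral>\<^sup>+y. (\<Prod>j\<in>I. ennreal (k j s (y j))) \<partial>LP I)"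
    using kern_nonneg[OF assms(1)] by (simp add: prod_ennreal)
  also have "\<dots> = (\<Prod>j\<in>I. \<integral>\<^sup>+t. ennreal (k j s t) \<partial>lborel)"
    using assms fin by (intro lb.product_nn_integral_prod)
      (auto intro!: measurable_compose[OF kern_meas[OF assms(1)] measurable_ennreal])
  also have "\<dots> = 1" using assms by (intro prod.neutral) (auto simp: kern_prob)
  finally show ?thesis .
qed

text \<open>Two values of \<theta> matter: 1 for partition functions, and 1/2 for separating energy
  from entropy by \<open>free_energy_split\<close>.\<close>

lemma exp_v_integrable: assumes "0 < \<theta>" shows "integrable LJ (\<lambda>y. exp (- (\<theta> * v s y)))"
proof (rule Bochner_Integration.integrable_bound)
  show "integrable LJ (\<lambda>y. exp (- (\<theta> * a)) * exp (- ((\<theta> * b) * (\<Sum>j\<in>J. (y j)\<^sup>2))))"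
    using integrable_gauss_PiM[OF finJ, of "\<theta> * b"] b_pos assms by auto
  have "\<theta> * (a + b * (\<Sum>j\<in>J. (y j)\<^sup>2)) \<le> \<theta> * v s y" for y
  proof (rule mult_left_mono)
    show "a + b * (\<Sum>j\<in>J. (y j)\<^sup>2) \<le> v s y"
    proof -
      have "0 \<le> b * s\<^sup>2" using b_pos by simp
      then show ?thesis using v_lower[of s y] by (simp add: distrib_left)
    qed
  qed (use assms in simp)
  then show "AE y in LJ. norm (exp (- (\<theta> * v s y))) \<le> norm (exp (- (\<theta> * a)) * exp (- ((\<theta> * b) * (\<Sum>j\<in>J. (y j)\<^sup>2))))"
    by (simp add: exp_add[symmetric] algebra_simps)
qed measurable

lemma potential_prod_kernel: assumes "kern k" shows "prob_density_potential LJ (prod_kernel k s) (v s)"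
  using assms nn_integral_prodK[OF assms, of J s] exp_v_integrable[of 1 s]
  by unfold_locales (auto simp: prod_kernel_nonneg prod_kernel_def[symmetric] intro!: prod_kernel_meas)

lemma c_nonneg: "0 \<le> c s" by (simp add: Bochner_Integration.integral_nonneg)

lemma c_integrable: "integrable lborel c"
proof (rule Bochner_Integration.integrable_bound)
  let ?G = "\<integral>y. exp (- (b * (\<Sum>j\<in>J. (y j)\<^sup>2))) \<partial>LJ"
  show "integrable lborel (\<lambda>s. exp (- a) * ?G * exp (- (b * s\<^sup>2)))"
    using integrable_gauss[OF b_pos] by simp
  have "c s \<le> exp (- a) * ?G * exp (- (b * s\<^sup>2))" for s
  proof -
    have "c s \<le> (\<integral>y. exp (- a) * exp (- (b * s\<^sup>2)) * exp (- (b * (\<Sum>j\<in>J. (y j)\<^sup>2))) \<partial>LJ)"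
    proof (rule integral_mono)
      show "exp (- v s y) \<le> exp (- a) * exp (- (b * s\<^sup>2)) * exp (- (b * (\<Sum>j\<in>J. (y j)\<^sup>2)))" for y
        using v_lower[of s y] by (simp add: exp_add[symmetric] algebra_simps)
    qed (use exp_v_integrable[of 1 s] integrable_gauss_PiM[OF finJ b_pos] in auto)
    then show ?thesis by (simp add: mult_ac)
  qed
  then show "AE s in lborel. norm (c s) \<le> norm (exp (- a) * ?G * exp (- (b * s\<^sup>2)))"
    using c_nonneg by (auto simp: abs_mult intro!: order_trans[OF _ abs_ge_self[of "exp (- a) * ?G * _"]])
qed measurable

lemma rel_ent_meas: assumes "kern k" and [measurable]: "r \<in> borel_measurable lborel"
  shows "(\<lambda>s. rel_ent LJ (\<lambda>y. r s * prod_kernel k s y) (v s)) \<in> borel_measurable lborel"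
proof -
  note prod_kernel_meas[OF assms(1), measurable (raw)]
  show ?thesis unfolding rel_ent_def by measurable
qed

lemma rel_ent1_meas: assumes "kern k"
  shows "(\<lambda>s. rel_ent LJ (prod_kernel k s) (v s)) \<in> borel_measurable lborel"
  using rel_ent_meas[OF assms, of "\<lambda>_. 1"] by simp

lemma free_energy_meas: assumes "kern k"
  shows "(\<lambda>s. free_energy LJ (prod_kernel k s) (v s)) \<in> borel_measurable lborel"
proof -
  note rel_ent1_meas[OF assms, measurable]
  show ?thesis unfolding free_energy_def by measurable
qed

definition unif_kernel :: "'n \<Rightarrow> real \<Rightarrow> real \<Rightarrow> real" where "unif_kernel j s t = indicator {0..1} t"

lemma kern_unif_kernel: "kern unif_kernel"
  unfolding kern_def unif_kernel_def[abs_def] by (auto simp: ennreal_indicator)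

text \<open>The uniform density on the cube takes only the values 0 and 1, so its entropy vanishes
  and its free energy is the mean of \<open>v s\<close> over the cube, where the squares sum to at
  most \<open>card J\<close>. It serves as a competitor of finite energy at every
  \<open>s\<close>.\<close>

lemma unif_kernel_growth: "\<exists>C>0. \<forall>s. rel_ent LJ (prod_kernel unif_kernel s) (v s) < \<infinity> \<and> free_energy LJ (prod_kernel unif_kernel s) (v s) \<le> C * exp (s\<^sup>2)"
proof -
  obtain C where C: "C > 0" "\<And>s y. \<bar>v s y\<bar> \<le> C * exp (1 * (s\<^sup>2 + (\<Sum>j\<in>J. (y j)\<^sup>2)))"
    using v_growth[of 1] by auto
  define D where "D = C * exp (real (card J))"
  have D: "0 < D" using C by (simp add: D_def)
  have "rel_ent LJ (prod_kernel unif_kernel s) (v s) < \<infinity> \<and> free_energy LJ (prod_kernel unif_kernel s) (v s) \<le> D * exp (s\<^sup>2)" for s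
  proof -
    interpret prob_density_potential LJ "prod_kernel unif_kernel s" "v s" by (rule potential_prod_kernel[OF kern_unif_kernel])
    have 0: "prod_kernel unif_kernel s y * ln (prod_kernel unif_kernel s y) = 0" for y
      unfolding prod_kernel_def unif_kernel_def using finJ
      by (cases "\<forall>j\<in>J. y j \<in> {0..1}") (auto simp: indicator_def)
    have le: "\<bar>prod_kernel unif_kernel s y * v s y\<bar> \<le> D * exp (s\<^sup>2) * prod_kernel unif_kernel s y" for y
    proof (cases "\<forall>j\<in>J. y j \<in> {0..1}")
      case True
      then have "(\<Sum>j\<in>J. (y j)\<^sup>2) \<le> (\<Sum>j\<in>J. 1)" by (intro sum_mono) (auto simp: power_le_one)
      then have "C * exp (1 * (s\<^sup>2 + (\<Sum>j\<in>J. (y j)\<^sup>2))) \<le> D * exp (s\<^sup>2)"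
        using C by (simp add: D_def mult.assoc exp_add[symmetric])
      moreover have "prod_kernel unif_kernel s y = 1" using True by (simp add: prod_kernel_def unif_kernel_def)
      ultimately show ?thesis using C(2)[of s y] by simp
    next
      case False
      then have "\<exists>j\<in>J. indicator {0..1} (y j) = (0::real)" by (metis indicator_simps(2))
      then have "prod_kernel unif_kernel s y = 0" using finJ by (auto simp: prod_kernel_def unif_kernel_def)
      then show ?thesis by simp
    qed
    have int: "integrable LJ (\<lambda>y. prod_kernel unif_kernel s y * v s y)"
      by (rule Bochner_Integration.integrable_bound[of _ "\<lambda>y. D * exp (s\<^sup>2) * prod_kernel unif_kernel s y"])
        (use A_int le A_nonneg D in \<open>auto simp: abs_mult\<close>)
    have "(\<integral>y. prod_kernel unif_kernel s y * v s y \<partial>LJ) \<le> (\<integral>y. D * exp (s\<^sup>2) * prod_kernel unif_kernel s y \<partial>LJ)"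
      using le by (intro integral_mono int) (use A_int in \<open>auto simp: abs_le_iff\<close>)
    then have "(\<integral>y. prod_kernel unif_kernel s y * v s y \<partial>LJ) \<le> D * exp (s\<^sup>2)" by (simp add: A_integral)
    with free_energy_combine[OF _ int] show ?thesis by (simp add: 0)
  qed
  with D show ?thesis by blast
qed

lemma free_energy_ge_gauss: assumes "kern k" "rel_ent LJ (prod_kernel k s) (v s) < \<infinity>"
  shows "(a + b * s\<^sup>2) + 1 - (\<integral>y. exp (- (b * (\<Sum>j\<in>J. (y j)\<^sup>2))) \<partial>LJ) \<le> free_energy LJ (prod_kernel k s) (v s)"
proof -
  interpret prob_density_potential LJ "prod_kernel k s" "v s" by (rule potential_prod_kernel[OF assms(1)])
  show ?thesis using v_lower[of s] integrable_gauss_PiM[OF finJ b_pos]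
    by (intro free_energy_ge[OF assms(2)]) (auto simp: algebra_simps)
qed

end

section \<open>Consequences of minimality\<close>

locale star_min = star_core +
  fixes r k
  assumes r: "dens r" and k: "kern k" and Ent_fin: "Ent r k < \<infinity>"
    and min: "\<And>r' k'. dens r' \<Longrightarrow> kern k' \<Longrightarrow> Ent r k \<le> Ent r' k'"
begin

lemma r_meas[measurable]: "r \<in> borel_measurable lborel" and r_nonneg: "0 \<le> r s" 
  using r by (auto simp: dens_def)

lemma AE_RE_fin: "AE s in lborel. 0 < r s \<longrightarrow> rel_ent LJ (prod_kernel k s) (v s) < \<infinity>"
proof -
  have "AE s in lborel. rel_ent LJ (\<lambda>y. r s * prod_kernel k s y) (v s) \<noteq> \<infinity>"
    using Ent_fin rel_ent_meas[OF k r_meas] by (intro nn_integral_noteq_infinite) (auto simp: Ent_def)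
  then show ?thesis
    by eventually_elim (use prob_density_potential.rel_ent_unscale[OF potential_prod_kernel[OF k]] in \<open>auto simp: less_top\<close>)
qed

text \<open>Conditionals at different \<open>s\<close> can be chosen independently, so minimality
  localises: inserting \<open>k'\<close> on the set \<open>S\<close> where it is strictly better
  lowers the integrand wherever \<open>r\<close> is positive there and raises it nowhere.\<close>

theorem compare_kernel:
  assumes k': "kern k'"
  shows "AE s in lborel. 0 < r s \<longrightarrow> rel_ent LJ (prod_kernel k s) (v s) \<le> rel_ent LJ (prod_kernel k' s) (v s)"
proof -
  define S where "S = {s. rel_ent LJ (prod_kernel k' s) (v s) < rel_ent LJ (prod_kernel k s) (v s)}"
  note [measurable] = rel_ent1_meas[OF k] rel_ent1_meas[OF k']
  have [measurable]: "S \<in> sets lborel" 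
    using borel_measurable_less[OF rel_ent1_meas[OF k'] rel_ent1_meas[OF k]] by (simp add: S_def)
  define k2 where "k2 j s t = (if s \<in> S then k' j s t else k j s t)" for j s t
  have k2: "kern k2"
    unfolding kern_def
  proof (intro conjI ballI allI)
    fix j assume j: "j \<in> J"
    note [measurable] = kern_meas[OF k j] kern_meas[OF k' j]
    show "case_prod (k2 j) \<in> borel_measurable (lborel \<Otimes>\<^sub>M lborel)" 
      unfolding k2_def[abs_def] case_prod_beta by measurable
    show "(\<integral>\<^sup>+ t. ennreal (k2 j s t) \<partial>lborel) = 1" for s
      using kern_prob[OF k j, of s] kern_prob[OF k' j, of s] by (cases "s \<in> S") (auto simp: k2_def)
  qed (use k k' in \<open>auto simp: k2_def kern_nonneg\<close>)
  have f2: "prod_kernel k2 s = (if s \<in> S then prod_kernel k' s else prod_kernel k s)" for s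
    by (auto simp: prod_kernel_def k2_def fun_eq_iff)
  define E where "E k s = rel_ent LJ (\<lambda>y. r s * prod_kernel k s y) (v s)" for k s
  have Em: "E k \<in> borel_measurable lborel" if "kern k" for k
    unfolding E_def[abs_def] by (rule rel_ent_meas[OF that r_meas])
  have *: "E k2 s \<le> E k s \<and> (s \<in> S \<and> 0 < r s \<longrightarrow> E k2 s < E k s)" for s
  proof (cases "s \<in> S \<and> 0 < r s")
    case False
    then have "E k2 s = E k s" using r_nonneg[of s] by (auto simp: E_def f2)
    then show ?thesis using False by auto
  next
    case True
    interpret P: prob_density_potential LJ "prod_kernel k s" "v s" by (rule potential_prod_kernel[OF k])
    interpret P': prob_density_potential LJ "prod_kernel k' s" "v s" by (rule potential_prod_kernel[OF k'])
    have less: "rel_ent LJ (prod_kernel k' s) (v s) < rel_ent LJ (prod_kernel k s) (v s)" using True by (simp add: S_def)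
    then have fin': "rel_ent LJ (prod_kernel k' s) (v s) < \<infinity>" by (rule order.strict_trans2) simp
    have e2: "E k2 s = ennreal (r s * (ln (r s) + free_energy LJ (prod_kernel k' s) (v s) - 1) + c s)"
      "0 \<le> r s * (ln (r s) + free_energy LJ (prod_kernel k' s) (v s) - 1) + c s"
      using P'.rel_ent_scale[OF fin', of "r s"] True by (auto simp: E_def f2)
    have "E k2 s < E k s"
    proof (cases "rel_ent LJ (prod_kernel k s) (v s) < \<infinity>")
      case fin: True
      have "free_energy LJ (prod_kernel k' s) (v s) < free_energy LJ (prod_kernel k s) (v s)"
        using less fin unfolding free_energy_def by (simp add: enn2real_less_iff less_top)
      then have "r s * (ln (r s) + free_energy LJ (prod_kernel k' s) (v s) - 1) + c s < r s * (ln (r s) + free_energy LJ (prod_kernel k s) (v s) - 1) + c s"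
        using True by simp
      moreover have "E k s = ennreal (r s * (ln (r s) + free_energy LJ (prod_kernel k s) (v s) - 1) + c s)"
        using P.rel_ent_scale[OF fin, of "r s"] True by (auto simp: E_def)
      ultimately show ?thesis using e2 by (simp add: ennreal_lessI)
    next
      case False
      then have "\<not> E k s < \<infinity>" using P.rel_ent_unscale[of "r s"] True by (auto simp: E_def)
      then have "E k s = \<infinity>" by (simp add: not_less top_unique)
      then show ?thesis by (simp add: e2)
    qed
    then show ?thesis by auto
  qed
  have "AE s in lborel. E k2 s = E k s"
    using Ent_fin min[OF r k2] *
    by (intro AE_eq_of_nn_integral_le Em k k2) (auto simp: Ent_def E_def[abs_def])
  then show ?thesis
  proof eventually_elim
    case (elim s)
    then show ?case using *[of s] by (auto simp: S_def not_less)
  qed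
qed

theorem first_marginal:
  "\<exists>W>0. AE s in lborel. 0 < r s \<and> rel_ent LJ (prod_kernel k s) (v s) < \<infinity> \<and> r s = exp (- free_energy LJ (prod_kernel k s) (v s)) / W"
proof -
  define S where "S = {s. 0 < r s \<and> rel_ent LJ (prod_kernel k s) (v s) < \<infinity>}"
  note [measurable] = rel_ent1_meas[OF k]
  have [measurable]: "S \<in> sets lborel" unfolding S_def by measurable
  \<comment> \<open>Almost everywhere off \<open>S\<close> the density \<open>r\<close> vanishes, so
    \<open>k\<close> is unconstrained there and may have infinite energy. The uniform kernel repairs
    this without changing \<open>Ent\<close> and makes \<open>w\<close> positive everywhere;
    \<open>r = w / W\<close> then shows that the repaired set was null.\<close>
  define k0 where "k0 j s t = (if s \<in> S then k j s t else unif_kernel j s t)" for j s t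
  have k0: "kern k0"
    unfolding kern_def
  proof (intro conjI ballI allI)
    fix j assume j: "j \<in> J"
    note [measurable] = kern_meas[OF k j] kern_meas[OF kern_unif_kernel j]
    show "case_prod (k0 j) \<in> borel_measurable (lborel \<Otimes>\<^sub>M lborel)" 
      unfolding k0_def[abs_def] case_prod_beta by measurable
    show "(\<integral>\<^sup>+ t. ennreal (k0 j s t) \<partial>lborel) = 1" for s
      using kern_prob[OF k j, of s] kern_prob[OF kern_unif_kernel j, of s] by (cases "s \<in> S") (auto simp: k0_def)
  qed (use k kern_unif_kernel in \<open>auto simp: k0_def kern_nonneg\<close>)
  have f0: "prod_kernel k0 s = (if s \<in> S then prod_kernel k s else prod_kernel unif_kernel s)" for s
    by (auto simp: prod_kernel_def k0_def fun_eq_iff)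
  have fin0: "rel_ent LJ (prod_kernel k0 s) (v s) < \<infinity>" for s
    using unif_kernel_growth by (auto simp: f0 S_def)
  define w where "w s = exp (- free_energy LJ (prod_kernel k0 s) (v s))" for s
  have w_int: "integrable lborel w"
  proof (rule Bochner_Integration.integrable_bound)
    let ?G = "\<integral>y. exp (- (b * (\<Sum>j\<in>J. (y j)\<^sup>2))) \<partial>LJ"
    show "integrable lborel (\<lambda>s. exp (- (a + 1 - ?G)) * exp (- (b * s\<^sup>2)))"
      using integrable_gauss[OF b_pos] by simp
    show "AE s in lborel. norm (w s) \<le> norm (exp (- (a + 1 - ?G)) * exp (- (b * s\<^sup>2)))"
      using free_energy_ge_gauss[OF k0 fin0] by (simp add: w_def exp_add[symmetric] algebra_simps)
    show "w \<in> borel_measurable lborel" unfolding w_def[abs_def] using free_energy_meas[OF k0] by measurable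
  qed
  have Ent0: "Ent r k0 = Ent r k"
    unfolding Ent_def
  proof (rule nn_integral_cong_AE)
    show "AE s in lborel. rel_ent LJ (\<lambda>y. r s * prod_kernel k0 s y) (v s) = rel_ent LJ (\<lambda>y. r s * prod_kernel k s y) (v s)"
      using AE_RE_fin
    proof eventually_elim
      case (elim s)
      then show ?case using r_nonneg[of s] by (cases "r s = 0") (auto simp: f0 S_def)
    qed
  qed
  interpret T: two_level LJ lborel r "prod_kernel k0" v w
  proof (intro two_level.intro two_level_axioms.intro)
    show "sigma_finite_measure LJ" ..
    show "case_prod (prod_kernel k0) \<in> borel_measurable (lborel \<Otimes>\<^sub>M LJ)"
      unfolding case_prod_beta by (rule prod_kernel_meas[OF k0]) auto
    show "(\<integral>\<^sup>+ x. ennreal (r x) \<partial>lborel) = 1" using r by (simp add: dens_def)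
    show "(\<integral>\<^sup>+ x. rel_ent LJ (\<lambda>y. r x * prod_kernel k0 x y) (v x) \<partial>lborel) < \<infinity>"
      using Ent_fin Ent0 by (simp add: Ent_def)
    show "w x = (if rel_ent LJ (prod_kernel k0 x) (v x) < \<infinity> then exp (- free_energy LJ (prod_kernel k0 x) (v x)) else 0)" for x
      using fin0 by (simp add: w_def)
  qed (auto simp: r_nonneg potential_prod_kernel[OF k0] c_integrable w_int)
  have dw: "dens (\<lambda>s. w s / T.W)"
  proof -
    have "(\<integral>\<^sup>+s. ennreal (w s / T.W) \<partial>lborel) = ennreal (\<integral>s. w s / T.W \<partial>lborel)"
      using w_int T.W_pos T.w_nonneg by (intro nn_integral_eq_integral) auto
    also have "\<dots> = 1" using T.W_pos by simp
    finally show ?thesis using borel_measurable_integrable[OF w_int] T.W_pos T.w_nonneg 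
      by (auto simp: dens_def)
  qed
  have "AE s in lborel. r s = w s / T.W"
    using min[OF dw k0] unfolding Ent0[symmetric] by (intro T.gibbs_density) (simp add: Ent_def)
  then have "AE s in lborel. 0 < r s \<and> rel_ent LJ (prod_kernel k s) (v s) < \<infinity> \<and> r s = exp (- free_energy LJ (prod_kernel k s) (v s)) / T.W"
    using AE_RE_fin
  proof eventually_elim
    case (elim s)
    then have "0 < r s" using T.W_pos by (simp add: w_def)
    with elim show ?case by (simp add: w_def f0 S_def)
  qed
  then show ?thesis using T.W_pos by blast
qed

end

section \<open>Optimal conditional densities\<close>
context star_core
begin

definition prod_kernel_off :: "('n \<Rightarrow> real \<Rightarrow> real \<Rightarrow> real) \<Rightarrow> 'n \<Rightarrow> real \<Rightarrow> ('n \<Rightarrow> real) \<Rightarrow> real" where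
  "prod_kernel_off k i s y = (\<Prod>j\<in>J - {i}. k j s (y j))"

abbreviation "LI i \<equiv> LP (J - {i})"

text \<open>The Gibbs weight of coordinate \<open>i\<close> when the other conditionals are kept:
  the \<open>w\<close> of \<open>two_level\<close> with \<open>t\<close> as outer variable. It still
  contains the entropy of the other conditionals, which does not depend on \<open>t\<close>.\<close>

definition coord_weight where
  "coord_weight k i s t = (if rel_ent (LI i) (prod_kernel_off k i s) (\<lambda>y. v s (y(i := t))) < \<infinity>
     then exp (- free_energy (LI i) (prod_kernel_off k i s) (\<lambda>y. v s (y(i := t)))) else 0)"

definition gauss_mass :: real where
  "gauss_mass = (\<Sum>i\<in>J. \<integral>y. exp (- (b * (\<Sum>j\<in>J - {i}. (y j)\<^sup>2))) \<partial>LI i)"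

text \<open>The prefactor left when the bound of \<open>free_energy_ge\<close> is exponentiated;
  \<open>gauss_mass\<close> dominates the Gaussian integral of each single \<open>i\<close>, so one
  constant serves all coordinates.\<close>

definition K0 :: real where "K0 = exp (gauss_mass - a - 1)"

lemma K0_pos: "0 < K0" by (simp add: K0_def)

lemma upd_meas[measurable (raw)]:
  assumes "i \<in> J" "g \<in> M \<rightarrow>\<^sub>M LI i" "h \<in> M \<rightarrow>\<^sub>M lborel"
  shows "(\<lambda>x. (g x)(i := h x)) \<in> M \<rightarrow>\<^sub>M LJ"
  using assms by (intro measurable_fun_upd[where J = "J - {i}"]) auto

lemma prod_kernel_off_meas: 
  assumes "kern k" "f \<in> M \<rightarrow>\<^sub>M lborel" "g \<in> M \<rightarrow>\<^sub>M LI i"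
  shows "(\<lambda>x. prod_kernel_off k i (f x) (g x)) \<in> borel_measurable M"
  unfolding prod_kernel_off_def using assms by (intro prodK_meas) auto

lemma prod_kernel_off_nonneg: "kern k \<Longrightarrow> 0 \<le> prod_kernel_off k i s y"
  by (auto simp: prod_kernel_off_def kern_nonneg intro!: prod_nonneg)

lemma sum_upd: assumes "i \<in> J" shows "(\<Sum>j\<in>J. ((y(i := t)) j)\<^sup>2) = t\<^sup>2 + (\<Sum>j\<in>J - {i}. (y j :: real)\<^sup>2)"
  using finJ assms by (simp add: sum.remove[of J i])

lemma prod_kernel_upd: assumes "i \<in> J" shows "prod_kernel k s (y(i := t)) = k i s t * prod_kernel_off k i s y"
  unfolding prod_kernel_def prod_kernel_off_def using finJ assms by (simp add: prod.remove[of J i])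

lemma exp_vi_integrable: assumes "0 < \<theta>" "i \<in> J" 
  shows "integrable (LI i) (\<lambda>y. exp (- (\<theta> * v s (y(i := t)))))"
proof (rule Bochner_Integration.integrable_bound)
  show "integrable (LI i) (\<lambda>y. exp (- (\<theta> * a)) * exp (- ((\<theta> * b) * (\<Sum>j\<in>J - {i}. (y j)\<^sup>2))))"
    using integrable_gauss_PiM[of "J - {i}" "\<theta> * b"] finJ b_pos assms by auto
  have "\<theta> * (a + b * (\<Sum>j\<in>J - {i}. (y j)\<^sup>2)) \<le> \<theta> * v s (y(i := t))" for y
  proof (rule mult_left_mono)
    have "0 \<le> b * s\<^sup>2" "0 \<le> b * t\<^sup>2" using b_pos by auto
    then show "a + b * (\<Sum>j\<in>J - {i}. (y j)\<^sup>2) \<le> v s (y(i := t))"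
      using v_lower[of s "y(i := t)"] unfolding sum_upd[OF assms(2)] by (simp only: distrib_left)
  qed (use assms in simp)
  then show "AE y in LI i. norm (exp (- (\<theta> * v s (y(i := t))))) \<le> norm (exp (- (\<theta> * a)) * exp (- ((\<theta> * b) * (\<Sum>j\<in>J - {i}. (y j)\<^sup>2))))"
    by (simp add: exp_add[symmetric] algebra_simps)
qed (use assms in measurable)

lemma potential_prod_kernel_off: assumes "kern k" "i \<in> J" 
  shows "prob_density_potential (LI i) (prod_kernel_off k i s) (\<lambda>y. v s (y(i := t)))"
  using nn_integral_prodK[OF assms(1), of "J - {i}" s] exp_vi_integrable[of 1 i s t] assms
  by unfold_locales (auto simp: prod_kernel_off_nonneg prod_kernel_off_def[symmetric] intro!: prod_kernel_off_meas v_meas' upd_meas)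

lemma nn_integral_LJ_split: assumes "i \<in> J" and [measurable]: "f \<in> borel_measurable LJ"
  shows "(\<integral>\<^sup>+y. f y \<partial>LJ) = (\<integral>\<^sup>+t. \<integral>\<^sup>+y. f (y(i := t)) \<partial>LI i \<partial>lborel)"
proof -
  have J: "insert i (J - {i}) = J" using assms by auto
  show ?thesis using lb.product_nn_integral_insert_rev[of "J - {i}" i f] finJ unfolding J by auto
qed

lemma rel_ent_decomp: assumes "kern k" "i \<in> J"
  shows "rel_ent LJ (prod_kernel k s) (v s) = (\<integral>\<^sup>+t. rel_ent (LI i) (\<lambda>y. k i s t * prod_kernel_off k i s y) (\<lambda>y. v s (y(i := t))) \<partial>lborel)"
proof -
  note prod_kernel_meas[OF assms(1), measurable (raw)]
  show ?thesis unfolding rel_ent_def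
    by (subst nn_integral_LJ_split[OF assms(2)]) (auto simp: prod_kernel_upd assms(2))
qed

lemma c_decomp: assumes "i \<in> J"
  shows "has_bochner_integral lborel (\<lambda>t. \<integral>y. exp (- v s (y(i := t))) \<partial>LI i) (c s)"
proof (rule has_bochner_integral_nn_integral)
  note upd_meas[OF assms, measurable (raw)]
  interpret I: sigma_finite_measure "LI i" using finJ by (intro sigma_finite_LP) auto
  have "(\<integral>\<^sup>+t. ennreal (\<integral>y. exp (- v s (y(i := t))) \<partial>LI i) \<partial>lborel) = (\<integral>\<^sup>+t. \<integral>\<^sup>+y. ennreal (exp (- v s (y(i := t)))) \<partial>LI i \<partial>lborel)"
    using exp_vi_integrable[of 1 i s] assms by (intro nn_integral_cong nn_integral_eq_integral[symmetric]) auto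
  also have "\<dots> = (\<integral>\<^sup>+y. ennreal (exp (- v s y)) \<partial>LJ)"
    using assms by (subst nn_integral_LJ_split[of i]) auto
  also have "\<dots> = ennreal (c s)"
    using exp_v_integrable[of 1 s] by (intro nn_integral_eq_integral) auto
  finally show "(\<integral>\<^sup>+t. ennreal (\<integral>y. exp (- v s (y(i := t))) \<partial>LI i) \<partial>lborel) = ennreal (c s)" .
  show "(\<lambda>t. \<integral>y. exp (- v s (y(i := t))) \<partial>LI i) \<in> borel_measurable lborel" by measurable
qed (auto intro!: Bochner_Integration.integral_nonneg c_nonneg)

lemma coord_weight_nonneg: "0 \<le> coord_weight k i s t" by (simp add: coord_weight_def)

text \<open>The nonnegative term \<open>b * s\<^sup>2\<close> is dropped, which makes the bound
  uniform in \<open>s\<close> and in the kernel.\<close>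

lemma coord_weight_le: assumes k: "kern k" and i: "i \<in> J" shows "coord_weight k i s t \<le> K0 * exp (- (b * t\<^sup>2))"
proof (cases "rel_ent (LI i) (prod_kernel_off k i s) (\<lambda>y. v s (y(i := t))) < \<infinity>")
  case True
  let ?G = "\<lambda>i. \<integral>y. exp (- (b * (\<Sum>j\<in>J - {i}. (y j)\<^sup>2))) \<partial>LI i"
  interpret P: prob_density_potential "LI i" "prod_kernel_off k i s" "\<lambda>y. v s (y(i := t))" by (rule potential_prod_kernel_off[OF k i])
  have "0 \<le> b * s\<^sup>2" using b_pos by simp
  have "(a + b * t\<^sup>2) + 1 - ?G i \<le> free_energy (LI i) (prod_kernel_off k i s) (\<lambda>y. v s (y(i := t)))"
  proof (rule P.free_energy_ge[OF True])
    show "a + b * t\<^sup>2 + b * (\<Sum>j\<in>J - {i}. (y j)\<^sup>2) \<le> v s (y(i := t))" for y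
      using v_lower[of s "y(i := t)"] \<open>0 \<le> b * s\<^sup>2\<close> unfolding sum_upd[OF i] by (simp only: distrib_left)
  qed (use integrable_gauss_PiM[of "J - {i}" b] finJ b_pos in auto)
  moreover have "?G i \<le> gauss_mass" unfolding gauss_mass_def
    using finJ i by (intro member_le_sum) (auto intro!: Bochner_Integration.integral_nonneg)
  ultimately show ?thesis using True by (simp add: coord_weight_def K0_def exp_add[symmetric])
qed (use K0_pos in \<open>simp add: coord_weight_def less_eq_real_def\<close>)

lemma coord_weight_meas: assumes k: "kern k" and i: "i \<in> J" 
  and [measurable]: "f \<in> M \<rightarrow>\<^sub>M lborel" "g \<in> M \<rightarrow>\<^sub>M lborel"
  shows "(\<lambda>x. coord_weight k i (f x) (g x)) \<in> borel_measurable M"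
proof -
  interpret I: sigma_finite_measure "LI i" using finJ by (intro sigma_finite_LP) auto
  note upd_meas[OF i, measurable (raw)] prod_kernel_off_meas[OF k, measurable (raw)]
  have [measurable]: "(\<lambda>x. rel_ent (LI i) (prod_kernel_off k i (f x)) (\<lambda>y. v (f x) (y(i := g x)))) \<in> borel_measurable M"
    unfolding rel_ent_def by measurable
  show ?thesis unfolding coord_weight_def free_energy_def by measurable
qed

lemma coord_weight_integrable: assumes "kern k" "i \<in> J" shows "integrable lborel (coord_weight k i s)"
proof (rule Bochner_Integration.integrable_bound)
  show "integrable lborel (\<lambda>t. K0 * exp (- (b * t\<^sup>2)))" using integrable_gauss[OF b_pos] by simp
  show "coord_weight k i s \<in> borel_measurable lborel" using coord_weight_meas[OF assms, of "\<lambda>_. s" lborel "\<lambda>t. t"] by simp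
qed (use coord_weight_le[OF assms] coord_weight_nonneg K0_pos in \<open>auto simp: abs_mult\<close>)

text \<open>The normalising factor is \<open>exp\<close> of the total free energy because at the
  optimum that energy is \<open>- ln\<close> of the partition function of any single
  coordinate.\<close>

definition good where
  "good k s \<longleftrightarrow> rel_ent LJ (prod_kernel k s) (v s) < \<infinity> \<and>
     (\<forall>i\<in>J. AE t in lborel. k i s t = exp (free_energy LJ (prod_kernel k s) (v s)) * coord_weight k i s t)"

lemma prodK_le:
  assumes k: "kern k" and g: "good k s" and I: "I \<subseteq> J"
  shows "AE y in LP I. (\<Prod>j\<in>I. k j s (y j)) \<le> 
     (exp (free_energy LJ (prod_kernel k s) (v s)) * K0) ^ card I * exp (- (b * (\<Sum>j\<in>I. (y j)\<^sup>2)))"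
proof -
  let ?K = "exp (free_energy LJ (prod_kernel k s) (v s)) * K0"
  have fin: "finite I" using I finJ finite_subset by blast
  have 1: "AE t in lborel. k j s t \<le> ?K * exp (- (b * t\<^sup>2))" if "j \<in> I" for j
  proof -
    have j: "j \<in> J" using that I by auto
    have "AE t in lborel. k j s t = exp (free_energy LJ (prod_kernel k s) (v s)) * coord_weight k j s t" using g j by (auto simp: good_def)
    then show ?thesis
    proof eventually_elim
      case (elim t)
      show ?case unfolding elim mult.assoc by (intro mult_left_mono coord_weight_le k j) auto
    qed
  qed
  have "AE y in LP I. \<forall>j\<in>I. k j s (y j) \<le> ?K * exp (- (b * (y j)\<^sup>2))"
    using fin by (intro AE_finite_allI AE_PiM_lborel_coord 1) auto
  then show ?thesis
  proof eventually_elim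
    case (elim y)
    have "(\<Prod>j\<in>I. k j s (y j)) \<le> (\<Prod>j\<in>I. ?K * exp (- (b * (y j)\<^sup>2)))"
      using elim kern_nonneg[OF k] by (intro prod_mono) auto
    also have "\<dots> = ?K ^ card I * exp (- (b * (\<Sum>j\<in>I. (y j)\<^sup>2)))"
      using fin by (simp add: prod.distrib sum_distrib_left sum_negf[symmetric] exp_sum)
    finally show ?case .
  qed
qed

text \<open>The growth condition enters here: a kernel with Gaussian tails integrates any potential that
  grows slower than every \<open>exp (c |z|\<^sup>2)\<close>.\<close>

lemma integrable_gauss_tail:
  assumes I: "finite I" and [measurable]: "f \<in> borel_measurable (LP I)" "g \<in> borel_measurable (LP I)"
    and f: "\<And>y. 0 \<le> f y" "AE y in LP I. f y \<le> K * exp (- (b * (\<Sum>j\<in>I. (y j)\<^sup>2)))"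
    and g: "\<And>y. \<bar>g y\<bar> \<le> C * exp (b / 2 * (\<Sum>j\<in>I. (y j)\<^sup>2))"
  shows "integrable (LP I) (\<lambda>y. f y * g y)"
proof (rule Bochner_Integration.integrable_bound)
  show "integrable (LP I) (\<lambda>y. (\<bar>K\<bar> * C) * exp (- (b / 2 * (\<Sum>j\<in>I. (y j)\<^sup>2))))"
    using integrable_gauss_PiM[OF I, of "b / 2"] b_pos by simp
  show "AE y in LP I. norm (f y * g y) \<le> norm ((\<bar>K\<bar> * C) * exp (- (b / 2 * (\<Sum>j\<in>I. (y j)\<^sup>2))))"
    using f(2)
  proof eventually_elim
    case (elim y)
    let ?S = "\<Sum>j\<in>I. (y j)\<^sup>2"
    have C: "0 \<le> C" using order_trans[OF abs_ge_zero g[of y]] by (simp add: zero_le_mult_iff)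
    have "\<bar>f y * g y\<bar> \<le> (\<bar>K\<bar> * exp (- (b * ?S))) * (C * exp (b / 2 * ?S))"
      unfolding abs_mult using f(1)[of y] 
      by (intro mult_mono g order_trans[OF _ mult_right_mono[OF abs_ge_self[of K]]]) (use elim C in auto)
    also have "\<dots> = (\<bar>K\<bar> * C) * exp (- (b / 2 * ?S))" by (simp add: exp_add[symmetric] field_simps)
    finally show ?case using C by (simp add: abs_mult)
  qed
qed measurable

text \<open>\<open>s'\<close> is independent of \<open>s\<close> because the envelope argument
  integrates the potential at \<open>s + h\<close> against the conditional at \<open>s\<close>. The
  growth rate \<open>b / 2\<close> uses up half of the Gaussian decay \<open>b\<close>.\<close>

lemma good_integrable:
  assumes k: "kern k" and g: "good k s"
  shows "integrable LJ (\<lambda>y. prod_kernel k s y * v s' y)"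
proof -
  obtain C where C: "C > 0" "\<And>s y. \<bar>v s y\<bar> \<le> C * exp (b / 2 * (s\<^sup>2 + (\<Sum>j\<in>J. (y j)\<^sup>2)))"
    using v_growth[of "b / 2"] b_pos by auto
  show ?thesis
  proof (rule integrable_gauss_tail[OF finJ])
    show "\<bar>v s' y\<bar> \<le> (C * exp (b / 2 * s'\<^sup>2)) * exp (b / 2 * (\<Sum>j\<in>J. (y j)\<^sup>2))" for y
      using C(2)[of s' y] by (simp add: distrib_left exp_add mult.assoc)
    show "AE y in LJ. prod_kernel k s y \<le> (exp (free_energy LJ (prod_kernel k s) (v s)) * K0) ^ card J * exp (- (b * (\<Sum>j\<in>J. (y j)\<^sup>2)))"
      using prodK_le[OF k g order_refl] by (simp add: prod_kernel_def)
  qed (auto intro!: prod_kernel_meas[OF k] prod_kernel_nonneg[OF k])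
qed

text \<open>Finiteness at \<open>s\<close> makes the entropy integrable; as the entropy does not
  involve the potential, it recombines with the energy in any other \<open>v s'\<close>.\<close>

lemma good_FE:
  assumes k: "kern k" and g: "good k s"
  shows "rel_ent LJ (prod_kernel k s) (v s') < \<infinity>"
    and "free_energy LJ (prod_kernel k s) (v s') = (\<integral>y. prod_kernel k s y * ln (prod_kernel k s y) \<partial>LJ) + (\<integral>y. prod_kernel k s y * v s' y \<partial>LJ)"
proof -
  interpret P: prob_density_potential LJ "prod_kernel k s" "v s" by (rule potential_prod_kernel[OF k])
  have fin: "rel_ent LJ (prod_kernel k s) (v s) < \<infinity>" using g by (simp add: good_def)
  have le: "a \<le> v s y" for y 
  proof -
    have "0 \<le> b * (s\<^sup>2 + (\<Sum>j\<in>J. (y j)\<^sup>2))" using b_pos by (auto intro!: mult_nonneg_nonneg add_nonneg_nonneg sum_nonneg)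
    then show ?thesis using v_lower[of s y] by linarith
  qed
  have 1: "integrable LJ (\<lambda>y. prod_kernel k s y * ln (prod_kernel k s y))"
    using P.free_energy_split(2)[OF fin le] exp_v_integrable[of "1/2" s] by simp
  interpret P': prob_density_potential LJ "prod_kernel k s" "v s'"
    using P.A_meas P.A_nonneg P.A_prob exp_v_integrable[of 1 s'] by unfold_locales auto
  show "rel_ent LJ (prod_kernel k s) (v s') < \<infinity>"
    "free_energy LJ (prod_kernel k s) (v s') = (\<integral>y. prod_kernel k s y * ln (prod_kernel k s y) \<partial>LJ) + (\<integral>y. prod_kernel k s y * v s' y \<partial>LJ)"
    using P'.free_energy_combine[OF 1 good_integrable[OF k g]] by auto
qed

lemma good_integrable_coord:
  assumes k: "kern k" and g: "good k s" and i: "i \<in> J"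
  shows "integrable (LI i) (\<lambda>y. prod_kernel_off k i s y * v s (y(i := t)))"
proof -
  obtain C where C: "C > 0" "\<And>s y. \<bar>v s y\<bar> \<le> C * exp (b / 2 * (s\<^sup>2 + (\<Sum>j\<in>J. (y j)\<^sup>2)))"
    using v_growth[of "b / 2"] b_pos by auto
  show ?thesis
  proof (rule integrable_gauss_tail)
    show "\<bar>v s (y(i := t))\<bar> \<le> (C * exp (b / 2 * (s\<^sup>2 + t\<^sup>2))) * exp (b / 2 * (\<Sum>j\<in>J - {i}. (y j)\<^sup>2))" for y
      using C(2)[of s "y(i := t)"] unfolding sum_upd[OF i] by (simp add: distrib_left exp_add mult.assoc)
    show "AE y in LI i. prod_kernel_off k i s y \<le> (exp (free_energy LJ (prod_kernel k s) (v s)) * K0) ^ card (J - {i}) * exp (- (b * (\<Sum>j\<in>J - {i}. (y j)\<^sup>2)))"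
      using prodK_le[OF k g, of "J - {i}"] by (simp add: prod_kernel_off_def)
  qed (use finJ in \<open>auto intro!: prod_kernel_off_meas[OF k] prod_kernel_off_nonneg[OF k] v_meas' upd_meas[OF i]\<close>)
qed

theorem good_conditional:
  assumes k: "kern k" and g: "good k s" and i: "i \<in> J"
  shows "\<exists>c>0. AE t in lborel. k i s t = c * exp (- (\<integral>y. prod_kernel_off k i s y * v s (y(i := t)) \<partial>LI i))"
proof -
  let ?F = "free_energy LJ (prod_kernel k s) (v s)" and ?e = "\<integral>y. prod_kernel_off k i s y * ln (prod_kernel_off k i s y) \<partial>LI i"
  have eq: "AE t in lborel. k i s t = exp ?F * coord_weight k i s t" using g i by (auto simp: good_def)
  \<comment> \<open>One \<open>t\<close> of positive weight is needed to know that the other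
    conditionals have finite entropy. If there were none, \<open>k i s\<close> would vanish almost
    everywhere, against its unit mass.\<close>
  have "\<exists>t. coord_weight k i s t \<noteq> 0"
  proof (rule ccontr)
    assume "\<nexists>t. coord_weight k i s t \<noteq> 0"
    then have "AE t in lborel. ennreal (k i s t) = 0" using eq by auto
    from nn_integral_cong_AE[OF this] have "(\<integral>\<^sup>+t. ennreal (k i s t) \<partial>lborel) = 0" by simp
    then show False using kern_prob[OF k i, of s] by simp
  qed
  then obtain t0 where "coord_weight k i s t0 \<noteq> 0" by auto
  then have fin0: "rel_ent (LI i) (prod_kernel_off k i s) (\<lambda>y. v s (y(i := t0))) < \<infinity>" by (auto simp: coord_weight_def split: if_splits)
  have ent: "integrable (LI i) (\<lambda>y. prod_kernel_off k i s y * ln (prod_kernel_off k i s y))"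
  proof (rule prob_density_potential.free_energy_split(2)[OF potential_prod_kernel_off[OF k i] fin0])
    show "a \<le> v s (y(i := t0))" for y 
    proof -
      have "0 \<le> b * (s\<^sup>2 + (\<Sum>j\<in>J. ((y(i := t0)) j)\<^sup>2))" using b_pos by (auto intro!: mult_nonneg_nonneg add_nonneg_nonneg sum_nonneg)
      then show ?thesis using v_lower[of s "y(i := t0)"] by linarith
    qed
  qed (use exp_vi_integrable[of "1/2" i s t0] i in simp)
  have w: "coord_weight k i s t = exp (- ?e) * exp (- (\<integral>y. prod_kernel_off k i s y * v s (y(i := t)) \<partial>LI i))" for t
  proof -
    note F = prob_density_potential.free_energy_combine[OF potential_prod_kernel_off[OF k i] ent good_integrable_coord[OF k g i, of t]]
    show ?thesis using F(1) by (simp add: coord_weight_def F(2) exp_add[symmetric])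
  qed
  show ?thesis
    by (rule exI[of _ "exp ?F * exp (- ?e)"]) (use eq in \<open>auto simp: w mult.assoc\<close>)
qed

end

context star_min
begin

text \<open>The competitor is the normalised \<open>coord_weight\<close> in one coordinate, which is
  jointly measurable in \<open>s\<close> and \<open>t\<close>. \<open>compare_kernel\<close> gives
  the inequality for almost every \<open>s\<close>, and at each such \<open>s\<close> the two-level
  principle applies with \<open>t\<close> as outer variable.\<close>

theorem AE_good: "AE s in lborel. good k s"
proof -
  obtain W0 where W0: "W0 > 0" "AE s in lborel. 0 < r s \<and> rel_ent LJ (prod_kernel k s) (v s) < \<infinity> \<and> r s = exp (- free_energy LJ (prod_kernel k s) (v s)) / W0"
    using first_marginal by auto
  have *: "AE s in lborel. AE t in lborel. k i s t = exp (free_energy LJ (prod_kernel k s) (v s)) * coord_weight k i s t" if i: "i \<in> J" for i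
  proof -
    define W where "W s = (\<integral>t. coord_weight k i s t \<partial>lborel)" for s
    have Wm[measurable]: "W \<in> borel_measurable lborel"
      unfolding W_def[abs_def] by (rule lborel.borel_measurable_lebesgue_integral) 
        (use coord_weight_meas[OF k i, of fst "lborel \<Otimes>\<^sub>M lborel" snd] in \<open>simp add: case_prod_beta\<close>)
    \<comment> \<open>Falling back on \<open>k\<close> where \<open>W s\<close> is not positive
      keeps the competitor a kernel for every \<open>s\<close>; at the relevant \<open>s\<close>
      positivity comes from the two-level principle.\<close>
    define k' where "k' j s t = (if j = i \<and> 0 < W s then coord_weight k i s t / W s else k j s t)" for j s t
    have k': "kern k'"
      unfolding kern_def
    proof (intro conjI ballI allI)
      fix j assume j: "j \<in> J"
      note [measurable (raw)] = kern_meas[OF k j] coord_weight_meas[OF k i]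
      show "case_prod (k' j) \<in> borel_measurable (lborel \<Otimes>\<^sub>M lborel)" 
        unfolding k'_def[abs_def] case_prod_beta by (cases "j = i") measurable
      show "(\<integral>\<^sup>+ t. ennreal (k' j s t) \<partial>lborel) = 1" for s
      proof (cases "j = i \<and> 0 < W s")
        case True
        then have "k' j s t = coord_weight k i s t / W s" for t by (simp add: k'_def)
        moreover have "(\<integral>\<^sup>+ t. ennreal (coord_weight k i s t / W s) \<partial>lborel) = ennreal (\<integral>t. coord_weight k i s t / W s \<partial>lborel)"
          using True coord_weight_integrable[OF k i, of s] coord_weight_nonneg[of k i s]
          by (intro nn_integral_eq_integral) auto
        ultimately have "(\<integral>\<^sup>+ t. ennreal (k' j s t) \<partial>lborel) = ennreal (\<integral>t. coord_weight k i s t / W s \<partial>lborel)" by simp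
        then show ?thesis using True by (simp add: W_def)
      next
        case False
        then have "k' j s t = k j s t" for t by (auto simp: k'_def)
        then show ?thesis using kern_prob[OF k j] by simp
      qed
    next
      show "0 \<le> k' j s t" for j s t using coord_weight_nonneg[of k i s t] by (auto simp: k'_def kern_nonneg[OF k])
    qed
    have prod_kernel_off': "prod_kernel_off k' i s = prod_kernel_off k i s" for s by (auto simp: prod_kernel_off_def k'_def fun_eq_iff intro!: prod.cong)
    show ?thesis
      using W0(2) compare_kernel[OF k']
    proof eventually_elim
      case (elim s)
      have fin: "rel_ent LJ (prod_kernel k s) (v s) < \<infinity>" and le: "rel_ent LJ (prod_kernel k s) (v s) \<le> rel_ent LJ (prod_kernel k' s) (v s)"
        using elim by auto
      interpret T: two_level "LI i" lborel "k i s" "\<lambda>t. prod_kernel_off k i s" "\<lambda>t y. v s (y(i := t))" "coord_weight k i s"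
      proof (intro two_level.intro two_level_axioms.intro)
        show "sigma_finite_measure (LI i)" using finJ by (intro sigma_finite_LP) auto
        show "k i s \<in> borel_measurable lborel" using kern_meas[OF k i, of "\<lambda>_. s" lborel "\<lambda>t. t"] by simp
        show "(\<lambda>(t, y). prod_kernel_off k i s y) \<in> borel_measurable (lborel \<Otimes>\<^sub>M LI i)"
          unfolding case_prod_beta by (rule prod_kernel_off_meas[OF k]) auto
        show "(\<lambda>(t, y). v s (y(i := t))) \<in> borel_measurable (lborel \<Otimes>\<^sub>M LI i)"
          unfolding case_prod_beta by (intro v_meas' upd_meas i) auto
        show "(\<integral>\<^sup>+ t. rel_ent (LI i) (\<lambda>y. k i s t * prod_kernel_off k i s y) (\<lambda>y. v s (y(i := t))) \<partial>lborel) < \<infinity>"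
          using fin rel_ent_decomp[OF k i, of s] by simp
        show "integrable lborel (\<lambda>t. \<integral>y. exp (- v s (y(i := t))) \<partial>LI i)"
          using c_decomp[OF i, of s] by (simp add: has_bochner_integral_iff)
      qed (auto simp: kern_nonneg[OF k] kern_prob[OF k i] potential_prod_kernel_off[OF k i] coord_weight_def coord_weight_integrable[OF k i])
      have cc: "integral\<^sup>L lborel T.c = c s" using c_decomp[OF i, of s] by (simp add: has_bochner_integral_iff)
      have WT: "W s = T.W" by (simp add: W_def)
      have k'i: "k' i s t = coord_weight k i s t / T.W" for t using T.W_pos by (simp add: k'_def WT)
      have "(\<integral>\<^sup>+ t. rel_ent (LI i) (\<lambda>y. k i s t * prod_kernel_off k i s y) (\<lambda>y. v s (y(i := t))) \<partial>lborel)
        \<le> (\<integral>\<^sup>+ t. rel_ent (LI i) (\<lambda>y. coord_weight k i s t / T.W * prod_kernel_off k i s y) (\<lambda>y. v s (y(i := t))) \<partial>lborel)"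
        using le unfolding rel_ent_decomp[OF k i] rel_ent_decomp[OF k' i] prod_kernel_off' k'i .
      note G = T.gibbs_density[OF this]
      have "rel_ent LJ (prod_kernel k s) (v s) = ennreal (- ln T.W - 1 + c s)"
        using G(2) unfolding rel_ent_decomp[OF k i, of s, symmetric] cc .
      \<comment> \<open>The minimal value is \<open>- ln W - 1 + c s\<close>, and the summand
        \<open>1 - c s\<close> in \<open>free_energy\<close> leaves only
        \<open>- ln W\<close>.\<close>
      then have "free_energy LJ (prod_kernel k s) (v s) = - ln T.W"
        using T.ln_W_le unfolding cc by (simp add: free_energy_def)
      then have "exp (free_energy LJ (prod_kernel k s) (v s)) = 1 / T.W" using T.W_pos by (simp add: exp_minus inverse_eq_divide)
      then show ?case using G(1) by simp
    qed
  qed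
  have "AE s in lborel. \<forall>i\<in>J. AE t in lborel. k i s t = exp (free_energy LJ (prod_kernel k s) (v s)) * coord_weight k i s t"
    using finJ * by (intro AE_finite_allI) auto
  then show ?thesis using W0(2) unfolding good_def by eventually_elim auto
qed

end

section \<open>The first marginal\<close>
lemma AE_lborel_shift: assumes "AE x in lborel. P x" shows "AE x in lborel. P (x + h :: real)"
proof -
  have "AE x in distr lborel borel ((+) h). P x" unfolding lborel_distr_plus by (rule assms)
  from AE_distrD[OF _ this] show ?thesis by (simp add: add.commute)
qed

lemma integral_lborel_shift: "(\<integral>s. f (s + h) \<partial>lborel) = (\<integral>s. f s \<partial>lborel :: real)" for h :: real
  using lborel_integral_real_affine[of 1 f h] by (simp add: add.commute)

lemma integrable_indicator_interval [simp]: 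
  "integrable lborel (indicator {a..b} :: real \<Rightarrow> real)" "integrable lborel (indicator {a..<b} :: real \<Rightarrow> real)"
  using emeasure_bounded_finite[of "{a..b}"] emeasure_bounded_finite[of "{a..<b}"]
  by (auto intro!: integrable_real_indicator)

locale star_diff = star_min +
  fixes dv :: "real \<Rightarrow> ('a \<Rightarrow> real) \<Rightarrow> real"
  assumes dv_meas[measurable]: "case_prod dv \<in> borel_measurable (lborel \<Otimes>\<^sub>M LP J)"
    and v_deriv: "\<And>s y. ((\<lambda>s. v s y) has_real_derivative dv s y) (at s)"
    and v_tangent: "\<And>s z y. v s y + dv s y * (z - s) \<le> v z y"
begin

lemma dv_meas'[measurable (raw)]:
  assumes "f \<in> M \<rightarrow>\<^sub>M lborel" "g \<in> M \<rightarrow>\<^sub>M LP J"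
  shows "(\<lambda>x. dv (f x) (g x)) \<in> borel_measurable M"
  using measurable_compose[OF measurable_Pair[OF assms] dv_meas] by simp

definition F where "F s = free_energy LJ (prod_kernel k s) (v s)"

definition m where "m s = (\<integral>y. prod_kernel k s y * dv s y \<partial>LJ)"

definition \<Delta> where "\<Delta> s h = (\<integral>y. prod_kernel k s y * (v (s + h) y - v s y) \<partial>LJ)"

lemma F_meas[measurable]: "F \<in> borel_measurable lborel"
  unfolding F_def using free_energy_meas[OF k] .

lemma m_meas[measurable]: "m \<in> borel_measurable lborel"
proof -
  note prod_kernel_meas[OF k, measurable (raw)]
  show ?thesis unfolding m_def by measurable
qed

lemma \<Delta>_meas[measurable]: "(\<lambda>s. \<Delta> s h) \<in> borel_measurable lborel"
proof -
  note prod_kernel_meas[OF k, measurable (raw)]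
  show ?thesis unfolding \<Delta>_def by measurable
qed

text \<open>Testing optimality against the kernel translated by \<open>h\<close>.\<close>

lemma F_increment_le: "AE s in lborel. F (s + h) - F s \<le> \<Delta> s h"
proof -
  define k' where "k' j s t = k j (s - h) t" for j s t
  have k': "kern k'"
    unfolding kern_def
  proof (intro conjI ballI allI)
    fix j assume j: "j \<in> J"
    note kern_meas[OF k j, measurable (raw)]
    show "case_prod (k' j) \<in> borel_measurable (lborel \<Otimes>\<^sub>M lborel)" 
      unfolding k'_def[abs_def] case_prod_beta by measurable
  qed (use kern_prob[OF k] in \<open>auto simp: k'_def kern_nonneg[OF k]\<close>)
  obtain W0 where W0: "AE s in lborel. 0 < r s \<and> rel_ent LJ (prod_kernel k s) (v s) < \<infinity> \<and> r s = exp (- free_energy LJ (prod_kernel k s) (v s)) / W0"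
    using first_marginal by auto
  have "AE s in lborel. rel_ent LJ (prod_kernel k s) (v s) \<le> rel_ent LJ (prod_kernel k (s - h)) (v s)"
    using compare_kernel[OF k'] W0 by eventually_elim (auto simp: prod_kernel_def[abs_def] k'_def)
  from AE_lborel_shift[OF this, of h] AE_good
  show ?thesis
  proof eventually_elim
    case (elim s)
    note G = good_FE[OF k elim(2)]
    have i: "integrable LJ (\<lambda>y. prod_kernel k s y * v (s + h) y)" "integrable LJ (\<lambda>y. prod_kernel k s y * v s y)"
      by (rule good_integrable[OF k elim(2)])+
    have "enn2real (rel_ent LJ (prod_kernel k (s + h)) (v (s + h))) \<le> enn2real (rel_ent LJ (prod_kernel k s) (v (s + h)))"
      using elim(1) G(1)[of "s + h"] by (intro enn2real_mono) auto
    then have "F (s + h) \<le> free_energy LJ (prod_kernel k s) (v (s + h))" by (simp add: F_def free_energy_def)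
    then show ?case using i by (simp add: F_def G(2) \<Delta>_def right_diff_distrib)
  qed
qed

section \<open>Bounds locally uniform in the first coordinate\<close>

definition H where "H R y = \<bar>v (R + 1) y - v R y\<bar> + \<bar>v (- R) y - v (- R - 1) y\<bar>"

lemma dv_mono: assumes "s \<le> z" shows "dv s y \<le> dv z y"
proof (cases "s = z")
  case False
  then have "0 \<le> (dv z y - dv s y) * (z - s)" "s < z"
    using v_tangent[of s y z] v_tangent[of z y s] assms by (auto simp: algebra_simps)
  then show ?thesis by (simp add: zero_le_mult_iff)
qed simp

text \<open>By convexity the slope on \<open>[-R, R]\<close> lies between the increments of
  \<open>v\<close> over \<open>[-R - 1, -R]\<close> and over \<open>[R, R + 1]\<close>, so the
  growth condition on \<open>v\<close> also controls the derivative.\<close>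

lemma dv_le_H: assumes "\<bar>s\<bar> \<le> R" shows "\<bar>dv s y\<bar> \<le> H R y"
proof -
  have "s \<le> R" "- R \<le> s" using assms by auto
  have "dv s y \<le> v (R + 1) y - v R y" using dv_mono[OF \<open>s \<le> R\<close>, of y] v_tangent[of R y "R + 1"] by simp
  moreover have "v (- R) y - v (- R - 1) y \<le> dv s y" 
    using dv_mono[OF \<open>- R \<le> s\<close>, of y] v_tangent[of "- R" y "- R - 1"] by simp
  ultimately show ?thesis by (auto simp: H_def)
qed

lemma v_lipschitz: assumes "\<bar>s\<bar> \<le> R" "\<bar>z\<bar> \<le> R" shows "\<bar>v z y - v s y\<bar> \<le> \<bar>z - s\<bar> * H R y"
proof -
  have "dv s y * (z - s) \<le> v z y - v s y" "v z y - v s y \<le> dv z y * (z - s)"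
    using v_tangent[of s y z] v_tangent[of z y s] by (auto simp: algebra_simps)
  then have "\<bar>v z y - v s y\<bar> \<le> max \<bar>dv s y * (z - s)\<bar> \<bar>dv z y * (z - s)\<bar>" by linarith
  also have "\<dots> \<le> \<bar>z - s\<bar> * H R y"
    using dv_le_H[OF assms(1), of y] dv_le_H[OF assms(2), of y]
    by (auto simp: abs_mult mult.commute[of "\<bar>z - s\<bar>"] intro!: mult_right_mono)
  finally show ?thesis .
qed

lemma H_nonneg: "0 \<le> H R y" by (simp add: H_def)

definition gauss where "gauss y = exp (- (b * (\<Sum>j\<in>J. (y j)\<^sup>2)))"

lemma gauss_H_integrable: "integrable LJ (\<lambda>y. gauss y * H R y)"
proof -
  obtain C where C: "C > 0" "\<And>s y. \<bar>v s y\<bar> \<le> C * exp (b / 2 * (s\<^sup>2 + (\<Sum>j\<in>J. (y j)\<^sup>2)))"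
    using v_growth[of "b / 2"] b_pos by auto
  have *: "integrable LJ (\<lambda>y. gauss y * v s y)" for s
  proof (rule integrable_gauss_tail[OF finJ, where K = 1])
    show "\<bar>v s y\<bar> \<le> (C * exp (b / 2 * s\<^sup>2)) * exp (b / 2 * (\<Sum>j\<in>J. (y j)\<^sup>2))" for y
      using C(2)[of s y] by (simp add: distrib_left exp_add mult.assoc)
    show "gauss \<in> borel_measurable LJ" unfolding gauss_def by measurable
  qed (auto simp: gauss_def)
  have "gauss y * H R y = \<bar>gauss y * v (R + 1) y - gauss y * v R y\<bar> + \<bar>gauss y * v (- R) y - gauss y * v (- R - 1) y\<bar>" for y
    by (simp add: H_def right_diff_distrib[symmetric] abs_mult gauss_def distrib_left)
  then show ?thesis using * by auto
qed

definition tame where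
  "tame R K B s \<longleftrightarrow> good k s \<and> \<bar>F s\<bar> \<le> B \<and> (AE y in LJ. prod_kernel k s y \<le> K * gauss y)"

lemma AE_tame: "\<exists>K B. 0 < K \<and> 0 \<le> B \<and> (AE s in lborel. \<bar>s\<bar> \<le> R \<longrightarrow> tame R K B s)"
proof -
  obtain C where C: "C > 0" "\<And>s. rel_ent LJ (prod_kernel unif_kernel s) (v s) < \<infinity>" "\<And>s. free_energy LJ (prod_kernel unif_kernel s) (v s) \<le> C * exp (s\<^sup>2)"
    using unif_kernel_growth by auto
  define D where "D = C * exp (R\<^sup>2)"
  let ?G = "\<integral>y. exp (- (b * (\<Sum>j\<in>J. (y j)\<^sup>2))) \<partial>LJ"
  \<comment> \<open>The constant of \<open>prodK_le\<close> with \<open>F s\<close> replaced by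
    \<open>D\<close>, its upper bound on \<open>[-R, R]\<close> from the uniform kernel; it no
    longer depends on \<open>s\<close>.\<close>
  define K where "K = (exp D * K0) ^ card J"
  define B where "B = max \<bar>D\<bar> \<bar>a + 1 - ?G\<bar>"
  obtain W0 where W0: "AE s in lborel. 0 < r s \<and> rel_ent LJ (prod_kernel k s) (v s) < \<infinity> \<and> r s = exp (- free_energy LJ (prod_kernel k s) (v s)) / W0"
    using first_marginal by auto
  have "AE s in lborel. \<bar>s\<bar> \<le> R \<longrightarrow> tame R K B s"
    using compare_kernel[OF kern_unif_kernel] W0 AE_good
  proof eventually_elim
    case (elim s)
    show ?case
    proof
      assume s: "\<bar>s\<bar> \<le> R"
      have "enn2real (rel_ent LJ (prod_kernel k s) (v s)) \<le> enn2real (rel_ent LJ (prod_kernel unif_kernel s) (v s))"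
        using elim C(2)[of s] by (intro enn2real_mono) auto
      then have "F s \<le> free_energy LJ (prod_kernel unif_kernel s) (v s)" by (simp add: F_def free_energy_def)
      also have "\<dots> \<le> C * exp (s\<^sup>2)" by (rule C)
      also have "\<dots> \<le> D" using s C(1) by (simp add: D_def abs_le_square_iff[symmetric])
      finally have FD: "F s \<le> D" .
      have "0 \<le> b * s\<^sup>2" using b_pos by simp
      then have "a + 1 - ?G \<le> F s" using free_energy_ge_gauss[OF k, of s] elim unfolding F_def by linarith
      then have "\<bar>F s\<bar> \<le> B" using FD by (auto simp: B_def)
      moreover have "AE y in LJ. prod_kernel k s y \<le> K * gauss y"
        using prodK_le[OF k elim(3) order_refl]
      proof eventually_elim
        case (elim y)
        have "(exp (free_energy LJ (prod_kernel k s) (v s)) * K0) ^ card J \<le> K"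
          unfolding K_def using FD K0_pos by (intro power_mono mult_right_mono) (auto simp: F_def)
        then have "(exp (free_energy LJ (prod_kernel k s) (v s)) * K0) ^ card J * gauss y \<le> K * gauss y"
          by (intro mult_right_mono) (auto simp: gauss_def)
        then show ?case using elim unfolding prod_kernel_def gauss_def by linarith
      qed
      ultimately show "tame R K B s" using elim by (simp add: tame_def)
    qed
  qed
  moreover have "0 < K" using K0_pos by (simp add: K_def)
  moreover have "0 \<le> B" by (simp add: B_def)
  ultimately show ?thesis by blast
qed

text \<open>The integral of the dominating function. This one number bounds \<open>m\<close>, the
  quotients \<open>\<Delta> s h / h\<close> and the slopes of \<open>F\<close> on
  \<open>[-R, R]\<close>.\<close>

definition lip where "lip R K = K * (\<integral>y. gauss y * H R y \<partial>LJ)"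

text \<open>Used with \<open>\<kappa> = 1\<close> for derivatives and difference quotients, and with
  \<open>\<kappa> = \<bar>h\<bar>\<close> for increments.\<close>

lemma tame_dominated:
  assumes "tame R K B s" and w: "\<And>y. \<bar>w y\<bar> \<le> \<kappa> * H R y" "0 \<le> \<kappa>" and [measurable]: "w \<in> borel_measurable LJ"
  shows "AE y in LJ. \<bar>prod_kernel k s y * w y\<bar> \<le> \<kappa> * (K * (gauss y * H R y))"
    and "\<bar>\<integral>y. prod_kernel k s y * w y \<partial>LJ\<bar> \<le> \<kappa> * lip R K"
proof -
  have AE: "AE y in LJ. prod_kernel k s y \<le> K * gauss y" using assms by (simp add: tame_def)
  show 1: "AE y in LJ. \<bar>prod_kernel k s y * w y\<bar> \<le> \<kappa> * (K * (gauss y * H R y))"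
    using AE
  proof eventually_elim
    case (elim y)
    have "\<bar>prod_kernel k s y * w y\<bar> \<le> (K * gauss y) * (\<kappa> * H R y)"
      unfolding abs_mult using elim w prod_kernel_nonneg[OF k, of s y] H_nonneg[of R y] by (intro mult_mono) auto
    then show ?case by (simp add: mult_ac)
  qed
  have int: "integrable LJ (\<lambda>y. \<kappa> * (K * (gauss y * H R y)))" using gauss_H_integrable by simp
  have "(\<lambda>y. prod_kernel k s y * w y) \<in> borel_measurable LJ" using prod_kernel_meas[OF k, of "\<lambda>_. s" LJ "\<lambda>y. y"] by simp
  then have "integrable LJ (\<lambda>y. prod_kernel k s y * w y)"
    by (rule Bochner_Integration.integrable_bound[OF int]) (use 1 in eventually_elim, auto)
  then have "(\<integral>y. \<bar>prod_kernel k s y * w y\<bar> \<partial>LJ) \<le> (\<integral>y. \<kappa> * (K * (gauss y * H R y)) \<partial>LJ)"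
    by (intro integral_mono_AE integrable_abs int 1)
  with integral_abs_bound[of LJ "\<lambda>y. prod_kernel k s y * w y"]
  have "\<bar>\<integral>y. prod_kernel k s y * w y \<partial>LJ\<bar> \<le> (\<integral>y. \<kappa> * (K * (gauss y * H R y)) \<partial>LJ)" by linarith
  then show "\<bar>\<integral>y. prod_kernel k s y * w y \<partial>LJ\<bar> \<le> \<kappa> * lip R K" by (simp add: lip_def)
qed

lemma tame_\<Delta>: assumes "tame R K B s" "\<bar>s\<bar> \<le> R" "\<bar>s + h\<bar> \<le> R"
  shows "\<bar>\<Delta> s h\<bar> \<le> \<bar>h\<bar> * lip R K"
  unfolding \<Delta>_def using v_lipschitz[OF assms(2,3)] by (intro tame_dominated(2)[OF assms(1)]) auto

lemma tame_m: assumes "tame R K B s" "\<bar>s\<bar> \<le> R" shows "\<bar>m s\<bar> \<le> lip R K"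
  using tame_dominated(2)[OF assms(1), of "dv s" 1] dv_le_H[OF assms(2)] by (simp add: m_def)

lemma tame_\<Delta>_deriv: assumes s: "tame R K B s" "\<bar>s\<bar> < R" and h: "h \<longlonglongrightarrow> 0" "\<And>n. h n \<noteq> 0" "\<And>n. \<bar>s + h n\<bar> \<le> R"
  shows "(\<lambda>n. \<Delta> s (h n) / h n) \<longlonglongrightarrow> m s"
proof -
  note fm = prod_kernel_meas[OF k, of "\<lambda>_. s" LJ "\<lambda>y. y"]
  have "(\<lambda>n. \<integral>y. prod_kernel k s y * ((v (s + h n) y - v s y) / h n) \<partial>LJ) \<longlonglongrightarrow> (\<integral>y. prod_kernel k s y * dv s y \<partial>LJ)"
  proof (rule integral_dominated_convergence)
    show "integrable LJ (\<lambda>y. K * (gauss y * H R y))" using gauss_H_integrable by simp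
    show "AE y in LJ. (\<lambda>n. prod_kernel k s y * ((v (s + h n) y - v s y) / h n)) \<longlonglongrightarrow> prod_kernel k s y * dv s y"
    proof (rule AE_I2, rule tendsto_mult_left)
      fix y
      have "((\<lambda>h. (v (s + h) y - v s y) / h) \<longlongrightarrow> dv s y) (at 0)"
        using v_deriv[of y s] by (simp add: DERIV_def)
      moreover have "filterlim h (at 0) sequentially" using h by (simp add: filterlim_at)
      ultimately show "(\<lambda>n. (v (s + h n) y - v s y) / h n) \<longlonglongrightarrow> dv s y"
        by (rule filterlim_compose)
    qed
    show "AE y in LJ. norm (prod_kernel k s y * ((v (s + h n) y - v s y) / h n)) \<le> K * (gauss y * H R y)" for n
    proof -
      have "\<bar>(v (s + h n) y - v s y) / h n\<bar> \<le> 1 * H R y" for y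
        using v_lipschitz[of s R "s + h n" y] s h(2)[of n] h(3)[of n] by (simp add: abs_divide field_simps)
      from tame_dominated(1)[OF s(1) this] show ?thesis by simp
    qed
  qed (use fm in simp_all)
  then show ?thesis by (simp add: m_def \<Delta>_def)
qed

text \<open>\<open>F\<close> comes from a kernel determined only up to null sets, so the Lipschitz
  estimate at \<open>x\<close> is required against almost every \<open>s\<close>. Inside
  \<open>(-R, R)\<close> this already makes \<open>F x\<close> the limit of averages over short
  intervals at \<open>x\<close>.\<close>

definition regular where
  "regular R K x \<longleftrightarrow> (AE s in lborel. \<bar>s\<bar> \<le> R \<longrightarrow> \<bar>F s - F x\<bar> \<le> lip R K * \<bar>s - x\<bar>)"

text \<open>\<open>F_increment_le\<close> at \<open>s\<close> with step \<open>h\<close>, and at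
  \<open>s + h\<close> with step \<open>- h\<close>, bounds the increment from both sides.\<close>

lemma AE_regular: assumes T: "AE s in lborel. \<bar>s\<bar> \<le> R \<longrightarrow> tame R K B s"
  shows "AE x in lborel. \<bar>x\<bar> \<le> R \<longrightarrow> regular R K x"
proof -
  have 1: "AE s in lborel. \<bar>s\<bar> \<le> R \<and> \<bar>s + h\<bar> \<le> R \<longrightarrow> \<bar>F (s + h) - F s\<bar> \<le> lip R K * \<bar>h\<bar>" for h
    using F_increment_le[of h] AE_lborel_shift[OF F_increment_le[of "- h"], of h] T AE_lborel_shift[OF T, of h]
  proof eventually_elim
    case (elim s)
    show ?case
    proof
      assume s: "\<bar>s\<bar> \<le> R \<and> \<bar>s + h\<bar> \<le> R"
      have "\<bar>\<Delta> s h\<bar> \<le> \<bar>h\<bar> * lip R K" using elim(3) s by (intro tame_\<Delta>[of R K B]) simp_all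
      moreover have "\<bar>\<Delta> (s + h) (- h)\<bar> \<le> \<bar>- h\<bar> * lip R K"
        using elim(4) s by (intro tame_\<Delta>[of R K B]) simp_all
      moreover have "F s - F (s + h) \<le> \<Delta> (s + h) (- h)" using elim(2) by simp
      ultimately have "\<bar>F (s + h) - F s\<bar> \<le> \<bar>h\<bar> * lip R K" using elim(1) unfolding abs_minus_cancel by linarith
      then show "\<bar>F (s + h) - F s\<bar> \<le> lip R K * \<bar>h\<bar>" by (simp add: mult.commute)
    qed
  qed
  \<comment> \<open>The null set of \<open>s\<close> depends on \<open>h\<close>. Exchanging the
    quantifiers gives, for almost every \<open>s\<close>, the bound for almost every
    \<open>h\<close>, that is, against almost every second point.\<close>
  have "AE h in lborel. AE s in lborel. \<bar>s\<bar> \<le> R \<and> \<bar>s + h\<bar> \<le> R \<longrightarrow> \<bar>F (s + h) - F s\<bar> \<le> lip R K * \<bar>h\<bar>"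
    using 1 by simp
  then have "AE s in lborel. AE h in lborel. \<bar>s\<bar> \<le> R \<and> \<bar>s + h\<bar> \<le> R \<longrightarrow> \<bar>F (s + h) - F s\<bar> \<le> lip R K * \<bar>h\<bar>"
    by (subst lborel_pair.AE_commute) measurable
  then show ?thesis
  proof eventually_elim
    case (elim x)
    show ?case
    proof
      assume x: "\<bar>x\<bar> \<le> R"
      show "regular R K x"
        using AE_lborel_shift[OF elim, of "- x"] x by (simp add: regular_def)
    qed
  qed
qed

section \<open>The integral formula for the free energy\<close>

context
  fixes R K B
  assumes K: "0 < K" and B: "0 \<le> B" and T: "AE s in lborel. \<bar>s\<bar> \<le> R \<longrightarrow> tame R K B s"
begin

lemma lip_nonneg: "0 \<le> lip R K"
  unfolding lip_def using K H_nonneg by (auto simp: gauss_def intro!: Bochner_Integration.integral_nonneg)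

lemma F_int: assumes [measurable]: "A \<in> sets lborel" and A: "A \<subseteq> {-R..R}"
  shows "integrable lborel (\<lambda>s. indicator A s * F s)"
proof (rule Bochner_Integration.integrable_bound)
  show "integrable lborel (\<lambda>s. B * indicator {-R..R} s :: real)" by simp
  show "AE s in lborel. norm (indicator A s * F s) \<le> norm (B * indicator {-R..R} s :: real)"
    using T
  proof eventually_elim
    case (elim s)
    show ?case
    proof (cases "s \<in> A")
      case True
      then have "s \<in> {-R..R}" using A by blast
      moreover from this have "\<bar>F s\<bar> \<le> B" using elim by (simp add: tame_def abs_le_iff)
      ultimately show ?thesis using True B by simp
    qed simp
  qed
qed measurable

lemma m_int: assumes [measurable]: "A \<in> sets lborel" and A: "A \<subseteq> {-R..R}"
  shows "integrable lborel (\<lambda>s. indicator A s * m s)"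
proof (rule Bochner_Integration.integrable_bound)
  show "integrable lborel (\<lambda>s. lip R K * indicator {-R..R} s :: real)" by simp
  show "AE s in lborel. norm (indicator A s * m s) \<le> norm (lip R K * indicator {-R..R} s :: real)"
    using T
  proof eventually_elim
    case (elim s)
    show ?case
    proof (cases "s \<in> A")
      case True
      then have "s \<in> {-R..R}" using A by blast
      moreover from this have "\<bar>m s\<bar> \<le> lip R K" using elim by (intro tame_m[of R K B]) (simp_all add: abs_le_iff)
      ultimately show ?thesis using True lip_nonneg by simp
    qed simp
  qed
qed measurable

text \<open>The free left endpoint \<open>p\<close> covers averages to the right of \<open>x\<close>
  (\<open>p = x\<close>) and to the left (\<open>p = x - h\<close>); steps of both signs need
  both.\<close>

lemma average_error:
  assumes x: "regular R K x" and h: "0 < h" and A: "{p..<p + h} \<subseteq> {-R..R}" "{p..<p + h} \<subseteq> {x - h..x + h}"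
  shows "\<bar>(\<integral>s. indicator {p..<p + h} s * F s \<partial>lborel) / h - F x\<bar> \<le> lip R K * h"
proof -
  let ?A = "{p..<p + h}"
  have int: "integrable lborel (\<lambda>s. indicator ?A s * F s)" by (rule F_int) (use A in auto)
  have int': "integrable lborel (\<lambda>s. indicator ?A s * F x)" by simp
  have int2: "integrable lborel (\<lambda>s. indicator ?A s * (F s - F x))"
    unfolding right_diff_distrib by (intro Bochner_Integration.integrable_diff int int')
  have e1: "(\<integral>s. indicator ?A s * z \<partial>lborel) = h * z" for z using h by simp
  have "(\<integral>s. indicator ?A s * (F s - F x) \<partial>lborel) = (\<integral>s. indicator ?A s * F s \<partial>lborel) - (\<integral>s. indicator ?A s * F x \<partial>lborel)"
    unfolding right_diff_distrib by (rule Bochner_Integration.integral_diff[OF int int'])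
  then have "\<bar>(\<integral>s. indicator ?A s * F s \<partial>lborel) - h * F x\<bar> = \<bar>\<integral>s. indicator ?A s * (F s - F x) \<partial>lborel\<bar>"
    unfolding e1 by (rule arg_cong[OF sym])
  also have "\<dots> \<le> (\<integral>s. \<bar>indicator ?A s * (F s - F x)\<bar> \<partial>lborel)" by (rule integral_abs_bound)
  also have "\<dots> \<le> (\<integral>s. indicator ?A s * (lip R K * h) \<partial>lborel)"
  proof (rule integral_mono_AE)
    show "integrable lborel (\<lambda>s. \<bar>indicator ?A s * (F s - F x)\<bar>)" using int2 by (rule integrable_abs)
    show "integrable lborel (\<lambda>s. indicator ?A s * (lip R K * h))" 
      by (rule integrable_mult_left) simp
    show "AE s in lborel. \<bar>indicator ?A s * (F s - F x)\<bar> \<le> indicator ?A s * (lip R K * h)"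
      using x[unfolded regular_def]
    proof (rule AE_mp, intro AE_I2 impI)
      fix s assume s: "\<bar>s\<bar> \<le> R \<longrightarrow> \<bar>F s - F x\<bar> \<le> lip R K * \<bar>s - x\<bar>"
      show "\<bar>indicator ?A s * (F s - F x)\<bar> \<le> indicator ?A s * (lip R K * h)"
      proof (cases "s \<in> ?A")
        case True
        then have "s \<in> {-R..R}" "s \<in> {x - h..x + h}" using A by blast+
        then have sR: "\<bar>s\<bar> \<le> R" and sh: "\<bar>s - x\<bar> \<le> h" by (simp_all add: abs_le_iff)
        have "\<bar>F s - F x\<bar> \<le> lip R K * \<bar>s - x\<bar>" using s sR by blast
        also have "\<dots> \<le> lip R K * h" by (rule mult_left_mono[OF sh lip_nonneg])
        finally show ?thesis using True by simp
      next
        case False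
        then show ?thesis by simp
      qed
    qed
  qed
  also have "\<dots> = h * (lip R K * h)" by (rule e1)
  finally have *: "\<bar>(\<integral>s. indicator ?A s * F s \<partial>lborel) - h * F x\<bar> \<le> h * (lip R K * h)" .
  have "\<bar>X / h - z\<bar> \<le> d" if "\<bar>X - h * z\<bar> \<le> h * d" for X z d :: real
  proof -
    have "\<bar>X / h - z\<bar> = \<bar>X - h * z\<bar> / h" using h by (simp add: field_simps abs_divide[symmetric])
    then show ?thesis using that h by (simp add: pos_divide_le_eq mult.commute)
  qed
  from this[OF *] show ?thesis .
qed

lemma F_diff_eq: assumes x: "regular R K x" and y: "regular R K y" and xy: "- R < x" "x < y" "y < R"
  shows "F y - F x = (\<integral>s. indicator {x..<y} s * m s \<partial>lborel)"
proof -
  \<comment> \<open>Room at both ends: translations by at most \<delta> keep \<open>[x, y)\<close>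
    inside \<open>[-R, R]\<close>.\<close>
  define \<delta> where "\<delta> = min (R - y) (x + R)"
  have \<delta>: "0 < \<delta>" "y + \<delta> \<le> R" "- R \<le> x - \<delta>" using xy by (auto simp: \<delta>_def)
  define h where "h n = \<delta> / real (Suc n)" for n
  have h: "0 < h n" "h n \<le> \<delta>" for n using \<delta> by (auto simp: h_def field_simps)
  have h0: "h \<longlonglongrightarrow> 0"
    unfolding h_def[abs_def] divide_inverse by (rule tendsto_mult_right_zero[OF LIMSEQ_inverse_real_of_nat])
  define I where "I c d = (\<integral>s. indicator {c..<d} s * F s \<partial>lborel)" for c d
  have lim: "(\<lambda>n. I (c n) (c n + h n) / h n) \<longlonglongrightarrow> F z"
    if "regular R K z" "x \<le> z" "z \<le> y" "\<And>n. c n = z \<or> c n = z - h n" for c z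
  proof -
    have *: "\<bar>I (c n) (c n + h n) / h n - F z\<bar> \<le> lip R K * h n" for n
      unfolding I_def
    proof (rule average_error[OF that(1) h(1)])
      have "z - h n \<le> c n" "c n \<le> z" using that(4)[of n] h(1)[of n] by linarith+
      moreover have "- R \<le> z - h n" "z + h n \<le> R" using h(2)[of n] \<delta>(2,3) that(2,3) by linarith+
      ultimately have "- R \<le> c n" "c n + h n \<le> R" "c n + h n \<le> z + h n" "z - h n \<le> c n" 
        by linarith+
      then show "{c n..<c n + h n} \<subseteq> {- R..R}" "{c n..<c n + h n} \<subseteq> {z - h n..z + h n}"
        by (meson atLeastAtMost_iff atLeastLessThan_iff less_imp_le order_trans subsetI)+
    qed
    have 0: "(\<lambda>n. lip R K * h n) \<longlonglongrightarrow> 0" using h0 by (rule tendsto_mult_right_zero)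
    have "(\<lambda>n. I (c n) (c n + h n) / h n - F z) \<longlonglongrightarrow> 0"
    proof (rule Lim_null_comparison[OF always_eventually 0], intro allI)
      show "norm (I (c n) (c n + h n) / h n - F z) \<le> lip R K * h n" for n
        unfolding real_norm_def by (rule *)
    qed
    then show ?thesis by (rule LIM_zero_cancel)
  qed
  have limD: "(\<lambda>n. (\<integral>s. indicator {x..<y} s * (\<Delta> s (e n) / e n) \<partial>lborel)) \<longlonglongrightarrow> (\<integral>s. indicator {x..<y} s * m s \<partial>lborel)"
    if e: "\<And>n. \<bar>e n\<bar> = h n" for e
  proof (rule integral_dominated_convergence)
    have e': "e n \<noteq> 0" "\<bar>e n\<bar> \<le> \<delta>" for n using e[of n] h[of n] by auto
    have e0: "e \<longlonglongrightarrow> 0" using h0 e by (simp add: tendsto_rabs_zero_iff[symmetric, of e])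
    show "integrable lborel (\<lambda>s. lip R K * indicator {x..<y} s)" by simp
    show "AE s in lborel. (\<lambda>n. indicator {x..<y} s * (\<Delta> s (e n) / e n)) \<longlonglongrightarrow> indicator {x..<y} s * m s"
      using T
    proof eventually_elim
      case (elim s)
      show ?case
      proof (cases "s \<in> {x..<y}")
        case True
        have "\<bar>s + e n\<bar> \<le> R" for n using True e'(2)[of n] \<delta> by auto
        then have "(\<lambda>n. \<Delta> s (e n) / e n) \<longlonglongrightarrow> m s"
          using elim True xy by (intro tame_\<Delta>_deriv[of R K B] e0 e') auto
        then show ?thesis by (rule tendsto_mult_left)
      qed simp
    qed
    show "AE s in lborel. norm (indicator {x..<y} s * (\<Delta> s (e n) / e n)) \<le> lip R K * indicator {x..<y} s" for n
      using T
    proof eventually_elim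
      case (elim s)
      show ?case
      proof (cases "s \<in> {x..<y}")
        case True
        have "\<bar>\<Delta> s (e n)\<bar> \<le> \<bar>e n\<bar> * lip R K" 
          using elim True xy e'(2)[of n] \<delta> by (intro tame_\<Delta>[of R K B]) auto
        then show ?thesis using True e'(1)[of n] by (simp add: abs_divide field_simps)
      qed simp
    qed
  qed measurable
  have \<Delta>_int: "integrable lborel (\<lambda>s. indicator {x..<y} s * \<Delta> s e)" if "\<bar>e\<bar> \<le> \<delta>" for e
  proof (rule Bochner_Integration.integrable_bound)
    show "integrable lborel (\<lambda>s. \<delta> * lip R K * indicator {x..<y} s :: real)" by simp
    show "AE s in lborel. norm (indicator {x..<y} s * \<Delta> s e) \<le> norm (\<delta> * lip R K * indicator {x..<y} s :: real)"
      using T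
    proof eventually_elim
      case (elim s)
      show ?case
      proof (cases "s \<in> {x..<y}")
        case True
        have "\<bar>\<Delta> s e\<bar> \<le> \<bar>e\<bar> * lip R K" 
          using elim True xy that \<delta> by (intro tame_\<Delta>[of R K B]) auto
        also have "\<dots> \<le> \<delta> * lip R K" using that lip_nonneg by (rule mult_right_mono)
        finally have "\<bar>\<Delta> s e\<bar> \<le> \<bar>\<delta> * lip R K\<bar>" by linarith
        then show ?thesis using True by simp
      qed simp
    qed
  qed measurable
  have I_split: "I c d + I d e = I c e" if "c \<le> d" "d \<le> e" "- R \<le> c" "e \<le> R" for c d e
  proof -
    have "indicator {c..<e} s * F s = indicator {c..<d} s * F s + indicator {d..<e} s * F s" for s
      using that by (auto simp: indicator_def)
    moreover have "integrable lborel (\<lambda>s. indicator {c..<d} s * F s)" "integrable lborel (\<lambda>s. indicator {d..<e} s * F s)"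
      using that by (auto intro!: F_int)
    ultimately show ?thesis unfolding I_def by simp
  qed
  have I_le: "I (x + e) (y + e) - I x y \<le> (\<integral>s. indicator {x..<y} s * \<Delta> s e \<partial>lborel)" if "\<bar>e\<bar> \<le> \<delta>" for e
  proof -
    have ind: "indicator {x + e..<y + e} (s + e) = (indicator {x..<y} s :: real)" for s by (auto simp: indicator_def)
    have Ish: "I (x + e) (y + e) = (\<integral>s. indicator {x..<y} s * F (s + e) \<partial>lborel)"
      unfolding I_def ind[symmetric] by (rule integral_lborel_shift[symmetric])
    have i1: "integrable lborel (\<lambda>s. indicator {x + e..<y + e} s * F s)" using that \<delta> by (intro F_int) auto
    have i2: "integrable lborel (\<lambda>s. indicator {x..<y} s * F (s + e))"
      using lborel_integrable_real_affine[OF i1, of 1 e] by (simp add: ind add.commute[of e])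
    have i3: "integrable lborel (\<lambda>s. indicator {x..<y} s * F s)" using xy by (intro F_int) auto
    have "I (x + e) (y + e) - I x y = (\<integral>s. indicator {x..<y} s * F (s + e) - indicator {x..<y} s * F s \<partial>lborel)"
      unfolding Ish Bochner_Integration.integral_diff[OF i2 i3] by (simp add: I_def)
    also have "\<dots> \<le> (\<integral>s. indicator {x..<y} s * \<Delta> s e \<partial>lborel)"
    proof (rule integral_mono_AE)
      show "AE s in lborel. indicator {x..<y} s * F (s + e) - indicator {x..<y} s * F s \<le> indicator {x..<y} s * \<Delta> s e"
        using F_increment_le[of e] by eventually_elim (auto simp: indicator_def)
    qed (use i2 i3 \<Delta>_int[OF that] in auto)
    finally show ?thesis .
  qed
  have "F y - F x \<le> (\<integral>s. indicator {x..<y} s * m s \<partial>lborel)"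
  proof (rule LIMSEQ_le)
    show "(\<lambda>n. I y (y + h n) / h n - I x (x + h n) / h n) \<longlonglongrightarrow> F y - F x"
      using xy by (intro tendsto_diff lim x y) auto
    show "(\<lambda>n. (\<integral>s. indicator {x..<y} s * (\<Delta> s (h n) / h n) \<partial>lborel)) \<longlonglongrightarrow> (\<integral>s. indicator {x..<y} s * m s \<partial>lborel)"
      using h by (intro limD) (simp add: less_imp_le)
    have "I y (y + h n) / h n - I x (x + h n) / h n \<le> (\<integral>s. indicator {x..<y} s * (\<Delta> s (h n) / h n) \<partial>lborel)" for n
    proof -
      \<comment> \<open>Both sides are the integral over \<open>[x, y + h n)\<close>, cut in two
        ways. The increment of the integral thus reduces to short intervals at \<open>x\<close> and
        \<open>y\<close>, with no relation needed between \<open>h n\<close> and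
        \<open>y - x\<close>.\<close>
      have "I x (x + h n) + I (x + h n) (y + h n) = I x y + I y (y + h n)"
        using I_split[of x "x + h n" "y + h n"] I_split[of x y "y + h n"] xy h[of n] \<delta> by simp
      then have "I y (y + h n) - I x (x + h n) \<le> (\<integral>s. indicator {x..<y} s * \<Delta> s (h n) \<partial>lborel)"
        using I_le[of "h n"] h[of n] by simp
      then have "(I y (y + h n) - I x (x + h n)) / h n \<le> (\<integral>s. indicator {x..<y} s * \<Delta> s (h n) \<partial>lborel) / h n"
        using h[of n] by (intro divide_right_mono) auto
      then show ?thesis by (simp add: diff_divide_distrib)
    qed
    then show "\<exists>N. \<forall>n\<ge>N. I y (y + h n) / h n - I x (x + h n) / h n \<le> (\<integral>s. indicator {x..<y} s * (\<Delta> s (h n) / h n) \<partial>lborel)"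
      by blast
  qed
  \<comment> \<open>Negative steps: dividing by \<open>- h n\<close> reverses the inequality, and
    the averages are now those to the left of \<open>x\<close> and \<open>y\<close>.\<close>
  moreover have "(\<integral>s. indicator {x..<y} s * m s \<partial>lborel) \<le> F y - F x"
  proof (rule LIMSEQ_le)
    show "(\<lambda>n. I (y - h n) (y - h n + h n) / h n - I (x - h n) (x - h n + h n) / h n) \<longlonglongrightarrow> F y - F x"
      using xy by (intro tendsto_diff lim x y) auto
    show "(\<lambda>n. (\<integral>s. indicator {x..<y} s * (\<Delta> s (- h n) / (- h n)) \<partial>lborel)) \<longlonglongrightarrow> (\<integral>s. indicator {x..<y} s * m s \<partial>lborel)"
      using h by (intro limD) (simp add: less_imp_le)
    have "(\<integral>s. indicator {x..<y} s * (\<Delta> s (- h n) / (- h n)) \<partial>lborel) \<le> I (y - h n) (y - h n + h n) / h n - I (x - h n) (x - h n + h n) / h n" for n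
    proof -
      have "I (x - h n) (y - h n) + I (y - h n) y = I (x - h n) x + I x y"
        using I_split[of "x - h n" "y - h n" y] I_split[of "x - h n" x y] xy h[of n] \<delta> by simp
      then have "I (x - h n) x - I (y - h n) y \<le> (\<integral>s. indicator {x..<y} s * \<Delta> s (- h n) \<partial>lborel)"
        using I_le[of "- h n"] h[of n] by simp
      then have "(I (x - h n) x - I (y - h n) y) / h n \<le> (\<integral>s. indicator {x..<y} s * \<Delta> s (- h n) \<partial>lborel) / h n"
        using h[of n] by (intro divide_right_mono) auto
      then show ?thesis by (simp add: diff_divide_distrib)
    qed
    then show "\<exists>N. \<forall>n\<ge>N. (\<integral>s. indicator {x..<y} s * (\<Delta> s (- h n) / (- h n)) \<partial>lborel) \<le> I (y - h n) (y - h n + h n) / h n - I (x - h n) (x - h n + h n) / h n"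
      by blast
  qed
  ultimately show ?thesis by (rule antisym)
qed

lemma m_interval: assumes "- R \<le> x" "x \<le> y" "y \<le> R"
  shows "interval_lebesgue_integrable lborel (ereal x) (ereal y) m"
    and "(LBINT s=x..y. m s) = (\<integral>s. indicator {x..<y} s * m s \<partial>lborel)"
proof -
  show "interval_lebesgue_integrable lborel (ereal x) (ereal y) m"
  proof -
    have "{x<..<y} \<subseteq> {-R..R}" using assms by auto
    then show ?thesis using m_int[of "{x<..<y}"] assms
      by (simp add: interval_lebesgue_integrable_def set_integrable_def einterval_eq)
  qed
  have "AE s in lborel. indicator {x<..<y} s * m s = indicator {x..<y} s * m s"
    using AE_lborel_singleton[of x] by eventually_elim (auto simp: indicator_def)
  then show "(LBINT s=x..y. m s) = (\<integral>s. indicator {x..<y} s * m s \<partial>lborel)"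
    using assms unfolding interval_lebesgue_integral_def set_lebesgue_integral_def
    by (auto simp: einterval_eq intro!: integral_cong_AE)
qed

lemma m_interval_integrable: assumes "\<bar>x\<bar> \<le> R" "\<bar>y\<bar> \<le> R" 
  shows "interval_lebesgue_integrable lborel (ereal x) (ereal y) m"
proof (cases "x \<le> y")
  case True
  then show ?thesis using m_interval(1)[of x y] assms by auto
next
  case False
  then show ?thesis using m_interval(1)[of y x] assms 
    by (auto simp: interval_lebesgue_integrable_def)
qed

lemma F_diff_LBINT: assumes x: "regular R K x" and y: "regular R K y" and xy: "\<bar>x\<bar> < R" "\<bar>y\<bar> < R"
  shows "F y = F x - (LBINT s=0..x. m s) + (LBINT s=0..y. m s)"
proof -
  have 1: "F y - F x = (LBINT s=x..y. m s)" 
  proof (rule linorder_cases[of x y])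
    assume "x < y" then show ?thesis using F_diff_eq[OF x y] m_interval(2)[of x y] xy by auto
  next
    assume "y < x" 
    then have "F x - F y = (LBINT s=y..x. m s)" using F_diff_eq[OF y x] m_interval(2)[of y x] xy by auto
    then show ?thesis using interval_integral_endpoints_reverse[of "ereal x" "ereal y" m] by simp
  qed simp
  have "(LBINT s=ereal 0..x. m s) + (LBINT s=x..y. m s) = (LBINT s=ereal 0..y. m s)"
  proof (rule interval_integral_sum)
    have "\<bar>min 0 (min x y)\<bar> \<le> R" "\<bar>max 0 (max x y)\<bar> \<le> R" using xy by auto
    from m_interval_integrable[OF this]
    show "interval_lebesgue_integrable lborel (min (ereal 0) (min (ereal x) (ereal y))) (max (ereal 0) (max (ereal x) (ereal y))) m"
      by (simp only: ereal_min ereal_max)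
  qed
  then show ?thesis using 1 by (simp add: zero_ereal_def)
qed

end

theorem first_marginal_formula:
  "\<exists>c>0. AE s in lborel. r s = c * exp (- (LBINT t=0..s. m t))"
proof -
  have "\<forall>n::nat. \<exists>K B. 0 < K \<and> 0 \<le> B \<and> (AE s in lborel. \<bar>s\<bar> \<le> real n \<longrightarrow> tame (real n) K B s)"
    using AE_tame by auto
  then obtain K B where KB: "\<And>n. 0 < K n" "\<And>n. 0 \<le> B n" 
    "\<And>n. AE s in lborel. \<bar>s\<bar> \<le> real n \<longrightarrow> tame (real n) (K n) (B n) s" by metis
  have "AE x in lborel. \<bar>x\<bar> \<le> real n \<longrightarrow> regular (real n) (K n) x" for n
    by (rule AE_regular[OF KB(3)])
  then have reg: "AE x in lborel. \<forall>n. \<bar>x\<bar> \<le> real n \<longrightarrow> regular (real n) (K n) x"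
    by (simp add: AE_all_countable)
  \<comment> \<open>The point 0 need not be regular. The formula is anchored at some regular
    \<open>x0\<close>, and \<open>c0\<close> below absorbs the change of base point; countably many
    radii still leave a single null set.\<close>
  have "\<exists>x. \<forall>n. \<bar>x\<bar> \<le> real n \<longrightarrow> regular (real n) (K n) x"
  proof (rule ccontr)
    assume "\<not> ?thesis"
    then have "AE x in lborel :: real measure. False" using reg by auto
    then have "(UNIV :: real set) \<in> null_sets lborel" by (simp add: AE_iff_null)
    from null_setsD1[OF this] show False by simp
  qed
  then obtain x0 where x0: "\<And>n. \<bar>x0\<bar> \<le> real n \<Longrightarrow> regular (real n) (K n) x0" by auto
  define c0 where "c0 = F x0 - (LBINT s=0..x0. m s)"
  have Feq: "AE y in lborel. F y = c0 + (LBINT s=0..y. m s)"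
    using reg
  proof eventually_elim
    case (elim y)
    obtain n where "max \<bar>x0\<bar> \<bar>y\<bar> < real n" using reals_Archimedean2 by blast
    then have n: "\<bar>x0\<bar> < real n" "\<bar>y\<bar> < real n" by simp_all
    have r: "regular (real n) (K n) x0" "regular (real n) (K n) y"
      using x0[of n] elim n by (simp_all add: less_imp_le)
    show ?case unfolding c0_def by (rule F_diff_LBINT[OF KB r n])
  qed
  obtain W where W: "W > 0" "AE s in lborel. 0 < r s \<and> rel_ent LJ (prod_kernel k s) (v s) < \<infinity> \<and> r s = exp (- free_energy LJ (prod_kernel k s) (v s)) / W"
    using first_marginal by auto
  have "AE s in lborel. r s = (exp (- c0) / W) * exp (- (LBINT t=0..s. m t))"
    using W(2) Feq
  proof eventually_elim
    case (elim s)
    have "r s = exp (- F s) / W" using elim(1) by (simp add: F_def)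
    also have "\<dots> = (exp (- c0) * exp (- (LBINT t=0..s. m t))) / W"
      unfolding elim(2) exp_add[symmetric] by simp
    finally show ?case by simp
  qed
  moreover have "0 < exp (- c0) / W" using W(1) by simp
  ultimately show ?thesis by blast
qed

end

section \<open>Products, kernels and coordinates\<close>
text \<open>Reduced to nonnegative integrands, for which kernel integrals are measurable: positive
  minus negative part where the absolute integral is finite, and the default value 0 of the Bochner
  integral elsewhere.\<close>

lemma kernel_integral_meas:
  fixes f :: "'a \<Rightarrow> 'b \<Rightarrow> real"
  assumes f[measurable]: "case_prod f \<in> borel_measurable (M \<Otimes>\<^sub>M N)" and L: "L \<in> M \<rightarrow>\<^sub>M prob_algebra N"
  shows "(\<lambda>x. \<integral>y. f x y \<partial>L x) \<in> borel_measurable M"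
proof -
  note L' = measurable_prob_algebraD[OF L]
  have sL: "sets (L x) = sets N" if "x \<in> space M" for x using subprob_measurableD(2)[OF L' that] .
  have m[measurable]: "(\<lambda>x. \<integral>\<^sup>+y. ennreal (g (f x y)) \<partial>L x) \<in> borel_measurable M" if [measurable]: "g \<in> borel_measurable borel" for g :: "real \<Rightarrow> real"
    by (rule nn_integral_measurable_subprob_algebra2[OF _ L']) measurable
  have fx: "f x \<in> borel_measurable (L x)" if x: "x \<in> space M" for x
    using measurable_compose[OF measurable_Pair1'[OF x] f] by (simp add: measurable_cong_sets[OF sL[OF x] refl])
  have [measurable]: "(\<lambda>x. \<integral>\<^sup>+y. ennreal (f x y) \<partial>L x) \<in> borel_measurable M"
    "(\<lambda>x. \<integral>\<^sup>+y. ennreal (- f x y) \<partial>L x) \<in> borel_measurable M" "(\<lambda>x. \<integral>\<^sup>+y. ennreal \<bar>f x y\<bar> \<partial>L x) \<in> borel_measurable M"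
    using m[of "\<lambda>x. x"] m[of uminus] m[of abs] by simp_all
  have "(\<integral>y. f x y \<partial>L x) = (if (\<integral>\<^sup>+y. ennreal \<bar>f x y\<bar> \<partial>L x) < \<infinity> 
      then enn2real (\<integral>\<^sup>+y. ennreal (f x y) \<partial>L x) - enn2real (\<integral>\<^sup>+y. ennreal (- f x y) \<partial>L x) else 0)"
    if x: "x \<in> space M" for x
    using fx[OF x] by (auto simp: integrable_iff_bounded real_lebesgue_integral_def intro!: not_integrable_integral_eq)
  then show ?thesis
    by (simp cong: measurable_cong)
qed

text \<open>Rectangles form an intersection-stable generator, and on them the product measure is a
  finite product of measurable kernel values.\<close>

lemma prob_kernel_PiM:
  assumes fin: "finite I" and K: "\<And>j. j \<in> I \<Longrightarrow> K j \<in> M \<rightarrow>\<^sub>M prob_algebra (N j)"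
  shows "(\<lambda>s. PiM I (\<lambda>j. K j s)) \<in> M \<rightarrow>\<^sub>M prob_algebra (PiM I N)"
proof (rule measurable_prob_algebra_generated[OF sets_PiM Int_stable_prod_algebra prod_algebra_sets_into_space])
  fix s assume s: "s \<in> space M"
  have 1: "prob_space (K j s)" "sets (K j s) = sets (N j)" if "j \<in> I" for j
    using measurable_space[OF K[OF that] s] by (auto simp: space_prob_algebra)
  show "prob_space (Pi\<^sub>M I (\<lambda>j. K j s))" using 1 by (intro prob_space_PiM) auto
  show "sets (Pi\<^sub>M I (\<lambda>j. K j s)) = sets (Pi\<^sub>M I N)" using 1 by (intro sets_PiM_cong) auto
next
  fix A assume "A \<in> prod_algebra I N"
  then obtain X where X: "A = Pi\<^sub>E I X" "\<And>j. j \<in> I \<Longrightarrow> X j \<in> sets (N j)"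
    by (auto simp: prod_algebra_eq_finite[OF fin])
  have "emeasure (Pi\<^sub>M I (\<lambda>j. K j s)) A = (\<Prod>j\<in>I. emeasure (K j s) (X j))" if s: "s \<in> space M" for s
  proof -
    \<comment> \<open>The product locale asks for a probability measure at every index, so indices
      outside \<open>I\<close> receive a point mass.\<close>
    define K' where "K' j = (if j \<in> I then K j s else return (count_space UNIV) undefined)" for j
    have 1: "prob_space (K j s)" "sets (K j s) = sets (N j)" if "j \<in> I" for j
      using measurable_space[OF K[OF that] s] by (auto simp: space_prob_algebra)
    have "prob_space (K' j)" for j using 1 by (auto simp: K'_def intro!: prob_space_return)
    then interpret product_prob_space K' by (simp add: product_prob_space_def product_prob_space_axioms_def product_sigma_finite_def prob_space_imp_sigma_finite)
    interpret finite_product_prob_space K' I by standard (rule fin)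
    have "Pi\<^sub>M I (\<lambda>j. K j s) = Pi\<^sub>M I K'" by (rule PiM_cong) (auto simp: K'_def)
    then show ?thesis using measure_times[of X] X 1 by (simp add: K'_def)
  qed
  moreover have "(\<lambda>s. \<Prod>j\<in>I. emeasure (K j s) (X j)) \<in> borel_measurable M"
    using X by (intro borel_measurable_prod_ennreal measurable_emeasure_kernel[OF measurable_prob_algebraD[OF K]]) auto
  ultimately show "(\<lambda>s. emeasure (Pi\<^sub>M I (\<lambda>j. K j s)) A) \<in> borel_measurable M"
    by (simp cong: measurable_cong)
qed

lemma prob_kernel_density:
  assumes g[measurable]: "case_prod g \<in> borel_measurable (M \<Otimes>\<^sub>M lborel)" and 1: "\<And>s. s \<in> space M \<Longrightarrow> (\<integral>\<^sup>+t. g s t \<partial>lborel) = 1"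
  shows "(\<lambda>s. density lborel (g s)) \<in> M \<rightarrow>\<^sub>M prob_algebra borel"
proof (rule measurable_prob_algebra_generated[of _ UNIV "sets borel"])
  show "sets borel = sigma_sets UNIV (sets (borel :: 'b measure))" by (metis sets.sigma_sets_eq space_borel)
  show "Int_stable (sets (borel :: 'b measure))" by (auto simp: Int_stable_def)
  fix s assume s: "s \<in> space M"
  have [measurable]: "g s \<in> borel_measurable borel" using measurable_compose[OF measurable_Pair1'[OF s] g] by simp
  show "prob_space (density lborel (g s))"
    by standard (simp add: emeasure_density 1[OF s])
next
  fix A assume [measurable]: "A \<in> sets (borel :: 'b measure)"
  have gm: "g s \<in> borel_measurable borel" if "s \<in> space M" for s 
    using measurable_compose[OF measurable_Pair1'[OF that] g] by simp
  have "(\<lambda>s. emeasure (density lborel (g s)) A) \<in> borel_measurable M \<longleftrightarrow> (\<lambda>s. \<integral>\<^sup>+t. g s t * indicator A t \<partial>lborel) \<in> borel_measurable M"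
    using gm by (intro measurable_cong) (simp add: emeasure_density)
  also have \<dots> by measurable
  finally show "(\<lambda>s. emeasure (density lborel (g s)) A) \<in> borel_measurable M" .
qed auto

lemma PiM_density_lborel:
  assumes fin: "finite I" and g: "\<And>j. j \<in> I \<Longrightarrow> g j \<in> borel_measurable lborel"
    and 1: "\<And>j. j \<in> I \<Longrightarrow> (\<integral>\<^sup>+t. g j t \<partial>lborel) = 1"
  shows "PiM I (\<lambda>j. density lborel (g j)) = density (LP I) (\<lambda>y. \<Prod>j\<in>I. g j (y j) :: ennreal)"
proof -
  define K' where "K' j = (if j \<in> I then density lborel (g j) else return borel 0)" for j
  have K'p: "prob_space (K' j)" for j
  proof (cases "j \<in> I")
    case True
    then show ?thesis using g 1 by (auto simp: K'_def emeasure_density intro!: prob_spaceI)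
  qed (auto simp: K'_def intro!: prob_space_return)
  then interpret product_sigma_finite K' by (simp add: product_sigma_finite_def prob_space_imp_sigma_finite)
  have P: "PiM I (\<lambda>j. density lborel (g j)) = PiM I K'" by (rule PiM_cong) (auto simp: K'_def)
  have s: "sets (LP I) = sets (PiM I K')" by (rule sets_PiM_cong) (auto simp: K'_def)
  have gm: "(\<lambda>y. \<Prod>j\<in>I. g j (y j)) \<in> borel_measurable (LP I)"
  proof (rule borel_measurable_prod_ennreal)
    fix j assume j: "j \<in> I"
    have "(\<lambda>y. y j) \<in> LP I \<rightarrow>\<^sub>M lborel" using j by (rule measurable_component_singleton)
    from measurable_compose[OF this g[OF j]] show "(\<lambda>y. g j (y j)) \<in> borel_measurable (LP I)" .
  qed
  have "density (LP I) (\<lambda>y. \<Prod>j\<in>I. g j (y j)) = PiM I K'"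
  proof (rule PiM_eqI[OF fin])
    show "sets (density (LP I) (\<lambda>y. \<Prod>j\<in>I. g j (y j))) = sets (PiM I K')" using s by simp
    fix A assume A: "\<And>i. i \<in> I \<Longrightarrow> A i \<in> sets (K' i)"
    then have A': "A i \<in> sets borel" if "i \<in> I" for i using that by (auto simp: K'_def)
    have "emeasure (density (LP I) (\<lambda>y. \<Prod>j\<in>I. g j (y j))) (Pi\<^sub>E I A)
      = (\<integral>\<^sup>+y. (\<Prod>j\<in>I. g j (y j)) * indicator (Pi\<^sub>E I A) y \<partial>LP I)"
      using A' fin by (intro emeasure_density gm sets_PiM_I_finite) auto
    also have "\<dots> = (\<integral>\<^sup>+y. (\<Prod>j\<in>I. g j (y j) * indicator (A j) (y j)) \<partial>LP I)"
    proof (rule nn_integral_cong)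
      fix y assume "y \<in> space (LP I)"
      then have "indicator (Pi\<^sub>E I A) y = (\<Prod>j\<in>I. indicator (A j) (y j) :: ennreal)"
        using fin by (auto simp: indicator_def PiE_iff space_PiM prod_zero_iff)
      then show "(\<Prod>j\<in>I. g j (y j)) * indicator (Pi\<^sub>E I A) y = (\<Prod>j\<in>I. g j (y j) * indicator (A j) (y j))"
        by (simp add: prod.distrib)
    qed
    also have "\<dots> = (\<Prod>j\<in>I. \<integral>\<^sup>+t. g j t * indicator (A j) t \<partial>lborel)"
      using fin A' g by (intro lb.product_nn_integral_prod) auto
    also have "\<dots> = (\<Prod>i\<in>I. emeasure (K' i) (A i))"
      using g A' by (intro prod.cong) (auto simp: K'_def emeasure_density)
    finally show "emeasure (density (LP I) (\<lambda>y. \<Prod>j\<in>I. g j (y j))) (Pi\<^sub>E I A) = (\<Prod>i\<in>I. emeasure (K' i) (A i))" .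
  qed
  then show ?thesis using P by simp
qed

lemma vembed_meas: 
  fixes i1 :: "'n::finite"
  assumes f: "f \<in> M \<rightarrow>\<^sub>M borel" and g: "\<And>j. j \<noteq> i1 \<Longrightarrow> (\<lambda>x. g x j) \<in> M \<rightarrow>\<^sub>M borel"
  shows "(\<lambda>x. vembed i1 (f x) (g x)) \<in> M \<rightarrow>\<^sub>M borel"
proof (subst borel_measurable_euclidean_space, intro ballI)
  fix b :: "real^'n" assume "b \<in> Basis"
  then obtain i where "b = axis i 1" by (auto simp: Basis_vec_def)
  then show "(\<lambda>x. vembed i1 (f x) (g x) \<bullet> b) \<in> borel_measurable M"
    using f g[of i] by (cases "i = i1") (auto simp: inner_axis vembed_def)
qed

lemma vembed_meas_pair[measurable (raw)]: 
  assumes "f \<in> M \<rightarrow>\<^sub>M lborel" and g: "g \<in> M \<rightarrow>\<^sub>M LP (UNIV - {i1})"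
  shows "(\<lambda>x. vembed i1 (f x) (g x)) \<in> M \<rightarrow>\<^sub>M borel"
  using assms(1) measurable_compose[OF g measurable_component_singleton, of j for j]
  by (intro vembed_meas) auto

lemma prod_Basis_vec: "(\<Prod>b\<in>Basis. (x :: real^'n) \<bullet> b) = (\<Prod>i\<in>UNIV. x $ i)"
proof -
  have "(Basis :: (real^'n) set) = (\<lambda>i. axis i 1) ` UNIV" by (auto simp: Basis_vec_def)
  moreover have "inj (\<lambda>i. axis i (1::real) :: real^'n)" by (auto simp: inj_on_def axis_eq_axis)
  ultimately show ?thesis using prod.reindex[of "\<lambda>i. axis i 1" UNIV "\<lambda>b. x \<bullet> b"] by (simp add: inner_axis)
qed

text \<open>Lebesgue measure is determined by its values on boxes, and splitting off one coordinate
  turns a box into a rectangle.\<close>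

lemma lborel_vembed: 
  fixes i1 :: "'n::finite"
  shows "(lborel :: (real^'n) measure) = distr (lborel \<Otimes>\<^sub>M LP (UNIV - {i1})) borel (\<lambda>(s, y). vembed i1 s y)"
proof (rule lborel_eqI)
  let ?J = "UNIV - {i1}"
  let ?T = "\<lambda>(s, y). vembed i1 s y"
  interpret J: sigma_finite_measure "LP ?J" by (rule sigma_finite_LP) simp
  interpret fJ: finite_product_sigma_finite "\<lambda>_. lborel :: real measure" ?J by standard simp
  fix l u :: "real^'n" assume lu: "\<And>b. b \<in> Basis \<Longrightarrow> l \<bullet> b \<le> u \<bullet> b"
  then have le: "l $ i \<le> u $ i" for i using lu[of "axis i 1"] by (simp add: inner_axis)
  have [measurable]: "?T \<in> lborel \<Otimes>\<^sub>M LP ?J \<rightarrow>\<^sub>M borel" by measurable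
  have box: "vembed i1 s y \<in> box l u \<longleftrightarrow> s \<in> {l $ i1<..<u $ i1} \<and> (\<forall>j\<in>?J. y j \<in> {l $ j<..<u $ j})" for s y
  proof -
    have "(\<forall>i. Q i) \<longleftrightarrow> Q i1 \<and> (\<forall>j\<in>?J. Q j)" for Q by blast
    from this[of "\<lambda>i. l $ i < vembed i1 s y $ i \<and> vembed i1 s y $ i < u $ i"]
    show ?thesis unfolding mem_box_cart by (simp add: vembed_def)
  qed
  have "?T -` box l u \<inter> space (lborel \<Otimes>\<^sub>M LP ?J) = {l $ i1<..<u $ i1} \<times> Pi\<^sub>E ?J (\<lambda>j. {l $ j<..<u $ j})"
    unfolding space_pair_measure space_PiM using box by (auto simp: PiE_iff)
  then have "emeasure (distr (lborel \<Otimes>\<^sub>M LP ?J) borel ?T) (box l u) = emeasure (lborel \<Otimes>\<^sub>M LP ?J) ({l $ i1<..<u $ i1} \<times> Pi\<^sub>E ?J (\<lambda>j. {l $ j<..<u $ j}))"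
    by (subst emeasure_distr) auto
  also have "\<dots> = emeasure lborel {l $ i1<..<u $ i1} * emeasure (LP ?J) (Pi\<^sub>E ?J (\<lambda>j. {l $ j<..<u $ j}))"
    by (intro J.emeasure_pair_measure_Times) auto
  also have "emeasure (LP ?J) (Pi\<^sub>E ?J (\<lambda>j. {l $ j<..<u $ j})) = (\<Prod>j\<in>?J. emeasure lborel {l $ j<..<u $ j})"
    by (rule fJ.measure_times) auto
  also have "\<dots> = ennreal (\<Prod>j\<in>?J. u $ j - l $ j)" using le by (simp add: prod_ennreal)
  also have "emeasure lborel {l $ i1<..<u $ i1} * \<dots> = ennreal ((u $ i1 - l $ i1) * (\<Prod>j\<in>?J. u $ j - l $ j))"
    using le by (simp add: ennreal_mult prod_nonneg)
  also have "(u $ i1 - l $ i1) * (\<Prod>j\<in>?J. u $ j - l $ j) = (\<Prod>j\<in>UNIV. (u - l) $ j)"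
    by (simp add: prod.remove[of UNIV i1])
  finally show "emeasure (distr (lborel \<Otimes>\<^sub>M LP ?J) borel ?T) (box l u) = ennreal (\<Prod>b\<in>Basis. (u - l) \<bullet> b)"
    by (simp add: prod_Basis_vec)
qed simp

lemma nn_integral_vembed:
  fixes i1 :: "'n::finite"
  assumes [measurable]: "f \<in> borel_measurable borel"
  shows "(\<integral>\<^sup>+z. f z \<partial>(lborel :: (real^'n) measure)) = (\<integral>\<^sup>+s. \<integral>\<^sup>+y. f (vembed i1 s y) \<partial>LP (UNIV - {i1}) \<partial>lborel)"
proof -
  interpret J: sigma_finite_measure "LP (UNIV - {i1})" by (rule sigma_finite_LP) simp
  have "(\<integral>\<^sup>+z. f z \<partial>(lborel :: (real^'n) measure)) = (\<integral>\<^sup>+(s, y). f (vembed i1 s y) \<partial>(lborel \<Otimes>\<^sub>M LP (UNIV - {i1})))"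
    unfolding case_prod_beta
    by (subst lborel_vembed[of i1], subst nn_integral_distr) (simp_all add: case_prod_beta)
  also have "\<dots> = (\<integral>\<^sup>+s. \<integral>\<^sup>+y. f (vembed i1 s y) \<partial>LP (UNIV - {i1}) \<partial>lborel)"
    by (subst J.nn_integral_fst[symmetric]) (auto simp: case_prod_beta)
  finally show ?thesis .
qed

definition star_kernel where
  "star_kernel i1 K s = distr (PiM (UNIV - {i1}) (\<lambda>j. K j s)) borel (vembed i1 s)"

lemma star_kernel_meas:
  fixes i1 :: "'n::finite"
  assumes K: "\<And>j. j \<noteq> i1 \<Longrightarrow> K j \<in> borel \<rightarrow>\<^sub>M prob_algebra borel"
  shows "star_kernel i1 K \<in> borel \<rightarrow>\<^sub>M prob_algebra (borel :: (real^'n) measure)"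
  unfolding star_kernel_def[abs_def]
proof (rule measurable_distr_prob_space2)
  show "(\<lambda>x. PiM (UNIV - {i1}) (\<lambda>j. K j x)) \<in> borel \<rightarrow>\<^sub>M prob_algebra (LP (UNIV - {i1}))"
    using K by (intro prob_kernel_PiM) (auto simp: prob_algebra_def subprob_algebra_def cong: measurable_cong_sets)
  show "(\<lambda>(x, y). vembed i1 x y) \<in> borel \<Otimes>\<^sub>M LP (UNIV - {i1}) \<rightarrow>\<^sub>M borel" by measurable
qed

lemma emeasure_star_measure:
  fixes i1 :: "'n::finite"
  assumes d: "star_data i1 mu1 K" and A: "A \<in> sets borel"
  shows "emeasure (star_measure i1 mu1 K) A = (\<integral>\<^sup>+s. emeasure (star_kernel i1 K s) A \<partial>mu1)"
    and "sets (star_measure i1 mu1 K) = sets borel"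
proof -
  have m: "mu1 \<in> space (prob_algebra borel)" using d by (auto simp: star_data_def space_prob_algebra)
  have k: "star_kernel i1 K \<in> borel \<rightarrow>\<^sub>M prob_algebra borel" using d by (intro star_kernel_meas) (auto simp: star_data_def)
  have e: "star_measure i1 mu1 K = bind mu1 (star_kernel i1 K)" by (simp add: star_measure_def star_kernel_def[abs_def])
  show "emeasure (star_measure i1 mu1 K) A = (\<integral>\<^sup>+s. emeasure (star_kernel i1 K s) A \<partial>mu1)"
    unfolding e by (rule emeasure_bind_prob_algebra[OF m k A])
  show "sets (star_measure i1 mu1 K) = sets borel" unfolding e by (rule sets_bind'[OF m k])
qed

section \<open>The Kullback-Leibler divergence of star-shaped densities\<close>
text \<open>Only countably many half-lines are tested, so an equality of conditional measures that
  is known almost everywhere for each half-line holds off one common null set.\<close>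

lemma real_measure_eqI_rational:
  fixes M N :: "real measure"
  assumes M: "sets M = sets borel" "prob_space M" and N: "sets N = sets borel"
    and eq: "\<And>x::rat. emeasure M {..<real_of_rat x} = emeasure N {..<real_of_rat x}"
  shows "M = N"
proof -
  let ?E = "range (\<lambda>x::rat. {..<real_of_rat x})"
  have "borel = sigma UNIV ?E"
  proof (rule borel_eq_sigmaI1[OF borel_Iio])
    fix A :: "real set" assume "A \<in> range lessThan"
    then obtain c where A: "A = {..<c}" by auto
    have "A = (\<Union>x\<in>{x::rat. real_of_rat x \<le> c}. {..<real_of_rat x})"
    proof safe
      fix y assume "y \<in> A"
      then obtain q where "y < real_of_rat q" "real_of_rat q < c" using of_rat_dense[of y c] A by auto
      then show "y \<in> (\<Union>x\<in>{x::rat. real_of_rat x \<le> c}. {..<real_of_rat x})" 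
        by (intro UN_I[of q]) auto
    qed (use A in auto)
    also have "\<dots> \<in> sets (sigma UNIV ?E)" by (intro sets.countable_UN') auto
    finally show "A \<in> sets (sigma UNIV ?E)" .
  qed auto
  then have "sets (borel :: real measure) = sets (sigma UNIV ?E)" by (rule arg_cong)
  then have s: "sets (borel :: real measure) = sigma_sets UNIV ?E" by simp
  interpret M: prob_space M by fact
  show ?thesis
  proof (rule measure_eqI_generator_eq[where E = ?E and \<Omega> = UNIV and A = "\<lambda>n. {..<real_of_rat (of_nat n)}"])
    show "Int_stable ?E"
    proof (rule Int_stableI)
      fix A B assume "A \<in> ?E" "B \<in> ?E"
      then obtain x y where "A = {..<real_of_rat x}" "B = {..<real_of_rat y}" by auto
      moreover have "real_of_rat x \<le> real_of_rat y \<or> real_of_rat y \<le> real_of_rat x" by linarith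
      ultimately have "A \<inter> B = A \<or> A \<inter> B = B" by auto
      then show "A \<inter> B \<in> ?E" using \<open>A \<in> ?E\<close> \<open>B \<in> ?E\<close> by metis
    qed
    show "range (\<lambda>n::nat. {..<real_of_rat (of_nat n)}) \<subseteq> ?E" by blast
    show "(\<Union>n. {..<real_of_rat (of_nat n)}) = (UNIV :: real set)" using reals_Archimedean2 by auto
  qed (use M N eq s in auto)
qed

locale gibbs_star =
  fixes V :: "real^'n::finite \<Rightarrow> real" and i1 :: 'n and a b :: real
  assumes V_meas[measurable]: "V \<in> borel_measurable borel" and b_pos: "0 < b"
    and lower: "\<And>z. a + b * (norm z)\<^sup>2 \<le> V z"
    and growth: "\<And>c. 0 < c \<Longrightarrow> \<exists>C>0. \<forall>z. \<bar>V z\<bar> \<le> C * exp (c * (norm z)\<^sup>2)"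

lemma norm_vembed: "(norm (vembed i1 s y :: real^'n::finite))\<^sup>2 = s\<^sup>2 + (\<Sum>j\<in>UNIV - {i1}. (y j)\<^sup>2)"
  by (simp add: norm_vec_def L2_set_def sum_nonneg vembed_def sum.remove[of UNIV i1])

sublocale gibbs_star \<subseteq> star_core "UNIV - {i1}" "\<lambda>s y. V (vembed i1 s y)" a b
proof
  show "(\<lambda>(s, y). V (vembed i1 s y)) \<in> borel_measurable (lborel \<Otimes>\<^sub>M LP (UNIV - {i1}))" by measurable
  show "\<exists>C>0. \<forall>s y. \<bar>V (vembed i1 s y)\<bar> \<le> C * exp (c * (s\<^sup>2 + (\<Sum>j\<in>UNIV - {i1}. (y j)\<^sup>2)))" if "0 < c" for c
    using growth[OF that] by (metis norm_vembed)
qed (use b_pos lower[of "vembed i1 s y" for s y] in \<open>auto simp: norm_vembed\<close>)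

context gibbs_star
begin

abbreviation "J \<equiv> UNIV - {i1}"

definition dK :: "('n \<Rightarrow> real \<Rightarrow> real \<Rightarrow> real) \<Rightarrow> 'n \<Rightarrow> real \<Rightarrow> real measure" where
  "dK k j s = density lborel (\<lambda>t. ennreal (k j s t))"

definition rhoK :: "(real \<Rightarrow> real) \<Rightarrow> ('n \<Rightarrow> real \<Rightarrow> real \<Rightarrow> real) \<Rightarrow> real^'n \<Rightarrow> real" where
  "rhoK r k z = r (z $ i1) * (\<Prod>j\<in>J. k j (z $ i1) (z $ j))"

lemma rhoK_vembed: "rhoK r k (vembed i1 s y) = r s * prod_kernel k s y"
  by (simp add: rhoK_def prod_kernel_def vembed_def)

lemma rhoK_meas: assumes "dens r" "kern k" shows "rhoK r k \<in> borel_measurable borel"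
proof -
  have nth: "(\<lambda>z::real^'n. z $ j) \<in> borel \<rightarrow>\<^sub>M lborel" for j by simp
  show ?thesis unfolding rhoK_def
    using assms kern_meas[OF assms(2) _ nth nth]
    by (intro borel_measurable_times borel_measurable_prod measurable_compose[OF nth]) (auto simp: dens_def)
qed

lemma rhoK_nonneg: "dens r \<Longrightarrow> kern k \<Longrightarrow> 0 \<le> rhoK r k z"
  by (auto simp: rhoK_def dens_def kern_nonneg intro!: mult_nonneg_nonneg prod_nonneg)

lemma PiM_dK: assumes k: "kern k" and I: "I \<subseteq> J"
  shows "PiM I (\<lambda>j. dK k j s) = density (LP I) (\<lambda>y. ennreal (\<Prod>j\<in>I. k j s (y j)))"
proof -
  have "k j s \<in> borel_measurable lborel" if "j \<in> I" for j
    using kern_meas[OF k, of j "\<lambda>_. s" lborel "\<lambda>t. t"] that I by auto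
  moreover have "(\<integral>\<^sup>+t. ennreal (k j s t) \<partial>lborel) = 1" if "j \<in> I" for j
    using kern_prob[OF k, of j s] that I by auto
  moreover have "finite I" by simp
  ultimately have "PiM I (\<lambda>j. dK k j s) = density (LP I) (\<lambda>y. \<Prod>j\<in>I. ennreal (k j s (y j)))"
    unfolding dK_def by (intro PiM_density_lborel) simp_all
  then show ?thesis using k by (simp add: prod_ennreal kern_nonneg)
qed

lemma star_data_density: assumes r: "dens r" and k: "kern k"
  shows "star_data i1 (density lborel (\<lambda>s. ennreal (r s))) (dK k)"
  unfolding star_data_def
proof (intro conjI allI impI)
  show "prob_space (density lborel (\<lambda>s. ennreal (r s)))"
    using r by (intro prob_spaceI) (simp add: dens_def emeasure_density)
  fix j assume j: "j \<noteq> i1"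
  have "(\<lambda>s. density lborel (\<lambda>t. ennreal (k j s t))) \<in> lborel \<rightarrow>\<^sub>M prob_algebra borel"
  proof (rule prob_kernel_density)
    show "(\<lambda>(s, t). ennreal (k j s t)) \<in> borel_measurable (lborel \<Otimes>\<^sub>M lborel)"
      using kern_meas[OF k, of j fst "lborel \<Otimes>\<^sub>M lborel" snd] j by (simp add: case_prod_beta)
  qed (use kern_prob[OF k] j in auto)
  then show "dK k j \<in> borel \<rightarrow>\<^sub>M prob_algebra borel" by (simp add: dK_def[abs_def])
qed simp

lemma star_measure_density: assumes r: "dens r" and k: "kern k"
  shows "star_measure i1 (density lborel (\<lambda>s. ennreal (r s))) (dK k) = density lborel (\<lambda>z. ennreal (rhoK r k z))"
proof (rule measure_eqI)
  note d = star_data_density[OF r k]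
  show "sets (star_measure i1 (density lborel (\<lambda>s. ennreal (r s))) (dK k)) = sets (density lborel (\<lambda>z. ennreal (rhoK r k z)))"
    using emeasure_star_measure(2)[OF d, of "{}"] by simp
  fix A assume "A \<in> sets (star_measure i1 (density lborel (\<lambda>s. ennreal (r s))) (dK k))"
  then have A[measurable]: "A \<in> sets borel" using emeasure_star_measure(2)[OF d, of "{}"] by simp
  have rm[measurable]: "r \<in> borel_measurable borel" using r by (simp add: dens_def)
  note prod_kernel_meas[OF k, measurable (raw)] rhoK_meas[OF r k, measurable]
  have T[measurable]: "vembed i1 s \<in> LJ \<rightarrow>\<^sub>M borel" for s by measurable
  have e: "emeasure (star_kernel i1 (dK k) s) A = (\<integral>\<^sup>+y. ennreal (prod_kernel k s y) * indicator A (vembed i1 s y) \<partial>LJ)" for s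
  proof -
    have "emeasure (star_kernel i1 (dK k) s) A = emeasure (density LJ (\<lambda>y. ennreal (prod_kernel k s y))) (vembed i1 s -` A \<inter> space LJ)"
      unfolding star_kernel_def PiM_dK[OF k order_refl] prod_kernel_def[symmetric] by (subst emeasure_distr) auto
    also have "\<dots> = (\<integral>\<^sup>+y. ennreal (prod_kernel k s y) * indicator (vembed i1 s -` A \<inter> space LJ) y \<partial>LJ)"
      by (intro emeasure_density measurable_sets[OF T A]) measurable
    also have "\<dots> = (\<integral>\<^sup>+y. ennreal (prod_kernel k s y) * indicator A (vembed i1 s y) \<partial>LJ)"
      by (intro nn_integral_cong) (auto simp: indicator_def)
    finally show ?thesis .
  qed
  have "emeasure (star_measure i1 (density lborel (\<lambda>s. ennreal (r s))) (dK k)) A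
     = (\<integral>\<^sup>+s. ennreal (r s) * (\<integral>\<^sup>+y. ennreal (prod_kernel k s y) * indicator A (vembed i1 s y) \<partial>LJ) \<partial>lborel)"
    unfolding emeasure_star_measure(1)[OF d A] e by (subst nn_integral_density) measurable
  also have "\<dots> = (\<integral>\<^sup>+s. \<integral>\<^sup>+y. ennreal (rhoK r k (vembed i1 s y)) * indicator A (vembed i1 s y) \<partial>LJ \<partial>lborel)"
    using r by (subst nn_integral_cmult[symmetric]) 
      (auto simp: rhoK_vembed dens_def ennreal_mult' prod_kernel_nonneg[OF k] mult.assoc)
  also have "\<dots> = (\<integral>\<^sup>+z. ennreal (rhoK r k z) * indicator A z \<partial>lborel)"
    by (subst nn_integral_vembed[of _ i1]) auto
  also have "\<dots> = emeasure (density lborel (\<lambda>z. ennreal (rhoK r k z))) A"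
    by (simp add: emeasure_density)
  finally show "emeasure (star_measure i1 (density lborel (\<lambda>s. ennreal (r s))) (dK k)) A
     = emeasure (density lborel (\<lambda>z. ennreal (rhoK r k z))) A" .
qed

lemma exp_V_integrable: "integrable lborel (\<lambda>z. exp (- V z))"
proof (rule integrableI_nonneg)
  have "(\<integral>\<^sup>+z. ennreal (exp (- V z)) \<partial>lborel) = (\<integral>\<^sup>+s. \<integral>\<^sup>+y. ennreal (exp (- V (vembed i1 s y))) \<partial>LJ \<partial>lborel)"
    by (rule nn_integral_vembed) measurable
  also have "\<dots> = (\<integral>\<^sup>+s. ennreal (c s) \<partial>lborel)"
    using exp_v_integrable[of 1] by (intro nn_integral_cong nn_integral_eq_integral) auto
  also have "\<dots> = ennreal (integral\<^sup>L lborel c)"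
    using c_integrable c_nonneg by (intro nn_integral_eq_integral) auto
  finally show "(\<integral>\<^sup>+z. ennreal (exp (- V z)) \<partial>lborel) < \<infinity>" by simp
qed auto

abbreviation "Z \<equiv> \<integral>z. exp (- V z) \<partial>lborel"

lemma Z_pos: "0 < Z"
proof (rule ccontr)
  assume "\<not> 0 < Z"
  moreover have "0 \<le> Z" by (intro Bochner_Integration.integral_nonneg) auto
  ultimately have "Z = 0" by simp
  then have "AE z in lborel :: (real^'n) measure. exp (- V z) = 0"
    using integral_nonneg_eq_0_iff_AE[OF exp_V_integrable] by auto
  then have "(UNIV :: (real^'n) set) \<in> null_sets lborel" by (simp add: AE_iff_null)
  from null_setsD1[OF this] show False by simp
qed

text \<open>The Radon-Nikodym derivative is \<open>\<rho> / g\<close> with \<open>g\<close> the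
  Gibbs density. The integrands of \<open>KL\<close> and of \<open>rel_ent\<close> then differ by
  integrable terms, so the integrability test inside \<open>KL\<close> agrees with finiteness of
  \<open>rel_ent\<close>.\<close>

lemma KL_density:
  fixes \<rho> :: "real^'n \<Rightarrow> real"
  assumes [measurable]: "\<rho> \<in> borel_measurable borel" and nn: "\<And>z. 0 \<le> \<rho> z" and 1: "(\<integral>\<^sup>+z. ennreal (\<rho> z) \<partial>lborel) = 1"
  shows "KL (density lborel (\<lambda>z. ennreal (\<rho> z))) (gibbs V) = (if rel_ent lborel \<rho> V < \<infinity> then ereal (free_energy lborel \<rho> V + ln Z) else \<infinity>)"
proof -
  let ?mu = "density lborel (\<lambda>z. ennreal (\<rho> z))"
  interpret P: prob_density_potential lborel \<rho> V
    using nn 1 exp_V_integrable by unfold_locales auto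
  define g where "g z = exp (- V z) / Z" for z
  have [measurable]: "g \<in> borel_measurable borel" unfolding g_def by measurable
  have g: "0 < g z" for z using Z_pos by (simp add: g_def)
  have nu: "gibbs V = density lborel (\<lambda>z. ennreal (g z))" by (simp add: gibbs_def g_def)
  have "(\<integral>\<^sup>+z. ennreal (g z) \<partial>lborel) = ennreal (\<integral>z. g z \<partial>lborel)"
    unfolding g_def using exp_V_integrable Z_pos by (intro nn_integral_eq_integral) auto
  also have "\<dots> = 1" unfolding g_def using Z_pos by simp
  finally have "prob_space (gibbs V)" unfolding nu by (intro prob_spaceI) (simp add: emeasure_density)
  then interpret G: prob_space "gibbs V" .
  have gg: "ennreal (g z) * ennreal (\<rho> z / g z) = ennreal (\<rho> z)" for z
    using g[of z] nn[of z] by (simp add: ennreal_mult'[symmetric])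
  have eq: "density (gibbs V) (\<lambda>z. ennreal (\<rho> z / g z)) = ?mu"
    unfolding nu by (subst density_density_eq) (auto simp: gg)
  have sm: "sets ?mu = sets (gibbs V)" by (simp add: nu)
  have ac: "absolutely_continuous (gibbs V) ?mu"
    unfolding eq[symmetric] by (rule absolutely_continuousI_density) (simp add: nu)
  have "AE z in gibbs V. ennreal (\<rho> z / g z) = RN_deriv (gibbs V) ?mu z"
    by (rule G.RN_deriv_unique[OF _ eq]) (simp add: nu)
  then have "AE z in lborel. ennreal (\<rho> z / g z) = RN_deriv (gibbs V) ?mu z"
    unfolding nu by (subst (asm) AE_density) (auto simp: g)
  then have AE: "AE z in lborel. enn2real (RN_deriv (gibbs V) ?mu z) = \<rho> z / g z"
    by eventually_elim (use nn g in \<open>auto simp: less_imp_le intro!: enn2real_ennreal divide_nonneg_nonneg dest!: sym[of "ennreal _"]\<close>)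
  have mRN[measurable]: "RN_deriv (gibbs V) ?mu \<in> borel_measurable borel" 
    using borel_measurable_RN_deriv[of "gibbs V" ?mu] by (simp add: nu)
  \<comment> \<open>The factor \<open>\<rho> z\<close> removes the points where the logarithm is
    taken at 0.\<close>
  have AE2: "AE z in lborel. \<rho> z * ln (enn2real (RN_deriv (gibbs V) ?mu z)) = \<rho> z * (ln (\<rho> z) + V z) + ln Z * \<rho> z"
    using AE
  proof eventually_elim
    case (elim z)
    show ?case
    proof (cases "\<rho> z = 0")
      case False
      then have "ln (\<rho> z / g z) = ln (\<rho> z) + V z + ln Z"
        using nn[of z] Z_pos by (simp add: g_def ln_div ln_mult)
      then show ?thesis unfolding elim by (simp add: algebra_simps)
    qed simp
  qed
  have int_iff: "integrable ?mu (\<lambda>z. ln (enn2real (RN_deriv (gibbs V) ?mu z))) \<longleftrightarrow> integrable lborel (\<lambda>z. \<rho> z * (ln (\<rho> z) + V z) + ln Z * \<rho> z)"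
    using nn integrable_cong_AE[OF _ _ AE2] by (subst integrable_density) auto
  have int_iff2: "integrable lborel (\<lambda>z. \<rho> z * (ln (\<rho> z) + V z) + ln Z * \<rho> z) \<longleftrightarrow> rel_ent lborel \<rho> V < \<infinity>"
  proof
    assume i: "integrable lborel (\<lambda>z. \<rho> z * (ln (\<rho> z) + V z) + ln Z * \<rho> z)"
    have eq: "relent (\<rho> z) (V z) = (\<rho> z * (ln (\<rho> z) + V z) + ln Z * \<rho> z) - ln Z * \<rho> z - \<rho> z + exp (- V z)" for z
      by (simp add: relent_def algebra_simps)
    have "integrable lborel (\<lambda>z. relent (\<rho> z) (V z))" unfolding eq
      by (intro Bochner_Integration.integrable_add Bochner_Integration.integrable_diff i integrable_mult_right P.A_int exp_V_integrable)
    then show "rel_ent lborel \<rho> V < \<infinity>" unfolding rel_ent_def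
      by (subst nn_integral_eq_integral) (auto simp: relent_nonneg nn)
  next
    assume "rel_ent lborel \<rho> V < \<infinity>"
    then show "integrable lborel (\<lambda>z. \<rho> z * (ln (\<rho> z) + V z) + ln Z * \<rho> z)"
      using P.free_energy_integral(1) P.A_int by simp
  qed
  have val: "(\<integral>z. ln (enn2real (RN_deriv (gibbs V) ?mu z)) \<partial>?mu) = free_energy lborel \<rho> V + ln Z" if "rel_ent lborel \<rho> V < \<infinity>"
  proof -
    have "(\<integral>z. ln (enn2real (RN_deriv (gibbs V) ?mu z)) \<partial>?mu) = (\<integral>z. \<rho> z * ln (enn2real (RN_deriv (gibbs V) ?mu z)) \<partial>lborel)"
      using nn by (subst integral_density) auto
    also have "\<dots> = (\<integral>z. \<rho> z * (ln (\<rho> z) + V z) + ln Z * \<rho> z \<partial>lborel)"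
      by (intro integral_cong_AE AE2) auto
    also have "\<dots> = free_energy lborel \<rho> V + ln Z"
      using P.free_energy_integral[OF that] P.A_int by (simp add: P.A_integral)
    finally show ?thesis .
  qed
  show ?thesis unfolding KL_def using ac sm int_iff int_iff2 val by auto
qed

lemma rel_ent_rhoK: assumes "dens r" "kern k" shows "rel_ent lborel (rhoK r k) V = Ent r k"
proof -
  note rhoK_meas[OF assms, measurable]
  show ?thesis unfolding rel_ent_def Ent_def
    by (subst nn_integral_vembed[of _ i1]) (auto simp: rhoK_vembed)
qed

lemma rhoK_prob: assumes r: "dens r" and k: "kern k" shows "(\<integral>\<^sup>+z. ennreal (rhoK r k z) \<partial>lborel) = 1"
proof -
  note rhoK_meas[OF assms, measurable] 
  have [measurable]: "(\<lambda>y. prod_kernel k s y) \<in> borel_measurable LJ" for s using prod_kernel_meas[OF k, of "\<lambda>_. s" LJ "\<lambda>y. y"] by simp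
  have "(\<integral>\<^sup>+z. ennreal (rhoK r k z) \<partial>lborel) = (\<integral>\<^sup>+s. \<integral>\<^sup>+y. ennreal (r s) * ennreal (prod_kernel k s y) \<partial>LJ \<partial>lborel)"
    using r by (subst nn_integral_vembed[of _ i1]) (auto simp: rhoK_vembed ennreal_mult' dens_def prod_kernel_nonneg[OF k])
  also have "\<dots> = (\<integral>\<^sup>+s. ennreal (r s) \<partial>lborel)"
    using nn_integral_prodK[OF k order_refl, folded prod_kernel_def] by (simp add: nn_integral_cmult)
  finally show ?thesis using r by (simp add: dens_def)
qed

lemma KL_star: assumes "dens r" "kern k" 
  shows "KL (star_measure i1 (density lborel (\<lambda>s. ennreal (r s))) (dK k)) (gibbs V) = 
    (if Ent r k < \<infinity> then ereal (enn2real (Ent r k) + 1 - Z + ln Z) else \<infinity>)"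
  unfolding star_measure_density[OF assms]
  by (subst KL_density) (auto simp: rhoK_meas[OF assms] rhoK_nonneg[OF assms] rhoK_prob[OF assms] rel_ent_rhoK[OF assms] free_energy_def)

text \<open>Excludes an infinite minimal value, in which case minimality would say nothing.\<close>

lemma ex_Ent_finite: "\<exists>r k. dens r \<and> kern k \<and> Ent r k < \<infinity>"
proof (intro exI conjI)
  define r where "r = (indicator {0..1} :: real \<Rightarrow> real)"
  show "dens r" by (auto simp: dens_def r_def ennreal_indicator)
  show "kern unif_kernel" by (rule kern_unif_kernel)
  obtain C where C: "C > 0" "\<And>s. rel_ent LJ (prod_kernel unif_kernel s) (\<lambda>y. V (vembed i1 s y)) < \<infinity>" 
    "\<And>s. free_energy LJ (prod_kernel unif_kernel s) (\<lambda>y. V (vembed i1 s y)) \<le> C * exp (s\<^sup>2)"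
    using unif_kernel_growth by auto
  have "rel_ent LJ (\<lambda>y. r s * prod_kernel unif_kernel s y) (\<lambda>y. V (vembed i1 s y)) \<le> ennreal (C * exp 1 * indicator {0..1} s + c s)" for s
  proof -
    interpret P: prob_density_potential LJ "prod_kernel unif_kernel s" "\<lambda>y. V (vembed i1 s y)" by (rule potential_prod_kernel[OF kern_unif_kernel])
    have "rel_ent LJ (\<lambda>y. r s * prod_kernel unif_kernel s y) (\<lambda>y. V (vembed i1 s y)) 
        = ennreal (r s * (ln (r s) + free_energy LJ (prod_kernel unif_kernel s) (\<lambda>y. V (vembed i1 s y)) - 1) + c s)"
      by (rule P.rel_ent_scale[OF C(2)]) (simp add: r_def)
    also have "\<dots> \<le> ennreal (C * exp 1 * indicator {0..1} s + c s)"
    proof (rule ennreal_leI, cases "s \<in> {0..1}")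
      case True
      then have "s\<^sup>2 \<le> 1" by (simp add: power_le_one)
      then have "C * exp (s\<^sup>2) \<le> C * exp 1" using C(1) by simp
      then show "r s * (ln (r s) + free_energy LJ (prod_kernel unif_kernel s) (\<lambda>y. V (vembed i1 s y)) - 1) + c s \<le> C * exp 1 * indicator {0..1} s + c s"
        using True C(3)[of s] by (simp add: r_def)
    qed (simp add: r_def)
    finally show ?thesis .
  qed
  then have "Ent r unif_kernel \<le> (\<integral>\<^sup>+s. ennreal (C * exp 1 * indicator {0..1} s + c s) \<partial>lborel)"
    unfolding Ent_def by (intro nn_integral_mono)
  also have "\<dots> = ennreal (\<integral>s. C * exp 1 * indicator {0..1} s + c s \<partial>lborel)"
    using C(1) c_integrable c_nonneg 
    by (intro nn_integral_eq_integral AE_I2 add_nonneg_nonneg Bochner_Integration.integrable_add integrable_mult_right) auto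
  also have "\<dots> < \<infinity>" by simp
  finally show "Ent r unif_kernel < \<infinity>" .
qed

text \<open>\<open>KL_star\<close> adds the same constant on both sides, so comparing divergences
  amounts to comparing \<open>Ent\<close>.\<close>

lemma star_minI:
  assumes r: "dens r" and k: "kern k"
    and min: "\<And>\<mu>. \<mu> \<in> C_star i1 \<Longrightarrow> KL (star_measure i1 (density lborel (\<lambda>s. ennreal (r s))) (dK k)) (gibbs V) \<le> KL \<mu> (gibbs V)"
  shows "star_min J (\<lambda>s y. V (vembed i1 s y)) a b r k"
proof -
  have le: "Ent r k \<le> Ent r' k'" "Ent r k < \<infinity>" if r': "dens r'" and k': "kern k'" and fin: "Ent r' k' < \<infinity>" for r' k'
  proof -
    have "star_measure i1 (density lborel (\<lambda>s. ennreal (r' s))) (dK k') \<in> C_star i1"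
      unfolding C_star_def using star_data_density[OF r' k'] by blast
    from min[OF this] fin have "Ent r k < \<infinity> \<and> enn2real (Ent r k) \<le> enn2real (Ent r' k')"
      unfolding KL_star[OF r k] KL_star[OF r' k'] by (auto split: if_splits)
    then show "Ent r k \<le> Ent r' k'" "Ent r k < \<infinity>" using fin ennreal_leI[of "enn2real (Ent r k)" "enn2real (Ent r' k')"] by simp_all
  qed
  obtain r0 k0 where "dens r0" "kern k0" "Ent r0 k0 < \<infinity>" using ex_Ent_finite by blast
  then have "Ent r k < \<infinity>" by (rule le(2))
  moreover have "Ent r k \<le> Ent r' k'" if "dens r'" "kern k'" for r' k'
    using le(1)[OF that] by (cases "Ent r' k' < \<infinity>") (auto simp: not_less top_unique)
  ultimately show ?thesis using r k by unfold_locales auto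
qed

end

section \<open>Densities of a disintegration\<close>
context gibbs_star
begin

text \<open>Factors other than \<open>j\<close> contribute mass 1, so events in the coordinates
  \<open>i1\<close> and \<open>j\<close> see a single conditional.\<close>

lemma emeasure_star_kernel_cylinder:
  assumes d: "star_data i1 p q" and j: "j \<in> J" and [measurable]: "A \<in> sets borel" "B \<in> sets borel"
  shows "emeasure (star_kernel i1 q s) {z. z $ i1 \<in> A \<and> z $ j \<in> B} = indicator A s * emeasure (q j s) B"
proof -
  have qs: "prob_space (q i s)" "sets (q i s) = sets borel" if "i \<in> J" for i
    using measurable_space[of "q i" borel "prob_algebra borel" s] d that by (auto simp: star_data_def space_prob_algebra)
  have sP: "sets (PiM J (\<lambda>j. q j s)) = sets LJ" using qs by (intro sets_PiM_cong) auto
  have T: "vembed i1 s \<in> PiM J (\<lambda>j. q j s) \<rightarrow>\<^sub>M borel"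
    unfolding measurable_cong_sets[OF sP refl] by measurable
  have C: "{z :: real^'n. z $ i1 \<in> A \<and> z $ j \<in> B} \<in> sets borel"
  proof -
    have "{z :: real^'n \<in> space borel. z $ i1 \<in> A \<and> z $ j \<in> B} \<in> sets borel" by measurable
    then show ?thesis by simp
  qed
  have cj: "(\<lambda>y. y j) \<in> PiM J (\<lambda>j. q j s) \<rightarrow>\<^sub>M q j s" using j by (rule measurable_component_singleton)
  have "emeasure (star_kernel i1 q s) {z. z $ i1 \<in> A \<and> z $ j \<in> B} 
    = emeasure (PiM J (\<lambda>j. q j s)) (vembed i1 s -` {z. z $ i1 \<in> A \<and> z $ j \<in> B} \<inter> space (PiM J (\<lambda>j. q j s)))"
    unfolding star_kernel_def by (rule emeasure_distr[OF T C])
  also have "vembed i1 s -` {z. z $ i1 \<in> A \<and> z $ j \<in> B} \<inter> space (PiM J (\<lambda>j. q j s))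
    = (if s \<in> A then (\<lambda>y. y j) -` B \<inter> space (PiM J (\<lambda>j. q j s)) else {})"
    using j by (auto simp: vembed_def)
  also have "emeasure (PiM J (\<lambda>j. q j s)) \<dots> = indicator A s * emeasure (PiM J (\<lambda>j. q j s)) ((\<lambda>y. y j) -` B \<inter> space (PiM J (\<lambda>j. q j s)))"
    by simp
  also have "emeasure (PiM J (\<lambda>j. q j s)) ((\<lambda>y. y j) -` B \<inter> space (PiM J (\<lambda>j. q j s))) = emeasure (distr (PiM J (\<lambda>j. q j s)) (q j s) (\<lambda>y. y j)) B"
    using qs(2)[OF j] by (intro emeasure_distr[symmetric] cj) simp
  also have "\<dots> = emeasure (q j s) B" using qs(1) j by (subst distr_PiM_component) auto
  finally show ?thesis .
qed

text \<open>A disintegration of an absolutely continuous measure has densities, namely quotients of marginals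
  of the joint density.\<close>

lemma star_densities:
  assumes d: "star_data i1 p q" and [measurable]: "\<rho> \<in> borel_measurable borel"
    and eq: "star_measure i1 p q = density lborel (\<lambda>z. ennreal (\<rho> z))" and ne: "J \<noteq> {}"
  shows "\<exists>r k. dens r \<and> kern k \<and> p = density lborel (\<lambda>s. ennreal (r s)) \<and> (AE s in p. \<forall>j\<in>J. q j s = dK k j s)"
proof -
  define R0 where "R0 s = (\<integral>\<^sup>+y. ennreal (\<rho> (vembed i1 s y)) \<partial>LJ)" for s
  define P where "P j s t = (\<integral>\<^sup>+y. ennreal (\<rho> (vembed i1 s (y(j := t)))) \<partial>LI j)" for j s t
  have R0m[measurable]: "R0 \<in> borel_measurable borel" 
  proof -
    have "R0 \<in> borel_measurable lborel" unfolding R0_def by measurable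
    then show ?thesis by simp
  qed
  have Pm: "(\<lambda>x. P j (f x) (g x)) \<in> borel_measurable M" if j: "j \<in> J" and [measurable]: "f \<in> M \<rightarrow>\<^sub>M lborel" "g \<in> M \<rightarrow>\<^sub>M lborel"
    for f g j and M :: "'m measure"
  proof -
    interpret I: sigma_finite_measure "LI j" using finJ by (intro sigma_finite_LP) auto
    note upd_meas[OF j, measurable (raw)]
    show ?thesis unfolding P_def by measurable
  qed
  have PR: "(\<integral>\<^sup>+t. P j s t * indicator B t \<partial>lborel) = (\<integral>\<^sup>+y. ennreal (\<rho> (vembed i1 s y)) * indicator B (y j) \<partial>LJ)"
    if j: "j \<in> J" and [measurable]: "B \<in> sets borel" for j s B
  proof -
    note upd_meas[OF j, measurable (raw)]
    have [measurable]: "(\<lambda>y. y j) \<in> LJ \<rightarrow>\<^sub>M borel"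
      using measurable_component_singleton[OF j, of "\<lambda>_. lborel"] by simp
    show ?thesis
      unfolding P_def by (subst nn_integral_LJ_split[OF j]) (auto intro!: nn_integral_cong nn_integral_multc[symmetric])
  qed
  have prob_p: "prob_space p" "sets p = sets borel" using d by (auto simp: star_data_def)
  have cyl: "(\<integral>\<^sup>+s. indicator A s * emeasure (q j s) B \<partial>p) = (\<integral>\<^sup>+s. indicator A s * (\<integral>\<^sup>+t. P j s t * indicator B t \<partial>lborel) \<partial>lborel)"
    if j: "j \<in> J" and [measurable]: "A \<in> sets borel" "B \<in> sets borel" for j A B
  proof -
    let ?C = "{z :: real^'n. z $ i1 \<in> A \<and> z $ j \<in> B}"
    have "{z :: real^'n \<in> space borel. z $ i1 \<in> A \<and> z $ j \<in> B} \<in> sets borel" by measurable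
    then have C[measurable]: "?C \<in> sets borel" by simp
    have "(\<integral>\<^sup>+s. indicator A s * emeasure (q j s) B \<partial>p) = emeasure (star_measure i1 p q) ?C"
      unfolding emeasure_star_measure(1)[OF d C] by (simp add: emeasure_star_kernel_cylinder[OF d j])
    also have "\<dots> = (\<integral>\<^sup>+z. ennreal (\<rho> z) * indicator ?C z \<partial>lborel)"
      unfolding eq by (rule emeasure_density) measurable
    also have "\<dots> = (\<integral>\<^sup>+s. \<integral>\<^sup>+y. ennreal (\<rho> (vembed i1 s y)) * indicator ?C (vembed i1 s y) \<partial>LJ \<partial>lborel)"
      by (rule nn_integral_vembed) measurable
    also have "\<dots> = (\<integral>\<^sup>+s. \<integral>\<^sup>+y. indicator A s * (ennreal (\<rho> (vembed i1 s y)) * indicator B (y j)) \<partial>LJ \<partial>lborel)"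
      using j by (intro nn_integral_cong) (auto simp: indicator_def vembed_def)
    also have "\<dots> = (\<integral>\<^sup>+s. indicator A s * (\<integral>\<^sup>+t. P j s t * indicator B t \<partial>lborel) \<partial>lborel)"
    proof (rule nn_integral_cong)
      fix s
      have [measurable]: "(\<lambda>y. y j) \<in> LJ \<rightarrow>\<^sub>M borel"
        using measurable_component_singleton[OF j, of "\<lambda>_. lborel"] by simp
      show "(\<integral>\<^sup>+y. indicator A s * (ennreal (\<rho> (vembed i1 s y)) * indicator B (y j)) \<partial>LJ) = indicator A s * (\<integral>\<^sup>+t. P j s t * indicator B t \<partial>lborel)"
        unfolding PR[OF j that(3)] by (rule nn_integral_cmult) measurable
    qed
    finally show ?thesis .
  qed
  have PR1: "(\<integral>\<^sup>+t. P j s t \<partial>lborel) = R0 s" if "j \<in> J" for j s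
    using PR[OF that, of UNIV s] by (simp add: R0_def)
  \<comment> \<open>Any second coordinate, taken with the trivial event \<open>UNIV\<close>,
    recovers the first marginal from \<open>cyl\<close>.\<close>
  obtain j0 where j0: "j0 \<in> J" using ne by blast
  have qs: "prob_space (q i s)" "sets (q i s) = sets borel" if "i \<in> J" for i s
    using measurable_space[of "q i" borel "prob_algebra borel" s] d that by (auto simp: star_data_def space_prob_algebra)
  have q1: "emeasure (q i s) UNIV = 1" if "i \<in> J" for i s
    using prob_space.emeasure_space_1[OF qs(1)[OF that]] sets_eq_imp_space_eq[OF qs(2)[OF that]] by simp
  have pR: "p = density lborel R0"
  proof (rule measure_eqI)
    show "sets p = sets (density lborel R0)" using prob_p by simp
    fix A assume "A \<in> sets p"
    then have A[measurable]: "A \<in> sets borel" using prob_p by simp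
    have "emeasure p A = (\<integral>\<^sup>+s. indicator A s * emeasure (q j0 s) UNIV \<partial>p)"
      using A prob_p by (simp add: q1[OF j0])
    also have "\<dots> = (\<integral>\<^sup>+s. indicator A s * R0 s \<partial>lborel)"
      using cyl[OF j0 A, of UNIV] by (simp add: PR1[OF j0])
    finally show "emeasure p A = emeasure (density lborel R0) A"
      by (simp add: emeasure_density mult.commute)
  qed
  have R1: "(\<integral>\<^sup>+s. R0 s \<partial>lborel) = 1"
    using prob_space.emeasure_space_1[OF prob_p(1)] by (simp add: pR emeasure_density)
  have R0fin: "AE s in lborel. R0 s \<noteq> \<infinity>" by (rule nn_integral_noteq_infinite) (auto simp: R1)
  define r where "r s = enn2real (R0 s)" for s
  have rm[measurable]: "r \<in> borel_measurable borel" unfolding r_def by measurable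
  have rR: "AE s in lborel. ennreal (r s) = R0 s"
    using R0fin by eventually_elim (simp add: r_def less_top)
  have pr: "p = density lborel (\<lambda>s. ennreal (r s))"
    unfolding pR by (rule density_cong) (use rR in auto)
  have r: "dens r"
    unfolding dens_def using R1 nn_integral_cong_AE[OF rR] by (auto simp: r_def)
  \<comment> \<open>On the \<open>p\<close>-null set where the quotient is meaningless, the uniform
    density is filled in so that \<open>k\<close> has unit mass at every \<open>s\<close>.\<close>
  define k where "k j s t = (if 0 < R0 s \<and> R0 s < \<infinity> then enn2real (P j s t) / r s else indicator {0..1} t)" for j s t
  have rpos: "0 < r s" "ennreal (r s) = R0 s" if "0 < R0 s \<and> R0 s < \<infinity>" for s
    using that by (auto simp: r_def enn2real_positive_iff)
  have kP: "(\<integral>\<^sup>+t. ennreal (k j s t) * indicator B t \<partial>lborel) * R0 s = (\<integral>\<^sup>+t. P j s t * indicator B t \<partial>lborel)"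
    if j: "j \<in> J" and s: "0 < R0 s \<and> R0 s < \<infinity>" and [measurable]: "B \<in> sets borel" for j s B
  proof -
    have [measurable]: "P j s \<in> borel_measurable borel" using Pm[OF j, of "\<lambda>_. s" lborel "\<lambda>t. t"] by simp
    have "AE t in lborel. P j s t \<noteq> \<infinity>"
      by (rule nn_integral_noteq_infinite) (use PR1[OF j] s in auto)
    then have "AE t in lborel. ennreal (k j s t) * indicator B t * R0 s = P j s t * indicator B t"
    proof eventually_elim
      case (elim t)
      have "ennreal (k j s t) * R0 s = ennreal (enn2real (P j s t) / r s) * ennreal (r s)"
        using s rpos(2)[OF s] by (simp add: k_def)
      also have "\<dots> = ennreal (enn2real (P j s t))"
        using rpos(1)[OF s] by (simp add: ennreal_mult'[symmetric])
      also have "\<dots> = P j s t" using elim by (simp add: less_top)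
      finally have "ennreal (k j s t) * R0 s = P j s t" .
      then show ?case by (auto simp: indicator_def)
    qed
    from nn_integral_cong_AE[OF this] show ?thesis
      using s by (subst nn_integral_multc[symmetric]) (auto simp: k_def)
  qed
  have cancel: "x = y" if "x * R0 s = y * R0 s" "0 < R0 s \<and> R0 s < \<infinity>" for x y s
    using that ennreal_mult_cancel_left[of "R0 s" x y] by (auto simp: mult.commute)
  have k: "kern k"
    unfolding kern_def
  proof (intro conjI ballI allI)
    fix j assume j: "j \<in> J"
    note Pm[OF j, measurable (raw)]
    show "case_prod (k j) \<in> borel_measurable (lborel \<Otimes>\<^sub>M lborel)"
      unfolding k_def[abs_def] case_prod_beta by measurable
    show "(\<integral>\<^sup>+t. ennreal (k j s t) \<partial>lborel) = 1" for s
    proof (cases "0 < R0 s \<and> R0 s < \<infinity>")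
      case True
      have "(\<integral>\<^sup>+t. ennreal (k j s t) \<partial>lborel) * R0 s = 1 * R0 s"
        using kP[OF j True, of UNIV] by (simp add: PR1[OF j])
      from cancel[OF this True] show ?thesis .
    next
      case False
      then have "k j s = indicator {0..1}" by (auto simp: k_def fun_eq_iff)
      then show ?thesis by (simp add: ennreal_indicator)
    qed
  next
    show "0 \<le> k j s t" for j s t by (auto simp: k_def r_def)
  qed
  \<comment> \<open>Integrated over a set \<open>A\<close>, both sides give the probability of the
    same cylinder; uniqueness of densities turns this into an identity at almost every
    \<open>s\<close>.\<close>
  have AEq: "AE s in lborel. R0 s * emeasure (q j s) {..<real_of_rat x} = (\<integral>\<^sup>+t. P j s t * indicator {..<real_of_rat x} t \<partial>lborel)"
    if j: "j \<in> J" for j x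
  proof (rule iffD1[OF sigma_finite_measure.density_unique_iff[OF lborel.sigma_finite_measure_axioms]])
    have qm: "q j \<in> borel \<rightarrow>\<^sub>M subprob_algebra borel" using d j by (auto simp: star_data_def intro: measurable_prob_algebraD)
    have [measurable]: "(\<lambda>s. emeasure (q j s) {..<real_of_rat x}) \<in> borel_measurable borel"
      by (rule measurable_emeasure_kernel[OF qm]) simp
    show m1[measurable]: "(\<lambda>s. R0 s * emeasure (q j s) {..<real_of_rat x}) \<in> borel_measurable lborel" by measurable
    note Pm[OF j, measurable (raw)]
    show m2[measurable]: "(\<lambda>s. \<integral>\<^sup>+t. P j s t * indicator {..<real_of_rat x} t \<partial>lborel) \<in> borel_measurable lborel" by measurable
    show "density lborel (\<lambda>s. R0 s * emeasure (q j s) {..<real_of_rat x}) = density lborel (\<lambda>s. \<integral>\<^sup>+t. P j s t * indicator {..<real_of_rat x} t \<partial>lborel)"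
    proof (rule measure_eqI)
      fix A assume "A \<in> sets (density lborel (\<lambda>s. R0 s * emeasure (q j s) {..<real_of_rat x}))"
      then have A[measurable]: "A \<in> sets borel" by simp
      have "emeasure (density lborel (\<lambda>s. R0 s * emeasure (q j s) {..<real_of_rat x})) A
        = (\<integral>\<^sup>+s. R0 s * (indicator A s * emeasure (q j s) {..<real_of_rat x}) \<partial>lborel)"
        using m1 by (subst emeasure_density) (auto simp: mult_ac)
      also have "\<dots> = (\<integral>\<^sup>+s. indicator A s * emeasure (q j s) {..<real_of_rat x} \<partial>p)"
        unfolding pR by (rule nn_integral_density[symmetric]) measurable
      also have "\<dots> = (\<integral>\<^sup>+s. indicator A s * (\<integral>\<^sup>+t. P j s t * indicator {..<real_of_rat x} t \<partial>lborel) \<partial>lborel)"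
        by (rule cyl[OF j A]) simp
      also have "\<dots> = emeasure (density lborel (\<lambda>s. \<integral>\<^sup>+t. P j s t * indicator {..<real_of_rat x} t \<partial>lborel)) A"
        using m2 by (subst emeasure_density) (auto simp: mult_ac)
      finally show "emeasure (density lborel (\<lambda>s. R0 s * emeasure (q j s) {..<real_of_rat x})) A
        = emeasure (density lborel (\<lambda>s. \<integral>\<^sup>+t. P j s t * indicator {..<real_of_rat x} t \<partial>lborel)) A" .
    qed simp
  qed
  have "AE s in lborel. \<forall>j\<in>J. \<forall>x. R0 s * emeasure (q j s) {..<real_of_rat x} = (\<integral>\<^sup>+t. P j s t * indicator {..<real_of_rat x} t \<partial>lborel)"
    by (intro AE_finite_allI) (use AEq in \<open>auto simp: AE_all_countable\<close>)
  then have "AE s in lborel. 0 < R0 s \<longrightarrow> (\<forall>j\<in>J. q j s = dK k j s)"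
    using R0fin
  proof eventually_elim
    case (elim s)
    show ?case
    proof (intro impI ballI)
      fix j assume "0 < R0 s" and j: "j \<in> J"
      then have s: "0 < R0 s \<and> R0 s < \<infinity>" using elim by (simp add: less_top)
      have [measurable]: "k j s \<in> borel_measurable borel" using kern_meas[OF k j, of "\<lambda>_. s" lborel "\<lambda>t. t"] by simp
      show "q j s = dK k j s"
      proof (rule real_measure_eqI_rational)
        show "sets (q j s) = sets borel" "prob_space (q j s)" using qs[OF j] by auto
        show "sets (dK k j s) = sets borel" by (simp add: dK_def)
        fix x
        have "emeasure (dK k j s) {..<real_of_rat x} * R0 s = emeasure (q j s) {..<real_of_rat x} * R0 s"
          using kP[OF j s, of "{..<real_of_rat x}"] elim j by (simp add: dK_def emeasure_density mult.commute)
        from cancel[OF this s] show "emeasure (q j s) {..<real_of_rat x} = emeasure (dK k j s) {..<real_of_rat x}" by simp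
      qed
    qed
  qed
  then have "AE s in p. \<forall>j\<in>J. q j s = dK k j s"
    unfolding pR by (subst AE_density) auto
  with r k pr show ?thesis by blast
qed

end

section \<open>Strong convexity and the optimality equations\<close>
text \<open>Two integrations along the segment: \<open>g' t - \<alpha> * (h \<bullet> h) * t\<close>
  is nondecreasing for \<open>t \<ge> 0\<close>, and then so is
  \<open>g t - g' 0 * t - \<alpha> / 2 * (h \<bullet> h) * t\<^sup>2\<close>.\<close>

lemma strong_convexity_tangent:
  fixes V :: "real^'n::finite \<Rightarrow> real"
  assumes grad: "\<And>z. (V has_derivative (\<lambda>h. DV z \<bullet> h)) (at z)"
    and hess: "\<And>z. (DV has_derivative (\<lambda>h. HV z *v h)) (at z)"
    and sc: "\<And>z h. \<alpha> * (h \<bullet> h) \<le> h \<bullet> (HV z *v h)"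
  shows "V x + DV x \<bullet> h + \<alpha> / 2 * (h \<bullet> h) \<le> V (x + h)"
proof -
  define g where "g t = V (x + t *\<^sub>R h)" for t
  define g' where "g' t = DV (x + t *\<^sub>R h) \<bullet> h" for t
  have line: "((\<lambda>t. x + t *\<^sub>R h) has_derivative (\<lambda>d. d *\<^sub>R h)) (at t)" for t
    by (auto intro!: derivative_eq_intros)
  have dg: "(g has_real_derivative g' t) (at t)" for t
    using has_derivative_compose[OF line grad] unfolding g_def g'_def has_field_derivative_def
    by (rule has_derivative_eq_rhs) (auto simp: fun_eq_iff)
  have dg': "(g' has_real_derivative h \<bullet> (HV (x + t *\<^sub>R h) *v h)) (at t)" for t
  proof -
    have "((\<lambda>t. DV (x + t *\<^sub>R h)) has_derivative (\<lambda>d. HV (x + t *\<^sub>R h) *v (d *\<^sub>R h))) (at t)"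
      by (rule has_derivative_compose[OF line hess])
    from has_derivative_inner_left[OF this, of h] show ?thesis
      unfolding g'_def has_field_derivative_def
      by (rule has_derivative_eq_rhs) (auto simp: fun_eq_iff inner_commute matrix_vector_mult_scaleR)
  qed
  have g': "g' 0 + \<alpha> * (h \<bullet> h) * t \<le> g' t" if "0 \<le> t" for t
  proof -
    have "g' 0 - \<alpha> * (h \<bullet> h) * 0 \<le> g' t - \<alpha> * (h \<bullet> h) * t"
    proof (rule DERIV_nonneg_imp_nondecreasing[OF that])
      fix s
      show "\<exists>y. ((\<lambda>t. g' t - \<alpha> * (h \<bullet> h) * t) has_real_derivative y) (at s) \<and> 0 \<le> y"
        by (rule exI[of _ "h \<bullet> (HV (x + s *\<^sub>R h) *v h) - \<alpha> * (h \<bullet> h)"])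
          (auto intro!: derivative_eq_intros dg' simp: sc)
    qed
    then show ?thesis by simp
  qed
  have "g 0 - g' 0 * 0 - \<alpha> / 2 * (h \<bullet> h) * 0\<^sup>2 \<le> g 1 - g' 0 * 1 - \<alpha> / 2 * (h \<bullet> h) * 1\<^sup>2"
  proof (rule DERIV_nonneg_imp_nondecreasing[where f = "\<lambda>t. g t - g' 0 * t - \<alpha> / 2 * (h \<bullet> h) * t\<^sup>2"])
    fix s :: real assume "0 \<le> s"
    then show "\<exists>y. ((\<lambda>t. g t - g' 0 * t - \<alpha> / 2 * (h \<bullet> h) * t\<^sup>2) has_real_derivative y) (at s) \<and> 0 \<le> y"
      using g'[of s]
      by (intro exI[of _ "g' s - g' 0 - \<alpha> * (h \<bullet> h) * s"]) (auto intro!: derivative_eq_intros dg)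
  qed simp
  then show ?thesis by (simp add: g_def g'_def)
qed

text \<open>Young's inequality spends half of the quadratic coefficient \<open>\<alpha> / 2\<close>
  on the linear term; the remaining \<open>\<alpha> / 4\<close> is the rate \<open>b\<close> of the
  Gaussian bounds.\<close>

lemma strong_convexity_lower_bound:
  fixes V :: "real^'n::finite \<Rightarrow> real"
  assumes t: "\<And>h. V 0 + d \<bullet> h + \<alpha> / 2 * (h \<bullet> h) \<le> V h" and \<alpha>: "0 < \<alpha>"
  shows "V 0 - (norm d)\<^sup>2 / \<alpha> + \<alpha> / 4 * (norm z)\<^sup>2 \<le> V z"
proof -
  have "- (d \<bullet> z) \<le> norm d * norm z" using Cauchy_Schwarz_ineq2[of d z] by linarith
  also have "norm d * norm z \<le> (norm d)\<^sup>2 / \<alpha> + \<alpha> / 4 * (norm z)\<^sup>2"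
  proof -
    have "0 \<le> (norm d - \<alpha> / 2 * norm z)\<^sup>2 / \<alpha>" using \<alpha> by simp
    also have "\<dots> = (norm d)\<^sup>2 / \<alpha> + \<alpha> / 4 * (norm z)\<^sup>2 - norm d * norm z"
      using \<alpha> by (simp add: power2_eq_square field_simps)
    finally show ?thesis by simp
  qed
  finally have "- (d \<bullet> z) \<le> (norm d)\<^sup>2 / \<alpha> + \<alpha> / 4 * (norm z)\<^sup>2" .
  then show ?thesis using t[of z] by (simp add: power2_norm_eq_inner)
qed

lemma vembed_eq_axis: "vembed i1 s y = vembed i1 0 y + s *\<^sub>R axis i1 (1::real)"
  by (simp add: vembed_def vec_eq_iff axis_def)

lemma vembed2_eq: "i \<noteq> i1 \<Longrightarrow> vembed2 i1 i s t y = vembed i1 s (y(i := t))"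
  by (auto simp: vembed_def vembed2_def vec_eq_iff)

lemma measurable_LBINT:
  fixes m :: "real \<Rightarrow> real"
  assumes [measurable]: "m \<in> borel_measurable borel"
  shows "(\<lambda>s. LBINT t=0..ereal s. m t) \<in> borel_measurable borel"
proof -
  have "(LBINT t=0..ereal s. m t) = (if 0 \<le> s then \<integral>t. (if 0 < t \<and> t < s then m t else 0) \<partial>lborel 
      else - (\<integral>t. (if s < t \<and> t < 0 then m t else 0) \<partial>lborel))" for s
    unfolding interval_lebesgue_integral_def set_lebesgue_integral_def zero_ereal_def einterval_eq
    by (auto simp: indicator_def intro!: Bochner_Integration.integral_cong)
  moreover have "(\<lambda>s. if 0 \<le> s then \<integral>t. (if 0 < t \<and> t < s then m t else 0) \<partial>lborel 
      else - (\<integral>t. (if s < t \<and> t < 0 then m t else 0) \<partial>lborel)) \<in> borel_measurable borel"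
    by measurable
  ultimately show ?thesis by simp
qed

theorem mainTheorem3:
  fixes V :: "real^'n::finite \<Rightarrow> real"
    and DV :: "real^'n \<Rightarrow> real^'n"
    and HV :: "real^'n \<Rightarrow> real^'n^'n"
    and i1 :: 'n
    and \<alpha> :: real
    and p :: "real measure"
    and q :: "'n \<Rightarrow> real \<Rightarrow> real measure"
    and \<rho> :: "real^'n \<Rightarrow> real"
  assumes dim: "CARD('n) \<ge> 2"
    and growth: "\<forall>c2>0. \<exists>c1>0. \<forall>z. \<bar>V z\<bar> \<le> c1 * exp (c2 * (norm z)\<^sup>2)"
    and grad: "\<And>z. (V has_derivative (\<lambda>h. DV z \<bullet> h)) (at z)"
    and hess: "\<And>z. (DV has_derivative (\<lambda>h. HV z *v h)) (at z)"
    and hess_cont: "continuous_on UNIV HV"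
    and alpha_pos: "\<alpha> > 0"
    and strong_convex: "\<And>z h. \<alpha> * (h \<bullet> h) \<le> h \<bullet> (HV z *v h)"
    and data: "star_data i1 p q"
    and minimizer: "\<forall>\<mu>\<in>C_star i1. KL (star_measure i1 p q) (gibbs V) \<le> KL \<mu> (gibbs V)"
    and dens_diff: "\<And>z. \<rho> differentiable (at z)"
    and dens_nonneg: "\<And>z. \<rho> z \<ge> 0"
    and dens: "star_measure i1 p q = density lborel (\<lambda>z. ennreal (\<rho> z))"
  shows "(\<exists>c>0. p = density lborel (\<lambda>z1. ennreal (c * exp (-
             (LBINT s=0..z1. (\<integral>y. DV (vembed i1 s y) $ i1 \<partial>(PiM (UNIV - {i1}) (\<lambda>j. q j s))))))))
       \<and> (\<forall>i. i \<noteq> i1 \<longrightarrow>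
           (AE z1 in p. \<exists>c>0. q i z1 = density lborel (\<lambda>zi. ennreal (c * exp (-
               (\<integral>y. V (vembed2 i1 i z1 zi y) \<partial>(PiM (UNIV - {i1, i}) (\<lambda>j. q j z1))))))))"
proof -
  note tangent = strong_convexity_tangent[OF grad hess strong_convex]
  define a where "a = V 0 - (norm (DV 0))\<^sup>2 / \<alpha>"
  have [measurable]: "V \<in> borel_measurable borel"
    using grad by (intro borel_measurable_continuous_onI continuous_at_imp_continuous_on ballI)
      (auto intro: has_derivative_continuous)
  have [measurable]: "DV \<in> borel_measurable borel"
    using hess by (intro borel_measurable_continuous_onI continuous_at_imp_continuous_on ballI)
      (auto intro: has_derivative_continuous)
  have [measurable]: "\<rho> \<in> borel_measurable borel"
    using dens_diff by (intro borel_measurable_continuous_onI continuous_at_imp_continuous_on ballI)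
      (auto intro: differentiable_imp_continuous_within)
  have DV1: "(\<lambda>z. DV z $ i1) \<in> borel_measurable borel" unfolding cart_eq_inner_axis by measurable
  interpret G: gibbs_star V i1 a "\<alpha> / 4"
  proof
    show "a + \<alpha> / 4 * (norm z)\<^sup>2 \<le> V z" for z
      unfolding a_def using tangent[of 0] alpha_pos by (intro strong_convexity_lower_bound) auto
  qed (use alpha_pos growth in auto)
  have "G.J \<noteq> {}"
  proof
    assume "G.J = {}"
    then have "(UNIV :: 'n set) = {i1}" by auto
    then have "CARD('n) = 1" by (metis card_1_singleton_iff One_nat_def)
    then show False using dim by simp
  qed
  then obtain r k where r: "G.dens r" and k: "G.kern k" and p: "p = density lborel (\<lambda>s. ennreal (r s))"
    and q: "AE s in p. \<forall>j\<in>G.J. q j s = G.dK k j s"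
    using G.star_densities[OF data _ dens] by auto
  \<comment> \<open>\<open>q\<close> agrees with the density kernels only for
    \<open>p\<close>-almost every \<open>s\<close>. The star measure does not see the difference, so
    minimality passes to the densities.\<close>
  have star_eq: "star_measure i1 p q = star_measure i1 (density lborel (\<lambda>s. ennreal (r s))) (G.dK k)"
    unfolding p[symmetric] star_measure_def star_kernel_def[symmetric]
  proof (rule bind_cong_AE')
    show "p \<in> space (prob_algebra borel)" using data by (auto simp: star_data_def space_prob_algebra)
    show "star_kernel i1 q \<in> borel \<rightarrow>\<^sub>M prob_algebra borel" "star_kernel i1 (G.dK k) \<in> borel \<rightarrow>\<^sub>M prob_algebra borel"
      using data G.star_data_density[OF r k] by (auto intro!: star_kernel_meas simp: star_data_def)
    show "AE s in p. star_kernel i1 q s = star_kernel i1 (G.dK k) s"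
      using q unfolding star_kernel_def by eventually_elim (auto intro!: arg_cong[where f = "\<lambda>M. distr M _ _"] PiM_cong)
  qed
  interpret M: star_min G.J "\<lambda>s y. V (vembed i1 s y)" a "\<alpha> / 4" r k
    using minimizer unfolding star_eq by (intro G.star_minI[OF r k]) auto
  interpret D: star_diff G.J "\<lambda>s y. V (vembed i1 s y)" a "\<alpha> / 4" r k "\<lambda>s y. DV (vembed i1 s y) $ i1"
  proof
    show "(\<lambda>(s, y). DV (vembed i1 s y) $ i1) \<in> borel_measurable (lborel \<Otimes>\<^sub>M LP G.J)"
    proof -
      have "(\<lambda>x. vembed i1 (fst x) (snd x)) \<in> lborel \<Otimes>\<^sub>M LP G.J \<rightarrow>\<^sub>M borel"
        by (rule vembed_meas_pair) auto
      from measurable_compose[OF this DV1] show ?thesis by (simp only: case_prod_unfold)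
    qed
    show "((\<lambda>s. V (vembed i1 s y)) has_real_derivative DV (vembed i1 s y) $ i1) (at s)" for s y
    proof -
      have "((\<lambda>s. vembed i1 s y) has_derivative (\<lambda>d. d *\<^sub>R axis i1 1)) (at s)"
        by (subst vembed_eq_axis) (auto intro!: derivative_eq_intros)
      from has_derivative_compose[OF this grad] show ?thesis
        unfolding has_field_derivative_def by (rule has_derivative_eq_rhs) (auto simp: fun_eq_iff inner_axis)
    qed
    show "V (vembed i1 s y) + DV (vembed i1 s y) $ i1 * (z - s) \<le> V (vembed i1 z y)" for s z y
    proof -
      have "vembed i1 z y = vembed i1 s y + (z - s) *\<^sub>R axis i1 1"
        by (simp add: vembed_def vec_eq_iff axis_def)
      moreover have "0 \<le> \<alpha> / 2 * (((z - s) *\<^sub>R axis i1 1 :: real^'n) \<bullet> ((z - s) *\<^sub>R axis i1 1))"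
        using alpha_pos by (intro mult_nonneg_nonneg inner_ge_zero) auto
      ultimately show ?thesis
        using tangent[of "vembed i1 s y" "(z - s) *\<^sub>R axis i1 1"] by (simp add: inner_axis mult.commute)
    qed
  qed
  obtain c where c: "0 < c" "AE s in lborel. r s = c * exp (- (LBINT t=0..s. D.m t))"
    using D.first_marginal_formula by auto
  \<comment> \<open>The formula for \<open>r\<close> makes it positive almost everywhere, so
    \<open>p\<close>-almost everywhere becomes Lebesgue-almost everywhere.\<close>
  have qL: "AE s in lborel. \<forall>j\<in>G.J. q j s = G.dK k j s"
  proof -
    have "AE s in lborel. 0 < r s \<longrightarrow> (\<forall>j\<in>G.J. q j s = G.dK k j s)"
      using q unfolding p by (subst (asm) AE_density) auto
    then show ?thesis using c(2) by eventually_elim (use c(1) in auto)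
  qed
  \<comment> \<open>Formed with the given kernels \<open>q\<close>, as in the conclusion; it agrees
    with \<open>D.m\<close> only almost everywhere, and exchanging the two under an integral needs
    its measurability.\<close>
  define m where "m s = (\<integral>y. DV (vembed i1 s y) $ i1 \<partial>(PiM G.J (\<lambda>j. q j s)))" for s
  have mm[measurable]: "m \<in> borel_measurable borel"
    unfolding m_def
  proof (rule kernel_integral_meas)
    show "(\<lambda>s. PiM G.J (\<lambda>j. q j s)) \<in> borel \<rightarrow>\<^sub>M prob_algebra (PiM G.J (\<lambda>_. borel))"
      using data by (intro prob_kernel_PiM) (auto simp: star_data_def)
    show "(\<lambda>(s, y). DV (vembed i1 s y) $ i1) \<in> borel_measurable (borel \<Otimes>\<^sub>M PiM G.J (\<lambda>_. borel))"
    proof -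
      have 1: "(\<lambda>x. vembed i1 (fst x) (snd x)) \<in> borel \<Otimes>\<^sub>M PiM G.J (\<lambda>_. borel) \<rightarrow>\<^sub>M borel"
        by (rule vembed_meas) (auto intro!: measurable_compose[OF measurable_snd measurable_component_singleton])
      from measurable_compose[OF 1 DV1] show ?thesis by (simp only: case_prod_unfold)
    qed
  qed
  have mD: "AE s in lborel. m s = D.m s"
    using qL
  proof eventually_elim
    case (elim s)
    have [measurable]: "(\<lambda>y. G.prod_kernel k s y) \<in> borel_measurable G.LJ" using G.prod_kernel_meas[OF k, of "\<lambda>_. s" G.LJ "\<lambda>y. y"] by simp
    have "PiM G.J (\<lambda>j. q j s) = PiM G.J (\<lambda>j. G.dK k j s)" using elim by (intro PiM_cong) auto
    also have "\<dots> = density G.LJ (\<lambda>y. ennreal (G.prod_kernel k s y))"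
      unfolding G.prod_kernel_def by (rule G.PiM_dK[OF k order_refl])
    finally show ?case unfolding m_def D.m_def
      by (simp add: integral_density G.prod_kernel_nonneg[OF k])
  qed
  have LB: "(LBINT t=0..s. D.m t) = (LBINT t=0..s. m t)" for s :: real
    unfolding interval_lebesgue_integral_def set_lebesgue_integral_def
    by (intro if_cong refl arg_cong[where f = uminus] integral_cong_AE) (use mD in \<open>auto elim!: eventually_mono\<close>)
  have "p = density lborel (\<lambda>s. ennreal (c * exp (- (LBINT t=0..s. m t))))"
    unfolding p
  proof (rule density_cong)
    show "(\<lambda>s. ennreal (r s)) \<in> borel_measurable lborel" by measurable
    have "AE s in lborel. ennreal (r s) = ennreal (c * exp (- (LBINT t=0..s. m t)))"
      using c(2) by eventually_elim (simp add: LB)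
    then show "AE s in lborel. ennreal (r s) = ennreal (c * exp (- (LBINT t=0..s. m t)))" .
    show "(\<lambda>s. ennreal (c * exp (- (LBINT t=0..s. m t)))) \<in> borel_measurable lborel"
      using measurable_LBINT[OF mm] by measurable
  qed
  moreover have "AE s in p. \<exists>c>0. q i s = density lborel (\<lambda>t. ennreal (c * exp (- (\<integral>y. V (vembed2 i1 i s t y) \<partial>(PiM (UNIV - {i1, i}) (\<lambda>j. q j s))))))"
    if i: "i \<noteq> i1" for i
  proof -
    have iJ: "i \<in> G.J" and Ji: "UNIV - {i1, i} = G.J - {i}" using i by auto
    have "AE s in lborel. \<exists>c>0. q i s = density lborel (\<lambda>t. ennreal (c * exp (- (\<integral>y. V (vembed2 i1 i s t y) \<partial>(PiM (UNIV - {i1, i}) (\<lambda>j. q j s))))))"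
      using qL M.AE_good
    proof eventually_elim
      case (elim s)
      note upd = G.upd_meas[OF iJ, measurable (raw)]
      have km[measurable]: "k i s \<in> borel_measurable borel" using G.kern_meas[OF k iJ, of "\<lambda>_. s" lborel "\<lambda>t. t"] by simp
      have fm[measurable]: "(\<lambda>y. G.prod_kernel_off k i s y) \<in> borel_measurable (G.LI i)" using G.prod_kernel_off_meas[OF k, of "\<lambda>_. s" "G.LI i" "\<lambda>y. y"] by simp
      obtain c where c: "0 < c" "AE t in lborel. k i s t = c * exp (- (\<integral>y. G.prod_kernel_off k i s y * V (vembed i1 s (y(i := t))) \<partial>G.LI i))"
        using G.good_conditional[OF k elim(2) iJ] by auto
      have "PiM (UNIV - {i1, i}) (\<lambda>j. q j s) = PiM (G.J - {i}) (\<lambda>j. G.dK k j s)"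
        unfolding Ji using elim(1) by (intro PiM_cong) auto
      also have "\<dots> = density (G.LI i) (\<lambda>y. ennreal (G.prod_kernel_off k i s y))"
        unfolding G.prod_kernel_off_def by (rule G.PiM_dK[OF k]) auto
      finally have int: "(\<integral>y. V (vembed2 i1 i s t y) \<partial>(PiM (UNIV - {i1, i}) (\<lambda>j. q j s))) = (\<integral>y. G.prod_kernel_off k i s y * V (vembed i1 s (y(i := t))) \<partial>G.LI i)" for t
        unfolding vembed2_eq[OF i] by (simp add: integral_density G.prod_kernel_off_nonneg[OF k])
      interpret I: sigma_finite_measure "G.LI i" by (intro sigma_finite_LP) auto
      have "(\<lambda>t. \<integral>y. G.prod_kernel_off k i s y * V (vembed i1 s (y(i := t))) \<partial>G.LI i) \<in> borel_measurable lborel"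
        by measurable
      then have "density lborel (\<lambda>t. ennreal (k i s t)) = density lborel (\<lambda>t. ennreal (c * exp (- (\<integral>y. G.prod_kernel_off k i s y * V (vembed i1 s (y(i := t))) \<partial>G.LI i))))"
        using c(2) by (intro density_cong) (auto elim!: eventually_mono)
      then show ?case unfolding int using c(1) elim(1) iJ by (intro exI[of _ c]) (auto simp: G.dK_def)
    qed
    then show ?thesis unfolding p by (subst AE_density) auto
  qed
  ultimately show ?thesis using c(1) unfolding m_def by blast
qed

end
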